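(* Let $\Omega\subset\mathbb{R}^n$ be a bounded extension domain for $W^{s,p}$, let $q\in(1,\infty)\cap(\tfrac{n}{sp},\infty)$, and let $\mathcal{C}$ be a nonempty bounded closed convex subset of $L^q(\Omega)$. Then there exists a unique $V^*\in\mathcal{C}$ such that $$\lambda(V^* )=\max\{\lambda(V)\colon V\in\mathcal{C}\},$$ and there exists $V_*\in\mathcal{C}$ (not necessarily unique) such that $$\lambda(V_* )=\min\{\lambda(V)\colon V\in\mathcal{C}\}.$$
   Context: Fix $n\ge 1$, $0<s<1<p<\infty$. For an open set $\Omega\subset\mathbb{R}^n$, $W^{s,p}(\Omega)$ is the space of $u\in L^p(\Omega)$ with $[u]_{s,p;\Omega}:=\left(\iint_{\Omega\times\Omega}\frac{|u(x)-u(y)|^p}{|x-y|^{n+sp}}\,dx\,dy\right)^{1/p}<\infty$, normed by $\|u\|_{s,p;\Omega}=(\|u\|_{L^p(\Omega)}^p+[u]_{s,p;\Omega}^p)^{1/p}$. When $\Omega=\mathbb{R}^n$ the set is omitted: $[u]_{s,p}$, $\|u\|_{s,p}$, $\|u\|_p$. An open set $\Omega$ is an extension domain for $W^{s,p}$ if there is $C=C(n,s,p,\Omega)>0$ such that every $u\in W^{s,p}(\Omega)$ has an extension $\tilde u\in W^{s,p}(\mathbb{R}^n)$ with $\tilde u=u$ on $\Omega$ and $\|\tilde u\|_{s,p}\le C\|u\|_{s,p;\Omega}$. $\widetilde W^{s,p}(\Omega)$ is the space of all $u\in W^{s,p}(\Omega)$ whose extension by zero outside $\Omega$ belongs to $W^{s,p}(\mathbb{R}^n)$,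 normed by the $W^{s,p}(\mathbb{R}^n)$ norm of the zero extension; such $u$ are always identified with their zero extension to $\mathbb{R}^n$. For $V\in L^q(\Omega)$, $$\lambda(V)=\inf\left\{\tfrac12[u]_{s,p}^p+\int_\Omega V(x)|u|^p\,dx\colon u\in\widetilde W^{s,p}(\Omega),\ \|u\|_p=1\right\}.$$ *)

theory Defs
  imports "HOL-Analysis.Analysis"
begin

text \<open>
  Elements of Lebesgue and Sobolev spaces are represented by functions on the whole space of
  which only the values on \<open>\<Omega>\<close> matter, and only up to a null set: every notion below for a single function is
  invariant under changing the function on a null subset of \<open>\<Omega>\<close> or outside \<open>\<Omega>\<close>.
  Identity of elements is equality almost everywhere with respect to \<^term>\<open>lebesgue_on \<Omega>\<close>.
\<close>

definition Lp_space :: "real \<Rightarrow> 'a::euclidean_space set \<Rightarrow> ('a \<Rightarrow> real) set" where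
  "Lp_space p \<Omega> =
     {u \<in> borel_measurable (lebesgue_on \<Omega>). integrable (lebesgue_on \<Omega>) (\<lambda>x. \<bar>u x\<bar> powr p)}"

definition Lp_norm :: "real \<Rightarrow> 'a::euclidean_space set \<Rightarrow> ('a \<Rightarrow> real) \<Rightarrow> real" where
  "Lp_norm p \<Omega> u = (LINT x|lebesgue_on \<Omega>. \<bar>u x\<bar> powr p) powr (1 / p)"

definition gagliardo_integral ::
    "real \<Rightarrow> real \<Rightarrow> 'a::euclidean_space set \<Rightarrow> ('a \<Rightarrow> real) \<Rightarrow> ennreal" where
  "gagliardo_integral s p \<Omega> u =
     (\<integral>\<^sup>+ x. (\<integral>\<^sup>+ y. ennreal (\<bar>u x - u y\<bar> powr p / norm (x - y) powr (real DIM('a) + s * p))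
        \<partial>lebesgue_on \<Omega>) \<partial>lebesgue_on \<Omega>)"

definition sobolev_space ::
    "real \<Rightarrow> real \<Rightarrow> 'a::euclidean_space set \<Rightarrow> ('a \<Rightarrow> real) set" where
  "sobolev_space s p \<Omega> = {u \<in> Lp_space p \<Omega>. gagliardo_integral s p \<Omega> u < \<infinity>}"

text \<open>The real-valued seminorm is meaningful only where the defining integral is finite, i.e.
  on \<^const>\<open>sobolev_space\<close>; it is not used elsewhere.\<close>

definition gagliardo_seminorm ::
    "real \<Rightarrow> real \<Rightarrow> 'a::euclidean_space set \<Rightarrow> ('a \<Rightarrow> real) \<Rightarrow> real" where
  "gagliardo_seminorm s p \<Omega> u = enn2real (gagliardo_integral s p \<Omega> u) powr (1 / p)"

definition sobolev_norm ::
    "real \<Rightarrow> real \<Rightarrow> 'a::euclidean_space set \<Rightarrow> ('a \<Rightarrow> real) \<Rightarrow> real" where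
  "sobolev_norm s p \<Omega> u =
     (Lp_norm p \<Omega> u powr p + gagliardo_seminorm s p \<Omega> u powr p) powr (1 / p)"

definition extension_domain :: "real \<Rightarrow> real \<Rightarrow> 'a::euclidean_space set \<Rightarrow> bool" where
  "extension_domain s p \<Omega> \<longleftrightarrow>
     open \<Omega> \<and>
     (\<exists>C>0. \<forall>u \<in> sobolev_space s p \<Omega>. \<exists>v \<in> sobolev_space s p UNIV.
        (AE x in lebesgue_on \<Omega>. v x = u x) \<and> sobolev_norm s p UNIV v \<le> C * sobolev_norm s p \<Omega> u)"

definition zero_ext :: "'a set \<Rightarrow> ('a \<Rightarrow> real) \<Rightarrow> 'a \<Rightarrow> real" where
  "zero_ext \<Omega> u = (\<lambda>x. if x \<in> \<Omega> then u x else 0)"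

definition sobolev_space0 ::
    "real \<Rightarrow> real \<Rightarrow> 'a::euclidean_space set \<Rightarrow> ('a \<Rightarrow> real) set" where
  "sobolev_space0 s p \<Omega> = {u \<in> sobolev_space s p \<Omega>. zero_ext \<Omega> u \<in> sobolev_space s p UNIV}"

text \<open>The infimum is taken in \<^typ>\<open>ereal\<close>, so that it is the true infimum without a separate
  proof that the set of values is nonempty and bounded below. For \<open>q > n/(sp)\<close>, \<open>q > 1\<close> and
  \<open>\<Omega>\<close> a bounded extension domain, the integrand \<open>V \<bar>u\<bar>\<^sup>p\<close> is integrable by the fractional
  Sobolev embedding, so the Bochner integral is the intended one.\<close>

definition eigenvalue ::
    "real \<Rightarrow> real \<Rightarrow> 'a::euclidean_space set \<Rightarrow> ('a \<Rightarrow> real) \<Rightarrow> ereal" where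
  "eigenvalue s p \<Omega> V =
     (INF u \<in> {u \<in> sobolev_space0 s p \<Omega>. Lp_norm p UNIV (zero_ext \<Omega> u) = 1}.
        ereal (1 / 2 * gagliardo_seminorm s p UNIV (zero_ext \<Omega> u) powr p
               + (LINT x|lebesgue_on \<Omega>. V x * \<bar>u x\<bar> powr p)))"

definition Lp_bounded :: "real \<Rightarrow> 'a::euclidean_space set \<Rightarrow> ('a \<Rightarrow> real) set \<Rightarrow> bool" where
  "Lp_bounded q \<Omega> \<C> \<longleftrightarrow> (\<exists>M. \<forall>V\<in>\<C>. Lp_norm q \<Omega> V \<le> M)"

text \<open>Norm closedness, as closure under limits of sequences. Constant sequences show that
  a closed set contains, with any function, all its almost everywhere equal representatives,
  so closed sets of functions correspond exactly to closed sets of classes.\<close>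

definition Lp_closed :: "real \<Rightarrow> 'a::euclidean_space set \<Rightarrow> ('a \<Rightarrow> real) set \<Rightarrow> bool" where
  "Lp_closed q \<Omega> \<C> \<longleftrightarrow>
     (\<forall>F V. (\<forall>k::nat. F k \<in> \<C>) \<longrightarrow> V \<in> Lp_space q \<Omega> \<longrightarrow>
        (\<lambda>k. Lp_norm q \<Omega> (\<lambda>x. F k x - V x)) \<longlonglongrightarrow> 0 \<longrightarrow> V \<in> \<C>)"

text \<open>The library's \<^const>\<open>convex\<close> needs a \<open>real_vector\<close> instance, which the function type
  lacks.\<close>

definition fun_convex :: "('a \<Rightarrow> real) set \<Rightarrow> bool" where
  "fun_convex \<C> \<longleftrightarrow>
     (\<forall>V\<in>\<C>. \<forall>W\<in>\<C>. \<forall>a\<ge>0. \<forall>b\<ge>0. a + b = 1 \<longrightarrow> (\<lambda>x. a * V x + b * W x) \<in> \<C>)"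

end

theory Submission
  imports Defs "HOL-Complex_Analysis.Great_Picard"
begin

text \<open>
  Write \<open>E u\<close> for the Gagliardo integral of \<open>u\<close> over the whole space, and
  \<open>J V u = E u / 2 + \<integral> V \<bar>u\<bar>\<^sup>p\<close>, so that \<open>\<lambda>(V)\<close> is the infimum of \<open>J V\<close> over the functions of
  finite energy that vanish outside \<open>\<Omega>\<close> and have \<open>L\<^sup>p\<close> norm \<open>1\<close>.
  
  \<^item> Everything rests on the estimate
    \<open>\<integral> \<bar>V\<bar> \<bar>u\<bar>\<^sup>p \<le> \<parallel>V\<parallel>\<^sub>q (\<epsilon> E u + K(\<epsilon>) \<parallel>u\<parallel>\<^sub>p\<^sup>p)\<close> (\<open>form_bound\<close>), which holds for
    every \<open>\<epsilon> > 0\<close> and every \<open>V\<close> that vanishes outside \<open>\<Omega>\<close>, because \<open>q > n/(sp)\<close>. Let \<open>u\<^sub>k\<close> be the function that equals, on each dyadic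
    cube of side \<open>2\<^sup>-\<^sup>k\<close>, the mean of \<open>u\<close> over that cube. Jensen's inequality gives
    \<open>\<parallel>u - u\<^sub>k\<parallel>\<^sub>p\<^sup>p \<le> C 2\<^sup>-\<^sup>k\<^sup>s\<^sup>p E u\<close>, and Hoelder's inequality on single cubes turns this into a
    bound for \<open>\<integral> \<bar>V\<bar> \<bar>u\<^sub>k\<^sub>+\<^sub>1 - u\<^sub>k\<bar>\<^sup>p\<close> that decays geometrically with ratio \<open>2\<close> to the power
    \<open>n/q - sp\<close>; summing over the scales gives the estimate. The same averages give compactness
    in \<open>L\<^sup>p\<close> (\<open>zero_sobolev_compact\<close>): up to a small error, a bounded sequence is described by
    countably many means, to which a diagonal argument applies.
  
  \<^item> Minimisers of \<open>J V\<close> exist by the direct method (\<open>minimizing_limit\<close>), and it works equally for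
    a sequence of varying potentials that is bounded in \<open>L\<^sup>q\<close>.
  
  \<^item> A decreasing sequence of nonempty, bounded, closed, convex sets in \<open>L\<^sup>q\<close> has a common point
    (\<open>nested_convex_Lp\<close>), because elements of almost minimal norm form a Cauchy sequence by
    uniform convexity. Hence a function on \<open>\<C>\<close> whose superlevel sets are closed and convex attains
    its maximum. As an infimum of the functions \<open>V \<mapsto> J V u\<close>, which are affine and continuous,
    \<open>\<lambda>\<close> is such a function. For the minimum, \<open>inf \<lambda>\<close> is the infimum of \<open>J V u\<close> over
    both variables; the direct method yields \<open>u\<close> with \<open>inf\<^sub>V J V u = inf \<lambda>\<close>, and the
    affine function \<open>V \<mapsto> J V u\<close> attains its minimum on \<open>\<C>\<close>.
  
  \<^item> If \<open>V\<close> and \<open>W\<close> are both maximal, then by concavity so is their midpoint, and the minimiser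
    \<open>u \<ge> 0\<close> for the midpoint is a minimiser for \<open>V\<close> and for \<open>W\<close>. Subtracting the two
    Euler-Lagrange equations gives \<open>(V - W) u\<^sup>p\<^sup>-\<^sup>1 = 0\<close> almost everywhere in \<open>\<Omega>\<close>, and
    \<open>u > 0\<close> almost everywhere in \<open>\<Omega>\<close> (\<open>minimizer_positive\<close>). The latter is shown as follows. Let
    \<open>\<phi>\<close> be the distance to the complement of \<open>\<Omega>\<close>. Submodularity of \<open>E\<close> and minimality of
    \<open>m u\<close> bound the energies of \<open>min (m u) \<phi>\<close> uniformly in \<open>m\<close>, so the restriction of \<open>\<phi>\<close> to
    \<open>{u > 0}\<close> has finite energy, and so has its restriction \<open>\<psi>\<close> to \<open>{u = 0}\<close>. Testing the
    Euler-Lagrange equation with \<open>\<psi>\<close>, only the nonlocal interaction of \<open>{\<psi> > 0}\<close> with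
    \<open>{u > 0}\<close> survives; it has a sign, so \<open>{\<psi> > 0}\<close> is a null set.
\<close>

section \<open>Inequalities for powers of absolute values\<close>

lemma abs_add_powr_le:
  fixes a b p :: real
  assumes "p \<ge> 0"
  shows "\<bar>a + b\<bar> powr p \<le> 2 powr p * (\<bar>a\<bar> powr p + \<bar>b\<bar> powr p)"
proof -
  have "\<bar>a + b\<bar> powr p \<le> (2 * max \<bar>a\<bar> \<bar>b\<bar>) powr p"
    using assms by (intro powr_mono2) auto
  also have "\<dots> = 2 powr p * max \<bar>a\<bar> \<bar>b\<bar> powr p"
    by (simp add: powr_mult)
  also have "\<dots> \<le> 2 powr p * (\<bar>a\<bar> powr p + \<bar>b\<bar> powr p)"
    by (intro mult_left_mono) (auto simp: max_def)
  finally show ?thesis .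
qed

lemma abs_diff_powr_le:
  fixes a b p :: real
  assumes "p \<ge> 0"
  shows "\<bar>a - b\<bar> powr p \<le> 2 powr p * (\<bar>a\<bar> powr p + \<bar>b\<bar> powr p)"
  using abs_add_powr_le[OF assms, of a "-b"] by simp

lemma powr_above_tangent:
  fixes a m p :: real
  assumes p: "p > 1" and "a \<ge> 0" and m: "m > 0"
  shows "a powr p \<ge> m powr p + p * m powr (p - 1) * (a - m)"
proof (cases "a = 0")
  case True
  have "m powr (p - 1) * m = m powr p"
    using m by (simp add: powr_diff)
  then have "m powr p + p * m powr (p - 1) * (a - m) = (1 - p) * m powr p"
    using True by (simp add: algebra_simps)
  also have "\<dots> \<le> 0" using p by (simp add: mult_nonpos_nonneg)
  finally show ?thesis using True by simp
next
  case False
  have "p * m powr (p - 1) * (a - m) \<le> a powr p - m powr p"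
    using powr_convex[of p] p m False assms(2)
    by (intro convex_on_imp_above_tangent[where A="{0<..}"] DERIV_subset[OF has_real_derivative_powr])
       (auto simp: interior_open)
  then show ?thesis by linarith
qed

lemma midpoint_powr_less:
  fixes x y p :: real
  assumes p: "p > 1" and x: "0 \<le> x" and xy: "x < y"
  shows "((x + y) / 2) powr p < (x powr p + y powr p) / 2"
proof -
  define m where "m = (x + y) / 2"
  have m: "m > 0" "x < m" "m < y" using x xy by (auto simp: m_def)
  obtain z where z: "m < z" "z < y" "y powr p - m powr p = (y - m) * (p * z powr (p - 1))"
    using MVT2[of m y "\<lambda>z. z powr p" "\<lambda>z. p * z powr (p - 1)"] m
      has_real_derivative_powr by force
  have "m powr (p - 1) < z powr (p - 1)" using z m p by (intro powr_less_mono2) auto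
  then have 1: "y powr p - m powr p > (y - m) * (p * m powr (p - 1))"
    using z p by (simp add: m)
  have 2: "x powr p \<ge> m powr p + p * m powr (p - 1) * (x - m)"
    using powr_above_tangent[OF p x m(1)] .
  have "x - m = - (y - m)" by (simp add: m_def field_simps)
  with 1 2 show ?thesis unfolding m_def[symmetric] by (simp add: algebra_simps)
qed

lemma abs_midpoint_powr_less:
  fixes a b p :: real
  assumes p: "p > 1" and "a \<noteq> b"
  shows "\<bar>(a + b) / 2\<bar> powr p < (\<bar>a\<bar> powr p + \<bar>b\<bar> powr p) / 2"
proof (cases "\<bar>a\<bar> = \<bar>b\<bar>")
  case True
  then have "b = - a" "a \<noteq> 0" using assms(2) by auto
  then show ?thesis by simp
next
  case False
  have "\<bar>(a + b) / 2\<bar> powr p \<le> ((\<bar>a\<bar> + \<bar>b\<bar>) / 2) powr p"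
    using p by (intro powr_mono2) auto
  also have "\<dots> < (\<bar>a\<bar> powr p + \<bar>b\<bar> powr p) / 2"
    using midpoint_powr_less[OF p, of "\<bar>a\<bar>" "\<bar>b\<bar>"] midpoint_powr_less[OF p, of "\<bar>b\<bar>" "\<bar>a\<bar>"] False
    by (cases "\<bar>a\<bar> < \<bar>b\<bar>") (auto simp: add.commute)
  finally show ?thesis .
qed

lemma continuous_on_abs_powr:
  fixes f :: "'a::topological_space \<Rightarrow> real"
  assumes "p > 0" "continuous_on S f"
  shows "continuous_on S (\<lambda>x. \<bar>f x\<bar> powr p)"
  using assms by (intro continuous_on_powr' continuous_intros) auto

text \<open>
  A quantitative form of strict convexity of \<open>\<bar>t\<bar>\<^sup>q\<close>. By homogeneity it is enough to consider
  \<open>\<bar>a\<bar>\<^sup>q + \<bar>b\<bar>\<^sup>q = 1\<close>; where \<open>\<bar>a - b\<bar>\<^sup>q \<ge> e\<close> on this compact set, the convexity defect has a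
  positive minimum.
\<close>

lemma powr_uniform_convexity:
  fixes q e :: real
  assumes q: "q > 1" and e: "e > 0"
  obtains C where "C > 0"
    "\<And>a b. \<bar>a - b\<bar> powr q \<le> e * (\<bar>a\<bar> powr q + \<bar>b\<bar> powr q)
        + C * ((\<bar>a\<bar> powr q + \<bar>b\<bar> powr q) / 2 - \<bar>(a + b) / 2\<bar> powr q)"
proof -
  define d :: "real \<times> real \<Rightarrow> real"
    where "d = (\<lambda>(a, b). (\<bar>a\<bar> powr q + \<bar>b\<bar> powr q) / 2 - \<bar>(a + b) / 2\<bar> powr q)"
  define S where "S = {z::real \<times> real. \<bar>fst z\<bar> powr q + \<bar>snd z\<bar> powr q = 1 \<and> e \<le> \<bar>fst z - snd z\<bar> powr q}"
  have d_nonneg: "d (a, b) \<ge> 0" for a b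
    using abs_midpoint_powr_less[OF q, of a b] q by (cases "a = b") (auto simp: d_def abs_mult)
  have abs_le1: "\<bar>fst z\<bar> \<le> 1 \<and> \<bar>snd z\<bar> \<le> 1" if "\<bar>fst z\<bar> powr q + \<bar>snd z\<bar> powr q = 1" for z :: "real \<times> real"
  proof -
    have *: "\<bar>a\<bar> \<le> 1" if "\<bar>a\<bar> powr q \<le> 1" for a :: real
    proof (rule ccontr)
      assume "\<not> \<bar>a\<bar> \<le> 1"
      then have "1 powr q < \<bar>a\<bar> powr q" using q by (intro powr_less_mono2) auto
      with that show False by simp
    qed
    show ?thesis using that by (intro conjI *) (use powr_ge_zero[of "\<bar>fst z\<bar>" q] powr_ge_zero[of "\<bar>snd z\<bar>" q] in linarith)+
  qed
  have "closed S" unfolding S_def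
    by (intro closed_Collect_conj closed_Collect_eq closed_Collect_le continuous_intros continuous_on_abs_powr)
       (use q in auto)
  moreover have "S \<subseteq> cbox (-1, -1) (1, 1)"
  proof
    fix z assume "z \<in> S"
    then have "\<bar>fst z\<bar> \<le> 1" "\<bar>snd z\<bar> \<le> 1" using abs_le1[of z] by (auto simp: S_def)
    then have "fst z \<in> cbox (-1) 1" "snd z \<in> cbox (-1) 1" unfolding cbox_interval atLeastAtMost_iff by linarith+
    then show "z \<in> cbox (-1, -1) (1, 1)" unfolding cbox_Pair_eq by (simp add: mem_Times_iff)
  qed
  ultimately have "compact S"
    by (meson bounded_cbox bounded_subset compact_eq_bounded_closed)
  have "\<exists>c>0. \<forall>z\<in>S. c \<le> d z"
  proof (cases "S = {}")
    case False
    have "continuous_on S d" unfolding d_def case_prod_beta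
      by (intro continuous_intros continuous_on_abs_powr) (use q in auto)
    then obtain z where z: "z \<in> S" "\<And>y. y \<in> S \<Longrightarrow> d z \<le> d y"
      using continuous_attains_inf[OF \<open>compact S\<close> False] by blast
    have "fst z \<noteq> snd z" using z(1) e by (auto simp: S_def)
    then have "d z > 0"
      using abs_midpoint_powr_less[OF q, of "fst z" "snd z"] by (simp add: d_def case_prod_beta)
    then show ?thesis using z by blast
  qed (auto intro: exI[of _ 1])
  then obtain c where c: "c > 0" "\<And>z. z \<in> S \<Longrightarrow> c \<le> d z" by blast
  define C where "C = 2 powr q / c"
  have main: "\<bar>a - b\<bar> powr q \<le> e + C * d (a, b)"
    if 1: "\<bar>a\<bar> powr q + \<bar>b\<bar> powr q = 1" for a b
  proof (cases "(a, b) \<in> S")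
    case True
    have "\<bar>a - b\<bar> powr q \<le> 2 powr q"
      using abs_le1[of "(a, b)"] 1 q by (intro powr_mono2) auto
    also have "\<dots> \<le> C * d (a, b)" using c(2)[OF True] c(1)
      by (simp add: C_def field_simps)
    finally show ?thesis using e by simp
  next
    case False
    then have "\<bar>a - b\<bar> powr q \<le> e" using 1 by (auto simp: S_def)
    moreover have "C * d (a, b) \<ge> 0" using d_nonneg c(1) by (simp add: C_def)
    ultimately show ?thesis by simp
  qed
  show ?thesis
  proof (rule that)
    show "C > 0" using c by (simp add: C_def)
    fix a b :: real
    define t where "t = \<bar>a\<bar> powr q + \<bar>b\<bar> powr q"
    show "\<bar>a - b\<bar> powr q \<le> e * (\<bar>a\<bar> powr q + \<bar>b\<bar> powr q)
        + C * ((\<bar>a\<bar> powr q + \<bar>b\<bar> powr q) / 2 - \<bar>(a + b) / 2\<bar> powr q)"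
    proof (cases "t = 0")
      case True
      then have "\<bar>a\<bar> powr q = 0" "\<bar>b\<bar> powr q = 0"
        using add_nonneg_eq_0_iff[of "\<bar>a\<bar> powr q" "\<bar>b\<bar> powr q"] by (auto simp: t_def)
      then show ?thesis by auto
    next
      case False
      then have t: "t > 0" by (simp add: t_def order_less_le)
      \<comment> \<open>the scaling factor that normalises \<open>\<bar>a\<bar>\<^sup>q + \<bar>b\<bar>\<^sup>q\<close> to \<open>1\<close>\<close>
      define r where "r = t powr (- 1 / q)"
      have "r powr q = t powr (- 1 / q * q)" by (simp only: r_def powr_powr)
      then have r: "r > 0" "r powr q = 1 / t" using t q by (simp_all add: r_def powr_minus_divide)
      have sc: "\<bar>r * x\<bar> powr q = \<bar>x\<bar> powr q / t" for x
        using r by (simp add: abs_mult powr_mult)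
      have "\<bar>r * a\<bar> powr q + \<bar>r * b\<bar> powr q = 1"
        unfolding sc using t by (simp add: t_def add_divide_distrib[symmetric])
      from main[OF this] have *: "\<bar>r * (a - b)\<bar> powr q \<le> e + C * ((\<bar>r * a\<bar> powr q + \<bar>r * b\<bar> powr q) / 2 - \<bar>r * ((a + b) / 2)\<bar> powr q)"
        by (simp add: d_def algebra_simps)
      show ?thesis using * t unfolding sc by (simp add: t_def[symmetric] field_simps)
    qed
  qed
qed

lemma abs_powr_diff_le:
  fixes p e :: real
  assumes p: "p > 0" and e: "e > 0"
  obtains C where "C > 0" "\<And>a b. \<bar>\<bar>a\<bar> powr p - \<bar>b\<bar> powr p\<bar> \<le> e * \<bar>b\<bar> powr p + C * \<bar>a - b\<bar> powr p"
proof -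
  have "((\<lambda>h. (1 + h) powr p) \<longlongrightarrow> (1 + 0) powr p) (at (0::real))"
    by (intro tendsto_intros) auto
  moreover have "((\<lambda>h. (1 - h) powr p) \<longlongrightarrow> (1 - 0) powr p) (at (0::real))"
    by (intro tendsto_intros) auto
  ultimately have "((\<lambda>h. (1 + h) powr p) \<longlongrightarrow> 1) (at_right (0::real))" "((\<lambda>h. (1 - h) powr p) \<longlongrightarrow> 1) (at_right (0::real))"
    by (auto intro: tendsto_mono[OF at_le])
  then have "\<forall>\<^sub>F h in at_right (0::real). (1 + h) powr p < 1 + e" "\<forall>\<^sub>F h in at_right (0::real). (1 - h) powr p > 1 - e"
    using e by (auto intro: order_tendstoD)
  moreover have "\<forall>\<^sub>F h in at_right (0::real). h < 1" "\<forall>\<^sub>F h in at_right (0::real). h > 0"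
    by (auto simp: eventually_at_right_less eventually_at_right_field intro: exI[of _ 1])
  ultimately have "\<forall>\<^sub>F h in at_right (0::real). (1 + h) powr p < 1 + e \<and> (1 - h) powr p > 1 - e \<and> h < 1 \<and> h > 0"
    by eventually_elim auto
  then obtain h where h: "(1 + h) powr p < 1 + e" "(1 - h) powr p > 1 - e" "h < 1" "h > 0"
    by (auto dest: eventually_happens)
  define C where "C = (1 + 1/h) powr p + (1/h) powr p"
  show ?thesis
  proof (rule that)
    have "(1/h) powr p > 0" using h by simp
    then show "C > 0" unfolding C_def by (intro add_nonneg_pos) auto
    fix a b :: real
    show "\<bar>\<bar>a\<bar> powr p - \<bar>b\<bar> powr p\<bar> \<le> e * \<bar>b\<bar> powr p + C * \<bar>a - b\<bar> powr p"
    proof (cases "\<bar>a - b\<bar> \<le> h * \<bar>b\<bar>")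
      case True
      have "\<bar>a\<bar> powr p \<le> ((1 + h) * \<bar>b\<bar>) powr p"
        using True p by (intro powr_mono2) (auto simp: algebra_simps)
      also have "\<dots> \<le> (1 + e) * \<bar>b\<bar> powr p"
        using h by (simp add: powr_mult mult_right_mono)
      finally have 1: "\<bar>a\<bar> powr p - \<bar>b\<bar> powr p \<le> e * \<bar>b\<bar> powr p" by (simp add: algebra_simps)
      have "(1 - e) * \<bar>b\<bar> powr p \<le> ((1 - h) * \<bar>b\<bar>) powr p"
        using h by (simp add: powr_mult mult_right_mono)
      also have "\<dots> \<le> \<bar>a\<bar> powr p"
        using True p h mult_right_mono[of h 1 "\<bar>b\<bar>"] by (intro powr_mono2) (auto simp: algebra_simps)
      finally have 2: "\<bar>b\<bar> powr p - \<bar>a\<bar> powr p \<le> e * \<bar>b\<bar> powr p" by (simp add: algebra_simps)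
      have "C * \<bar>a - b\<bar> powr p \<ge> 0" using h by (simp add: C_def)
      with 1 2 show ?thesis by linarith
    next
      case False
      then have b: "\<bar>b\<bar> \<le> (1/h) * \<bar>a - b\<bar>" using h by (simp add: field_simps)
      then have a: "\<bar>a\<bar> \<le> (1 + 1/h) * \<bar>a - b\<bar>" by (simp add: algebra_simps)
      have "\<bar>b\<bar> powr p \<le> ((1/h) * \<bar>a - b\<bar>) powr p" using b p by (intro powr_mono2) auto
      moreover have "\<bar>a\<bar> powr p \<le> ((1 + 1/h) * \<bar>a - b\<bar>) powr p" using a p by (intro powr_mono2) auto
      ultimately have "\<bar>a\<bar> powr p + \<bar>b\<bar> powr p \<le> C * \<bar>a - b\<bar> powr p"
        unfolding C_def by (simp only: powr_mult distrib_right[of "(1 + 1/h) powr p"])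
      moreover have "e * \<bar>b\<bar> powr p \<ge> 0" using e by simp
      moreover have "\<bar>\<bar>a\<bar> powr p - \<bar>b\<bar> powr p\<bar> \<le> \<bar>a\<bar> powr p + \<bar>b\<bar> powr p"
        by (smt (verit) powr_ge_zero)
      ultimately show ?thesis by linarith
    qed
  qed
qed

lemma has_real_derivative_abs_powr:
  fixes p x :: real
  assumes p: "p > 1"
  shows "((\<lambda>x. \<bar>x\<bar> powr p) has_real_derivative p * sgn x * \<bar>x\<bar> powr (p - 1)) (at x)"
proof -
  consider "x > 0" | "x < 0" | "x = 0" by linarith
  then show ?thesis
  proof cases
    case 1
    have "((\<lambda>x. x powr p) has_real_derivative p * sgn x * \<bar>x\<bar> powr (p - 1)) (at x)"
      using has_real_derivative_powr[OF 1] 1 by simp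
    moreover have "\<forall>\<^sub>F y in nhds x. y powr p = \<bar>y\<bar> powr p"
      using eventually_nhds_in_open[of "{0<..}" x] 1 by (auto elim!: eventually_mono)
    ultimately show ?thesis by (subst DERIV_cong_ev[OF refl _ refl]) (auto elim!: eventually_mono)
  next
    case 2
    have "((\<lambda>x. (- x) powr p) has_real_derivative p * sgn x * \<bar>x\<bar> powr (p - 1)) (at x)"
      using 2 by (auto intro!: derivative_eq_intros DERIV_chain'[OF _ has_real_derivative_powr] simp: powr_diff)
    moreover have "\<forall>\<^sub>F y in nhds x. (- y) powr p = \<bar>y\<bar> powr p"
      using eventually_nhds_in_open[of "{..<0}" x] 2 by (auto elim!: eventually_mono)
    ultimately show ?thesis by (subst DERIV_cong_ev[OF refl _ refl]) (auto elim!: eventually_mono)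
  next
    case 3
    have "((\<lambda>h. \<bar>h\<bar> powr p / h) \<longlongrightarrow> 0) (at (0::real))"
    proof (rule Lim_null_comparison)
      show "\<forall>\<^sub>F h in at (0::real). norm (\<bar>h\<bar> powr p / h) \<le> \<bar>h\<bar> powr (p - 1)"
        by (auto simp: eventually_at powr_diff intro!: exI[of _ 1])
      have "isCont (\<lambda>h. \<bar>h\<bar> powr (p - 1)) (0::real)"
        using continuous_on_abs_powr[of "p - 1" UNIV "\<lambda>x::real. x"] p
        by (simp add: continuous_on_eq_continuous_at)
      then show "((\<lambda>h. \<bar>h\<bar> powr (p - 1)) \<longlongrightarrow> 0) (at (0::real))" by (simp add: isCont_def)
    qed
    then show ?thesis using 3 by (simp add: has_field_derivative_iff)
  qed
qed

text \<open>
  An increment bound that is linear in \<open>t\<close> and homogeneous of degree \<open>p\<close> in \<open>(a, b)\<close>, so that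
  the difference quotients at \<open>t = 0\<close> are dominated by \<open>p\<close>-th powers.
\<close>

lemma abs_powr_increment_le:
  fixes p a b t :: real
  assumes p: "p > 1" and t: "\<bar>t\<bar> \<le> 1"
  shows "\<bar>\<bar>a + t * b\<bar> powr p - \<bar>a\<bar> powr p\<bar> \<le> \<bar>t\<bar> * (p * (\<bar>a\<bar> + \<bar>b\<bar>) powr p)"
proof -
  have dv: "((\<lambda>s. \<bar>a + s * b\<bar> powr p) has_real_derivative (p * sgn (a + s * b) * \<bar>a + s * b\<bar> powr (p - 1)) * b) (at s)" for s
    by (rule DERIV_chain2[OF has_real_derivative_abs_powr[OF p]]) (auto intro!: derivative_eq_intros)
  have "norm (\<bar>a + t * b\<bar> powr p - \<bar>a + 0 * b\<bar> powr p) \<le> (p * (\<bar>a\<bar> + \<bar>b\<bar>) powr p) * norm (t - 0)"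
  proof (rule field_differentiable_bound[where S="{-1..1}" and f'="\<lambda>s. (p * sgn (a + s * b) * \<bar>a + s * b\<bar> powr (p - 1)) * b"])
    fix s :: real assume s: "s \<in> {-1..1}"
    show "((\<lambda>s. \<bar>a + s * b\<bar> powr p) has_real_derivative (p * sgn (a + s * b) * \<bar>a + s * b\<bar> powr (p - 1)) * b) (at s within {- 1..1})"
      using dv by (rule DERIV_subset) auto
    have "\<bar>s * b\<bar> \<le> 1 * \<bar>b\<bar>" unfolding abs_mult using s by (intro mult_right_mono) auto
    then have "\<bar>a + s * b\<bar> powr (p - 1) \<le> (\<bar>a\<bar> + \<bar>b\<bar>) powr (p - 1)" using p by (intro powr_mono2) auto
    then have "\<bar>a + s * b\<bar> powr (p - 1) * \<bar>b\<bar> \<le> (\<bar>a\<bar> + \<bar>b\<bar>) powr (p - 1) * (\<bar>a\<bar> + \<bar>b\<bar>)"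
      by (intro mult_mono) auto
    also have "\<dots> = (\<bar>a\<bar> + \<bar>b\<bar>) powr p" by (cases "\<bar>a\<bar> + \<bar>b\<bar> = 0") (auto simp: powr_diff)
    finally have 1: "\<bar>a + s * b\<bar> powr (p - 1) * \<bar>b\<bar> \<le> (\<bar>a\<bar> + \<bar>b\<bar>) powr p" .
    have "norm ((p * sgn (a + s * b) * \<bar>a + s * b\<bar> powr (p - 1)) * b) = p * \<bar>sgn (a + s * b)\<bar> * (\<bar>a + s * b\<bar> powr (p - 1) * \<bar>b\<bar>)"
      using p by (simp add: abs_mult)
    also have "\<dots> \<le> p * 1 * (\<bar>a\<bar> + \<bar>b\<bar>) powr p"
      using p 1 by (intro mult_mono) (auto simp: sgn_if)
    finally show "norm ((p * sgn (a + s * b) * \<bar>a + s * b\<bar> powr (p - 1)) * b) \<le> p * (\<bar>a\<bar> + \<bar>b\<bar>) powr p" by simp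
  qed (use t in auto)
  then show ?thesis by (simp add: mult.commute)
qed

section \<open>Lebesgue spaces: Jensen, completeness, nested convex sets\<close>

lemma integrable_of_integrable_powr:
  fixes f :: "'a \<Rightarrow> real"
  assumes "finite_measure M" "f \<in> borel_measurable M" "integrable M (\<lambda>x. \<bar>f x\<bar> powr r)" "r \<ge> 1"
  shows "integrable M f"
proof -
  interpret finite_measure M by fact
  show ?thesis
  proof (rule Bochner_Integration.integrable_bound[where f="\<lambda>x. 1 + \<bar>f x\<bar> powr r"])
    have "\<bar>y\<bar> \<le> 1 + \<bar>y\<bar> powr r" for y :: real
    proof (cases "\<bar>y\<bar> \<le> 1")
      case False
      then have "\<bar>y\<bar> powr 1 \<le> \<bar>y\<bar> powr r" using assms(4) by (intro powr_mono) auto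
      then show ?thesis using False by simp
    qed (simp add: add_increasing2)
    then show "AE x in M. norm (f x) \<le> norm (1 + \<bar>f x\<bar> powr r)" by auto
  qed (use assms in auto)
qed

text \<open>
  Jensen's inequality for a measure of finite total mass. Stated with a nonnegative integral on
  the right, it needs no integrability assumption.
\<close>

lemma abs_integral_powr_le:
  fixes f :: "'a \<Rightarrow> real"
  assumes M: "finite_measure M" and pos: "measure M (space M) > 0"
    and f: "f \<in> borel_measurable M" and r: "r > 1"
  shows "ennreal (\<bar>\<integral>x. f x \<partial>M\<bar> powr r)
           \<le> ennreal (measure M (space M) powr (r - 1)) * (\<integral>\<^sup>+x. ennreal (\<bar>f x\<bar> powr r) \<partial>M)"
proof (cases "(\<integral>\<^sup>+x. ennreal (\<bar>f x\<bar> powr r) \<partial>M) < \<infinity>")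
  case False
  then have "(\<integral>\<^sup>+x. ennreal (\<bar>f x\<bar> powr r) \<partial>M) = top"
    using less_top[of "\<integral>\<^sup>+x. ennreal (\<bar>f x\<bar> powr r) \<partial>M"] by simp
  then show ?thesis using pos by (simp add: ennreal_mult_top)
next
  case True
  interpret finite_measure M by fact
  define c where "c = measure M (space M)"
  have fr: "integrable M (\<lambda>x. \<bar>f x\<bar> powr r)"
    using True f by (intro integrableI_nonneg) auto
  then have fi: "integrable M f"
    using integrable_of_integrable_powr[OF M f] r by simp
  define m where "m = (\<integral>x. \<bar>f x\<bar> \<partial>M) / c"
  have "(c * m) powr r \<le> c powr (r - 1) * (\<integral>x. \<bar>f x\<bar> powr r \<partial>M)"
  proof (cases "m = 0")
    case True
    then show ?thesis by simp
  next
    case False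
    then have m: "m > 0" using pos by (simp add: m_def c_def order_less_le)
    have "(\<integral>x. m powr r + r * m powr (r - 1) * (\<bar>f x\<bar> - m) \<partial>M) \<le> (\<integral>x. \<bar>f x\<bar> powr r \<partial>M)"
      using fr fi powr_above_tangent[OF r _ m] by (intro integral_mono) auto
    also have "(\<integral>x. m powr r + r * m powr (r - 1) * (\<bar>f x\<bar> - m) \<partial>M)
        = c * m powr r + r * m powr (r - 1) * ((\<integral>x. \<bar>f x\<bar> \<partial>M) - c * m)"
      using fi by (simp add: c_def)
    also have "\<dots> = c * m powr r" using pos by (simp add: m_def c_def)
    finally have "c powr (r - 1) * (c * m powr r) \<le> c powr (r - 1) * (\<integral>x. \<bar>f x\<bar> powr r \<partial>M)"
      by (rule mult_left_mono) simp
    moreover have "c powr (r - 1) * (c * m powr r) = (c * m) powr r"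
      using pos m by (simp add: powr_mult powr_diff c_def)
    ultimately show ?thesis by simp
  qed
  moreover have "\<bar>\<integral>x. f x \<partial>M\<bar> powr r \<le> (c * m) powr r"
    using pos r by (intro powr_mono2) (auto simp: m_def c_def intro: integral_abs_bound)
  ultimately have "\<bar>\<integral>x. f x \<partial>M\<bar> powr r \<le> c powr (r - 1) * (\<integral>x. \<bar>f x\<bar> powr r \<partial>M)"
    by linarith
  then show ?thesis
    using fr by (simp add: nn_integral_eq_integral c_def ennreal_mult[symmetric])
qed

text \<open>
  Completeness of \<open>L\<^sup>r\<close>, together with almost everywhere convergence of a subsequence.
\<close>

lemma powr_Cauchy_imp_convergent:
  fixes f :: "nat \<Rightarrow> 'a \<Rightarrow> real"
  assumes r: "r > 0" and f: "\<And>i. f i \<in> borel_measurable M"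
    and C: "\<And>e. e > 0 \<Longrightarrow> \<exists>N. \<forall>i\<ge>N. \<forall>j\<ge>N. (\<integral>\<^sup>+x. ennreal (\<bar>f i x - f j x\<bar> powr r) \<partial>M) \<le> ennreal e"
  obtains g n where "g \<in> borel_measurable M" "strict_mono (n :: nat \<Rightarrow> nat)"
    "AE x in M. (\<lambda>k. f (n k) x) \<longlonglongrightarrow> g x"
    "(\<lambda>i. \<integral>\<^sup>+x. ennreal (\<bar>f i x - g x\<bar> powr r) \<partial>M) \<longlonglongrightarrow> 0"
proof -
  \<comment> \<open>so small that \<open>2\<^sup>k\<close> times the \<open>k\<close>-th increment is still \<open>r\<close>-summable\<close>
  define e :: "nat \<Rightarrow> real" where "e k = ((1/2) ^ k) powr r * (1/2) ^ k" for k
  have e: "e k > 0" for k by (simp add: e_def)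
  obtain N where N: "\<And>k i j. i \<ge> N k \<Longrightarrow> j \<ge> N k \<Longrightarrow>
      (\<integral>\<^sup>+x. ennreal (\<bar>f i x - f j x\<bar> powr r) \<partial>M) \<le> ennreal (e k)"
    using C[OF e] by metis
  define n where "n k = rec_nat (N 0) (\<lambda>k m. max (Suc m) (N (Suc k))) k" for k
  have n_Suc: "n (Suc k) = max (Suc (n k)) (N (Suc k))" for k by (simp add: n_def)
  have n_N: "n k \<ge> N k" for k by (cases k) (auto simp: n_def)
  have sm: "strict_mono n" by (rule strict_monoI_Suc) (simp add: n_Suc)
  define S where "S x = (\<Sum>k. ennreal ((2 ^ k) powr r * \<bar>f (n (Suc k)) x - f (n k) x\<bar> powr r))" for x
  have "(\<integral>\<^sup>+x. S x \<partial>M) = (\<Sum>k. \<integral>\<^sup>+x. ennreal ((2 ^ k) powr r * \<bar>f (n (Suc k)) x - f (n k) x\<bar> powr r) \<partial>M)"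
    unfolding S_def using f by (intro nn_integral_suminf) auto
  also have "\<dots> \<le> (\<Sum>k. ennreal ((1/2) ^ k))"
  proof (rule suminf_le)
    fix k
    have "(\<integral>\<^sup>+x. ennreal ((2 ^ k) powr r * \<bar>f (n (Suc k)) x - f (n k) x\<bar> powr r) \<partial>M)
       = ennreal ((2 ^ k) powr r) * (\<integral>\<^sup>+x. ennreal (\<bar>f (n (Suc k)) x - f (n k) x\<bar> powr r) \<partial>M)"
      using f by (simp add: ennreal_mult nn_integral_cmult)
    also have "\<dots> \<le> ennreal ((2 ^ k) powr r) * ennreal (e k)"
      using n_N[of k] sm by (intro mult_left_mono N) (auto simp: n_Suc)
    also have "\<dots> = ennreal ((1/2) ^ k)"
      by (simp add: e_def ennreal_mult[symmetric] powr_mult[symmetric] power_one_over mult.assoc[symmetric])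
    finally show "(\<integral>\<^sup>+x. ennreal ((2 ^ k) powr r * \<bar>f (n (Suc k)) x - f (n k) x\<bar> powr r) \<partial>M) \<le> ennreal ((1/2) ^ k)" .
  qed auto
  also have "\<dots> = ennreal 2" by (subst suminf_ennreal2) (auto simp: suminf_geometric)
  finally have "(\<integral>\<^sup>+x. S x \<partial>M) \<noteq> \<infinity>" by (auto simp: top_unique)
  then have "AE x in M. S x \<noteq> \<infinity>"
    using f by (intro nn_integral_PInf_AE) (auto simp: S_def)
  then have conv: "AE x in M. convergent (\<lambda>k. f (n k) x)"
  proof eventually_elim
    case (elim x)
    then obtain s where s: "S x = ennreal s" "s \<ge> 0" by (cases "S x") auto
    have b: "\<bar>f (n (Suc k)) x - f (n k) x\<bar> \<le> s powr (1/r) * (1/2) ^ k" for k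
    proof -
      have "(\<Sum>k\<in>{k}. ennreal ((2 ^ k) powr r * \<bar>f (n (Suc k)) x - f (n k) x\<bar> powr r)) \<le> S x"
        unfolding S_def by (rule sum_le_suminf) auto
      then have "(2 ^ k * \<bar>f (n (Suc k)) x - f (n k) x\<bar>) powr r \<le> s"
        using s by (simp add: powr_mult)
      then have "((2 ^ k * \<bar>f (n (Suc k)) x - f (n k) x\<bar>) powr r) powr (1/r) \<le> s powr (1/r)"
        using r by (intro powr_mono2) auto
      then have "2 ^ k * \<bar>f (n (Suc k)) x - f (n k) x\<bar> \<le> s powr (1/r)"
        using r by (simp add: powr_powr)
      then show ?thesis by (simp add: field_simps)
    qed
    have "summable (\<lambda>k. f (n (Suc k)) x - f (n k) x)"
      by (rule summable_comparison_test'[where g="\<lambda>k. s powr (1/r) * (1/2) ^ k" and N=0])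
         (use b in \<open>auto intro!: summable_mult summable_geometric\<close>)
    then have "convergent (\<lambda>m. f (n 0) x + (\<Sum>k<m. f (n (Suc k)) x - f (n k) x))"
      by (intro convergent_add convergent_const) (simp add: summable_iff_convergent)
    then show ?case by (simp add: sum_lessThan_telescope[of "\<lambda>k. f (n k) x"])
  qed
  define g where "g x = lim (\<lambda>k. f (n k) x)" for x
  have g: "g \<in> borel_measurable M" unfolding g_def using f by measurable
  have ae: "AE x in M. (\<lambda>k. f (n k) x) \<longlonglongrightarrow> g x"
    using conv by eventually_elim (simp add: g_def convergent_LIMSEQ_iff)
  have "(\<lambda>i. \<integral>\<^sup>+x. ennreal (\<bar>f i x - g x\<bar> powr r) \<partial>M) \<longlonglongrightarrow> 0"
  proof (rule tendsto_zero_ennreal)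
    fix d :: real assume d: "0 < d"
    then obtain K where K: "\<And>i j. i \<ge> K \<Longrightarrow> j \<ge> K \<Longrightarrow>
      (\<integral>\<^sup>+x. ennreal (\<bar>f i x - f j x\<bar> powr r) \<partial>M) \<le> ennreal (d/2)"
      using C[of "d/2"] by (metis half_gt_zero)
    have "(\<integral>\<^sup>+x. ennreal (\<bar>f i x - g x\<bar> powr r) \<partial>M) < ennreal d" if i: "i \<ge> K" for i
    proof -
      have "(\<integral>\<^sup>+x. ennreal (\<bar>f i x - g x\<bar> powr r) \<partial>M)
          = (\<integral>\<^sup>+x. liminf (\<lambda>k. ennreal (\<bar>f i x - f (n k) x\<bar> powr r)) \<partial>M)"
      proof (rule nn_integral_cong_AE, use ae in eventually_elim)
        case (elim x)
        have "(\<lambda>k. ennreal (\<bar>f i x - f (n k) x\<bar> powr r)) \<longlonglongrightarrow> ennreal (\<bar>f i x - g x\<bar> powr r)"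
          using elim r by (intro tendsto_ennrealI tendsto_powr' tendsto_intros) auto
        then show ?case using lim_imp_Liminf[of sequentially] by (metis trivial_limit_sequentially)
      qed
      also have "\<dots> \<le> liminf (\<lambda>k. \<integral>\<^sup>+x. ennreal (\<bar>f i x - f (n k) x\<bar> powr r) \<partial>M)"
        using f by (intro nn_integral_liminf) auto
      also have "\<dots> \<le> ennreal (d/2)"
      proof (rule Liminf_le)
        show "\<forall>\<^sub>F k in sequentially. (\<integral>\<^sup>+x. ennreal (\<bar>f i x - f (n k) x\<bar> powr r) \<partial>M) \<le> ennreal (d/2)"
          using seq_suble[OF sm] i by (intro eventually_sequentiallyI[of K] K) (auto intro: order_trans)
      qed simp
      also have "\<dots> < ennreal d" using d by (simp add: ennreal_less_iff)
      finally show ?thesis .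
    qed
    then show "\<forall>\<^sub>F i in sequentially. (\<integral>\<^sup>+x. ennreal (\<bar>f i x - g x\<bar> powr r) \<partial>M) < ennreal d"
      by (auto simp: eventually_sequentially)
  qed
  then show ?thesis using that g sm ae by blast
qed

lemma nn_integral_abs_powr_eq:
  assumes "integrable M (\<lambda>x. \<bar>f x\<bar> powr r)"
  shows "(\<integral>\<^sup>+x. ennreal (\<bar>f x\<bar> powr r) \<partial>M) = ennreal (\<integral>x. \<bar>f x\<bar> powr r \<partial>M)"
  using assms by (intro nn_integral_eq_integral) auto

lemma Lp_spaceD:
  assumes "V \<in> Lp_space q \<Omega>"
  shows "V \<in> borel_measurable (lebesgue_on \<Omega>)" "integrable (lebesgue_on \<Omega>) (\<lambda>x. \<bar>V x\<bar> powr q)"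
  using assms by (auto simp: Lp_space_def)

lemma integrable_abs_powr_add:
  fixes V W :: "'a \<Rightarrow> real"
  assumes "V \<in> borel_measurable M" "W \<in> borel_measurable M" "q > 0"
    "integrable M (\<lambda>x. \<bar>V x\<bar> powr q)" "integrable M (\<lambda>x. \<bar>W x\<bar> powr q)"
  shows "integrable M (\<lambda>x. \<bar>a * V x + b * W x\<bar> powr q)"
proof (rule Bochner_Integration.integrable_bound)
  show "integrable M (\<lambda>x. 2 powr q * (\<bar>a\<bar> powr q * \<bar>V x\<bar> powr q + \<bar>b\<bar> powr q * \<bar>W x\<bar> powr q))"
    using assms by auto
  show "AE x in M. norm (\<bar>a * V x + b * W x\<bar> powr q)
      \<le> norm (2 powr q * (\<bar>a\<bar> powr q * \<bar>V x\<bar> powr q + \<bar>b\<bar> powr q * \<bar>W x\<bar> powr q))"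
    using abs_add_powr_le[of q "a * V x" "b * W x" for x] \<open>q > 0\<close>
    by (auto simp: abs_mult powr_mult)
qed (use assms in measurable)

lemma Lp_space_lincomb:
  assumes "V \<in> Lp_space q \<Omega>" "W \<in> Lp_space q \<Omega>" "q > 0"
  shows "(\<lambda>x. a * V x + b * W x) \<in> Lp_space q \<Omega>"
  using assms by (auto simp: Lp_space_def intro!: integrable_abs_powr_add)

lemma Lp_norm_powr:
  assumes "V \<in> Lp_space q \<Omega>" "q > 0"
  shows "Lp_norm q \<Omega> V powr q = (\<integral>x. \<bar>V x\<bar> powr q \<partial>lebesgue_on \<Omega>)"
  using assms by (simp add: Lp_norm_def powr_powr)

lemma mean_diff_le:
  fixes x y z w v c :: real
  assumes "x \<le> z + c" "y \<le> z + c" "v \<le> w"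
  shows "(x + y) / 2 - w \<le> z - v + c"
proof -
  have "(x + y) / 2 \<le> z + c" using assms(1,2) by simp
  from diff_mono[OF this assms(3)] show ?thesis by (simp only: add_diff_eq diff_add_eq)
qed

text \<open>
  A substitute for weak compactness: pick in each \<open>\<C> k\<close> an element whose \<open>q\<close>-th power
  integral is within \<open>1/(k+1)\<close> of the infimum. The infima increase and are bounded, and
  midpoints stay in \<open>\<C> k\<close>, so uniform convexity makes the chosen elements a Cauchy sequence; its limit lies in every \<open>\<C> k\<close>.
\<close>

lemma nested_convex_Lp:
  fixes \<C> :: "nat \<Rightarrow> ('a::euclidean_space \<Rightarrow> real) set"
  assumes q: "q > 1" and sub: "\<And>k. \<C> k \<subseteq> Lp_space q \<Omega>" and ne: "\<And>k. \<C> k \<noteq> {}"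
    and cl: "\<And>k. Lp_closed q \<Omega> (\<C> k)" and cv: "\<And>k. fun_convex (\<C> k)"
    and bd: "Lp_bounded q \<Omega> (\<C> 0)" and dec: "decseq \<C>"
  shows "(\<Inter>k. \<C> k) \<noteq> {}"
proof -
  let ?M = "lebesgue_on \<Omega>"
  define \<Phi> where "\<Phi> V = (\<integral>x. \<bar>V x\<bar> powr q \<partial>?M)" for V :: "'a \<Rightarrow> real"
  have \<Phi>0: "\<Phi> V \<ge> 0" for V by (simp add: \<Phi>_def)
  have mono: "\<C> j \<subseteq> \<C> k" if "k \<le> j" for j k using dec that by (auto simp: decseq_def)
  obtain B where B: "\<And>V. V \<in> \<C> 0 \<Longrightarrow> Lp_norm q \<Omega> V \<le> B" using bd by (auto simp: Lp_bounded_def)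
  define b where "b = \<bar>B\<bar> powr q + 1"
  have b: "\<Phi> V \<le> b" if "V \<in> \<C> k" for V k
  proof -
    have V: "V \<in> \<C> 0" using that mono[of 0 k] by auto
    then have "Lp_norm q \<Omega> V powr q \<le> \<bar>B\<bar> powr q"
      using B[OF V] q by (intro powr_mono2) (auto simp: Lp_norm_def)
    then show ?thesis using Lp_norm_powr[of V q \<Omega>] V sub[of 0] q by (auto simp: \<Phi>_def b_def)
  qed
  define d where "d k = Inf (\<Phi> ` \<C> k)" for k
  have bbl: "bdd_below (\<Phi> ` \<C> k)" for k using \<Phi>0 by (auto intro!: bdd_belowI[of _ 0])
  have d_le: "d k \<le> \<Phi> V" if "V \<in> \<C> k" for V k
    unfolding d_def using that bbl by (intro cInf_lower) auto
  have "incseq d" unfolding incseq_def d_def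
    using ne mono bbl by (intro allI impI cInf_superset_mono) (auto intro!: image_mono)
  moreover have "d k \<le> b" for k using ne[of k] d_le b by (meson all_not_in_conv order_trans)
  ultimately obtain D where D: "d \<longlonglongrightarrow> D" using incseq_convergent by blast
  have d_le_D: "d k \<le> D" for k using \<open>incseq d\<close> D by (rule incseq_le)
  have "\<exists>V\<in>\<C> k. \<Phi> V < d k + 1 / Suc k" for k
    using cInf_lessD[of "\<Phi> ` \<C> k" "d k + 1 / Suc k"] ne[of k] by (auto simp: d_def)
  then obtain V where V: "\<And>k. V k \<in> \<C> k" "\<And>k. \<Phi> (V k) < d k + 1 / Suc k" by metis
  have VL: "V k \<in> Lp_space q \<Omega>" for k using V sub by auto
  note Vm[measurable] = Lp_spaceD(1)[OF VL] and Vi = Lp_spaceD(2)[OF VL]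
  have Vdi: "integrable ?M (\<lambda>x. \<bar>V i x - V j x\<bar> powr q)" for i j
    using integrable_abs_powr_add[OF Vm Vm _ Vi Vi, of 1 i "-1" j] q by simp
  have Vsi: "integrable ?M (\<lambda>x. \<bar>(V i x + V j x) / 2\<bar> powr q)" for i j
    using integrable_abs_powr_add[OF Vm Vm _ Vi Vi, of "1/2" i "1/2" j] q by (simp add: add_divide_distrib)
  have main: "(\<integral>x. \<bar>V i x - V j x\<bar> powr q \<partial>?M) \<le> e * (2 * b) + C * ((D - d k) + 1 / Suc k)"
    if "e > 0" "C > 0" and C: "\<And>x y::real. \<bar>x - y\<bar> powr q \<le> e * (\<bar>x\<bar> powr q + \<bar>y\<bar> powr q)
        + C * ((\<bar>x\<bar> powr q + \<bar>y\<bar> powr q) / 2 - \<bar>(x + y) / 2\<bar> powr q)" and ij: "i \<ge> k" "j \<ge> k"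
    for e C i j k
  proof -
    have "(\<integral>x. \<bar>V i x - V j x\<bar> powr q \<partial>?M) \<le> (\<integral>x. e * (\<bar>V i x\<bar> powr q + \<bar>V j x\<bar> powr q)
        + C * ((\<bar>V i x\<bar> powr q + \<bar>V j x\<bar> powr q) / 2 - \<bar>(V i x + V j x) / 2\<bar> powr q) \<partial>?M)"
      using Vi Vdi Vsi C by (intro integral_mono) auto
    also have "\<dots> = e * (\<Phi> (V i) + \<Phi> (V j)) + C * ((\<Phi> (V i) + \<Phi> (V j)) / 2 - \<Phi> (\<lambda>x. (V i x + V j x) / 2))"
      using Vi Vsi by (simp add: \<Phi>_def)
    also have "\<dots> \<le> e * (2 * b) + C * ((D - d k) + 1 / Suc k)"
    proof (intro add_mono mult_left_mono)
      show "\<Phi> (V i) + \<Phi> (V j) \<le> 2 * b" using b[OF V(1)[of i]] b[OF V(1)[of j]] by linarith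
      have "V i \<in> \<C> k" "V j \<in> \<C> k" using V(1) mono ij by blast+
      then have "(\<lambda>x. (1/2) * V i x + (1/2) * V j x) \<in> \<C> k"
        using cv[of k] unfolding fun_convex_def by (metis field_sum_of_halves less_eq_real_def half_gt_zero_iff zero_less_one)
      then have mid: "d k \<le> \<Phi> (\<lambda>x. (V i x + V j x) / 2)" using d_le by (auto simp: add_divide_distrib)
      have Vl: "\<Phi> (V l) \<le> D + 1 / Suc k" if "l \<ge> k" for l
      proof -
        have "1 / real (Suc l) \<le> 1 / real (Suc k)" using that by (intro divide_left_mono) auto
        then show ?thesis using V(2)[of l] d_le_D[of l] by linarith
      qed
      from mean_diff_le[OF Vl[OF ij(1)] Vl[OF ij(2)] mid]
      show "(\<Phi> (V i) + \<Phi> (V j)) / 2 - \<Phi> (\<lambda>x. (V i x + V j x) / 2) \<le> (D - d k) + 1 / Suc k" .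
    qed (use that in auto)
    finally show ?thesis .
  qed
  have Cauchy: "\<exists>N. \<forall>i\<ge>N. \<forall>j\<ge>N. (\<integral>\<^sup>+x. ennreal (\<bar>V i x - V j x\<bar> powr q) \<partial>?M) \<le> ennreal e" if e: "e > 0" for e
  proof -
    have b0: "b > 0" by (simp add: b_def add_nonneg_pos)
    have e': "e / (4 * b) > 0" using e b0 by simp
    obtain C where C: "C > 0" "\<And>x y::real. \<bar>x - y\<bar> powr q \<le> e / (4 * b) * (\<bar>x\<bar> powr q + \<bar>y\<bar> powr q)
        + C * ((\<bar>x\<bar> powr q + \<bar>y\<bar> powr q) / 2 - \<bar>(x + y) / 2\<bar> powr q)"
      using powr_uniform_convexity[OF q e'] by blast
    have "(\<lambda>k. C * ((D - d k) + 1 / Suc k)) \<longlonglongrightarrow> C * ((D - D) + 0)"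
      by (intro tendsto_intros D LIMSEQ_Suc[OF lim_1_over_n])
    then have "\<forall>\<^sub>F k in sequentially. C * ((D - d k) + 1 / Suc k) < e / 2"
      using e by (intro order_tendstoD) auto
    then obtain k where "C * ((D - d k) + 1 / Suc k) < e / 2" by (auto dest: eventually_happens)
    moreover have "e / (4 * b) * (2 * b) = e / 2" using b0 by simp
    ultimately have "(\<integral>x. \<bar>V i x - V j x\<bar> powr q \<partial>?M) \<le> e" if "i \<ge> k" "j \<ge> k" for i j
      using main[OF e' C that] by linarith
    then show ?thesis using nn_integral_abs_powr_eq[OF Vdi] by (auto intro!: exI[of _ k] ennreal_leI)
  qed
  obtain g where g: "g \<in> borel_measurable ?M" "(\<lambda>i. \<integral>\<^sup>+x. ennreal (\<bar>V i x - g x\<bar> powr q) \<partial>?M) \<longlonglongrightarrow> 0"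
    using powr_Cauchy_imp_convergent[of q V ?M, OF _ Vm Cauchy] q by auto
  note gm[measurable] = g(1)
  have "\<forall>\<^sub>F i in sequentially. (\<integral>\<^sup>+x. ennreal (\<bar>V i x - g x\<bar> powr q) \<partial>?M) < 1"
    using g(2) by (intro order_tendstoD) auto
  then obtain i0 where i0: "\<And>i. i \<ge> i0 \<Longrightarrow> (\<integral>\<^sup>+x. ennreal (\<bar>V i x - g x\<bar> powr q) \<partial>?M) < 1"
    by (auto simp: eventually_sequentially)
  have di: "integrable ?M (\<lambda>x. \<bar>V i x - g x\<bar> powr q)" if "i \<ge> i0" for i
    using i0[OF that] by (intro integrableI_nonneg) (auto intro: less_trans)
  have gL: "g \<in> Lp_space q \<Omega>"
    using integrable_abs_powr_add[OF Vm _ _ Vi di[OF order_refl], of 1 i0 "-1"] q g(1) by (simp add: Lp_space_def)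
  have lim: "(\<lambda>i. Lp_norm q \<Omega> (\<lambda>x. V (i + i0) x - g x)) \<longlonglongrightarrow> 0"
  proof -
    have "(\<lambda>i. ennreal (\<integral>x. \<bar>V (i + i0) x - g x\<bar> powr q \<partial>?M)) \<longlonglongrightarrow> ennreal 0"
      using LIMSEQ_ignore_initial_segment[OF g(2), of i0] nn_integral_abs_powr_eq[OF di] by simp
    then have "(\<lambda>i. (\<integral>x. \<bar>V (i + i0) x - g x\<bar> powr q \<partial>?M)) \<longlonglongrightarrow> 0"
      by (subst (asm) tendsto_ennreal_iff) auto
    then have "(\<lambda>i. (\<integral>x. \<bar>V (i + i0) x - g x\<bar> powr q \<partial>?M) powr (1 / q)) \<longlonglongrightarrow> 0 powr (1 / q)"
      using q by (intro tendsto_powr' tendsto_intros) auto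
    then show ?thesis by (simp add: Lp_norm_def)
  qed
  have "g \<in> \<C> k" for k
  proof -
    have "\<forall>i. V (i + k + i0) \<in> \<C> k" using V(1) mono by (meson le_add1 le_add2 order_trans subsetD)
    moreover have "(\<lambda>i. Lp_norm q \<Omega> (\<lambda>x. V (i + k + i0) x - g x)) \<longlonglongrightarrow> 0"
      using LIMSEQ_ignore_initial_segment[OF lim, of k] .
    ultimately show ?thesis
      using cl[of k] gL unfolding Lp_closed_def by (elim allE[of _ "\<lambda>i. V (i + k + i0)"]) auto
  qed
  then show ?thesis by blast
qed

lemma quasiconcave_attains_max:
  fixes \<C> :: "('a::euclidean_space \<Rightarrow> real) set" and f :: "('a \<Rightarrow> real) \<Rightarrow> ereal"
  assumes q: "q > 1" and sub: "\<C> \<subseteq> Lp_space q \<Omega>" and ne: "\<C> \<noteq> {}" and bd: "Lp_bounded q \<Omega> \<C>"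
    and cl: "\<And>c. Lp_closed q \<Omega> {V\<in>\<C>. c \<le> f V}" and cv: "\<And>c. fun_convex {V\<in>\<C>. c \<le> f V}"
  shows "\<exists>V\<in>\<C>. \<forall>W\<in>\<C>. f W \<le> f V"
proof -
  define m where "m = (SUP V\<in>\<C>. f V)"
  obtain c where c: "incseq c" "range c \<subseteq> f ` \<C>" "m = (SUP i. c i)"
    using Sup_countable_SUP[of "f ` \<C>"] ne unfolding m_def by auto
  have "(\<Inter>k. {V\<in>\<C>. c k \<le> f V}) \<noteq> {}"
  proof (rule nested_convex_Lp[OF q])
    show "{V\<in>\<C>. c k \<le> f V} \<noteq> {}" for k
    proof -
      have "c k \<in> f ` \<C>" using c(2) by blast
      then show ?thesis by auto
    qed
    show "Lp_bounded q \<Omega> {V\<in>\<C>. c 0 \<le> f V}" using bd by (auto simp: Lp_bounded_def)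
    show "decseq (\<lambda>k. {V\<in>\<C>. c k \<le> f V})" 
    proof (intro decseq_SucI subsetI)
      fix k V assume "V \<in> {V\<in>\<C>. c (Suc k) \<le> f V}"
      moreover have "c k \<le> c (Suc k)" using c(1) by (rule incseq_SucD)
      ultimately show "V \<in> {V\<in>\<C>. c k \<le> f V}" using order_trans by blast
    qed
  qed (use sub cl cv in auto)
  then obtain V where V: "V \<in> \<C>" "\<And>k. c k \<le> f V" by auto
  then have "m \<le> f V" unfolding c(3) by (intro SUP_least) auto
  moreover have "f W \<le> m" if "W \<in> \<C>" for W unfolding m_def using that by (rule SUP_upper)
  ultimately show ?thesis using V(1) order_trans by blast
qed

section \<open>Lebesgue measure and Hoelder's inequality on sets\<close>

lemma sigma_finite_lebesgue: "sigma_finite_measure (lebesgue :: 'a::euclidean_space measure)"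
proof
  obtain A :: "'a set set" where A: "countable A" "A \<subseteq> sets lborel" "\<Union>A = space lborel" "\<forall>a\<in>A. emeasure lborel a \<noteq> \<infinity>"
    using lborel.sigma_finite_countable by blast
  have "A \<subseteq> sets lebesgue" using A(2) by auto
  moreover have "\<forall>a\<in>A. emeasure lebesgue a \<noteq> \<infinity>"
    using A(2,4) by (auto simp: subset_iff)
  ultimately show "\<exists>A::'a set set. countable A \<and> A \<subseteq> sets lebesgue \<and> \<Union>A = space lebesgue \<and> (\<forall>a\<in>A. emeasure lebesgue a \<noteq> \<infinity>)"
    using A(1,3) by (intro exI[of _ A]) simp
qed

interpretation lebesgue: sigma_finite_measure "lebesgue :: 'a::euclidean_space measure"
  by (rule sigma_finite_lebesgue)

interpretation lebesgue_pair: pair_sigma_finite "lebesgue :: 'a::euclidean_space measure" "lebesgue :: 'a measure"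
  by (rule pair_sigma_finite.intro) (rule sigma_finite_lebesgue)+

lemma measurable_id_lebesgue [measurable]: "(\<lambda>x. x) \<in> lebesgue \<rightarrow>\<^sub>M (borel :: 'a::euclidean_space measure)"
  by (rule measurable_completion) simp

lemma measurable_fst_lebesgue [measurable]:
  "fst \<in> lebesgue \<Otimes>\<^sub>M M \<rightarrow>\<^sub>M (borel :: 'a::euclidean_space measure)"
  using measurable_compose[OF measurable_fst measurable_id_lebesgue] by (simp add: comp_def)

lemma measurable_snd_lebesgue [measurable]:
  "snd \<in> M \<Otimes>\<^sub>M lebesgue \<rightarrow>\<^sub>M (borel :: 'a::euclidean_space measure)"
  using measurable_compose[OF measurable_snd measurable_id_lebesgue] by (simp add: comp_def)

lemma set_integrable_of_powr:
  fixes V :: "'a::euclidean_space \<Rightarrow> real"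
  assumes S: "S \<in> lmeasurable" and V: "V \<in> borel_measurable lebesgue"
    and fin: "(\<integral>\<^sup>+x. ennreal (\<bar>V x\<bar> powr q) \<partial>lebesgue) < \<infinity>" and q: "q \<ge> 1"
  shows "integrable (lebesgue_on S) V"
proof (rule integrable_of_integrable_powr[OF _ _ _ q])
  show "finite_measure (lebesgue_on S)" using S by (rule finite_measure_lebesgue_on)
  show Vm: "V \<in> borel_measurable (lebesgue_on S)" using V by (rule measurable_restrict_space1)
  have "(\<integral>\<^sup>+x. ennreal (\<bar>V x\<bar> powr q) \<partial>lebesgue_on S) = (\<integral>\<^sup>+x. ennreal (\<bar>V x\<bar> powr q) * indicator S x \<partial>lebesgue)"
    using S by (subst nn_integral_restrict_space) auto
  also have "\<dots> \<le> (\<integral>\<^sup>+x. ennreal (\<bar>V x\<bar> powr q) \<partial>lebesgue)"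
    by (intro nn_integral_mono) (auto simp: indicator_def)
  finally show "integrable (lebesgue_on S) (\<lambda>x. \<bar>V x\<bar> powr q)"
    using Vm fin by (intro integrableI_nonneg) (auto intro: order_le_less_trans)
qed

lemma set_Jensen_powr:
  fixes f :: "'a::euclidean_space \<Rightarrow> real"
  assumes S: "S \<in> lmeasurable" and pos: "measure lebesgue S > 0"
    and f: "f \<in> borel_measurable lebesgue" and r: "r > 1"
  shows "ennreal (\<bar>\<integral>x. f x \<partial>lebesgue_on S\<bar> powr r)
    \<le> ennreal (measure lebesgue S powr (r - 1)) * (\<integral>\<^sup>+x. ennreal (\<bar>f x\<bar> powr r) * indicator S x \<partial>lebesgue)"
proof -
  have m: "measure (lebesgue_on S) (space (lebesgue_on S)) = measure lebesgue S"
    using S by (simp add: measure_restrict_space fmeasurableD)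
  have "(\<integral>\<^sup>+x. ennreal (\<bar>f x\<bar> powr r) \<partial>lebesgue_on S) = (\<integral>\<^sup>+x. ennreal (\<bar>f x\<bar> powr r) * indicator S x \<partial>lebesgue)"
    using S by (subst nn_integral_restrict_space) auto
  then show ?thesis
    using abs_integral_powr_le[of "lebesgue_on S" f r] S pos r f m
    by (simp add: finite_measure_lebesgue_on measurable_restrict_space1)
qed

text \<open>
  Hoelder's inequality for \<open>V\<close> and the indicator function of \<open>S\<close>.
\<close>

lemma set_nn_integral_le_powr:
  fixes V :: "'a::euclidean_space \<Rightarrow> real"
  assumes S: "S \<in> lmeasurable" and pos: "measure lebesgue S > 0"
    and V: "V \<in> borel_measurable lebesgue" "integrable lebesgue (\<lambda>x. \<bar>V x\<bar> powr q)" and q: "q > 1"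
  shows "(\<integral>\<^sup>+x. ennreal \<bar>V x\<bar> * indicator S x \<partial>lebesgue)
     \<le> ennreal (measure lebesgue S powr (1 - 1/q) * (\<integral>x. \<bar>V x\<bar> powr q \<partial>lebesgue) powr (1/q))"
proof -
  define I where "I = (\<integral>x. \<bar>V x\<bar> powr q \<partial>lebesgue)"
  have I: "(\<integral>\<^sup>+x. ennreal (\<bar>V x\<bar> powr q) \<partial>lebesgue) = ennreal I"
    using nn_integral_abs_powr_eq[OF V(2)] by (simp add: I_def)
  have I0: "I \<ge> 0" by (simp add: I_def)
  have int: "integrable (lebesgue_on S) V"
    using set_integrable_of_powr[OF S V(1), of q] I q by simp
  define J where "J = (\<integral>x. \<bar>V x\<bar> \<partial>lebesgue_on S)"
  have J0: "J \<ge> 0" by (simp add: J_def)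
  have "ennreal (J powr q) \<le> ennreal (measure lebesgue S powr (q - 1)) * (\<integral>\<^sup>+x. ennreal (\<bar>V x\<bar> powr q) * indicator S x \<partial>lebesgue)"
    using set_Jensen_powr[OF S pos, of "\<lambda>x. \<bar>V x\<bar>" q] V q J0 by (simp add: J_def)
  also have "\<dots> \<le> ennreal (measure lebesgue S powr (q - 1)) * ennreal I"
    unfolding I[symmetric] by (intro mult_left_mono nn_integral_mono) (auto simp: indicator_def)
  finally have "J powr q \<le> measure lebesgue S powr (q - 1) * I"
    using I0 by (simp add: ennreal_mult[symmetric])
  then have "(J powr q) powr (1/q) \<le> (measure lebesgue S powr (q - 1) * I) powr (1/q)"
    using q by (intro powr_mono2) auto
  then have "J \<le> measure lebesgue S powr (1 - 1/q) * I powr (1/q)"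
    using J0 q by (simp add: powr_powr powr_mult diff_divide_distrib)
  moreover have "(\<integral>\<^sup>+x. ennreal \<bar>V x\<bar> * indicator S x \<partial>lebesgue) = ennreal J"
    using S int by (subst nn_integral_restrict_space[symmetric]) (auto simp: J_def nn_integral_eq_integral)
  ultimately show ?thesis by (simp add: I_def ennreal_leI)
qed

section \<open>Averages over dyadic cubes\<close>

text \<open>
  The half-open dyadic cube of side \<open>2\<^sup>-\<^sup>k\<close> that contains \<open>x\<close>. Membership of \<open>y\<close> is an
  equivalence relation between \<open>x\<close> and \<open>y\<close>, which is how the cubes are used throughout; no
  enumeration of the cubes is needed.
\<close>

definition dyadic_cube :: "nat \<Rightarrow> 'a::euclidean_space \<Rightarrow> 'a set" where
  "dyadic_cube k x = {y. \<forall>b\<in>Basis. \<lfloor>2 ^ k * (y \<bullet> b)\<rfloor> = \<lfloor>2 ^ k * (x \<bullet> b)\<rfloor>}"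

lemma dyadic_cube_self [simp]: "x \<in> dyadic_cube k x"
  by (simp add: dyadic_cube_def)

lemma dyadic_cube_sym: "y \<in> dyadic_cube k x \<longleftrightarrow> x \<in> dyadic_cube k y"
  by (auto simp: dyadic_cube_def)

lemma dyadic_cube_eq: "y \<in> dyadic_cube k x \<Longrightarrow> dyadic_cube k y = dyadic_cube k x"
  by (auto simp: dyadic_cube_def)

lemma dyadic_cube_Suc_subset: "dyadic_cube (Suc k) x \<subseteq> dyadic_cube k x"
proof -
  have "\<lfloor>2 ^ k * t\<rfloor> = \<lfloor>2 ^ Suc k * t\<rfloor> div 2" for t :: real
    using floor_divide_real_eq_div[of 2 "2 ^ Suc k * t"] by simp
  then show ?thesis unfolding dyadic_cube_def by auto
qed

lemma pred_dyadic_cube [measurable]: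
  "Measurable.pred (lebesgue \<Otimes>\<^sub>M lebesgue) (\<lambda>z. snd z \<in> dyadic_cube k (fst z :: 'a::euclidean_space))"
  unfolding dyadic_cube_def mem_Collect_eq by measurable

lemma dyadic_cube_between_boxes:
  fixes x :: "'a::euclidean_space"
  obtains l u where "box l u \<subseteq> dyadic_cube k x" "dyadic_cube k x \<subseteq> cbox l u"
    "\<forall>b\<in>Basis. l \<bullet> b < u \<bullet> b" "(\<Prod>b\<in>Basis. (u - l) \<bullet> b) = 1 / (2 ^ k) ^ DIM('a)"
proof -
  define l where "l = (\<Sum>b\<in>Basis. (of_int \<lfloor>2 ^ k * (x \<bullet> b)\<rfloor> / 2 ^ k) *\<^sub>R b)"
  define u where "u = (\<Sum>b\<in>Basis. ((of_int \<lfloor>2 ^ k * (x \<bullet> b)\<rfloor> + 1) / 2 ^ k) *\<^sub>R b)"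
  have l: "l \<bullet> b = of_int \<lfloor>2 ^ k * (x \<bullet> b)\<rfloor> / 2 ^ k" if "b \<in> Basis" for b using that by (simp add: l_def)
  have u: "u \<bullet> b = (of_int \<lfloor>2 ^ k * (x \<bullet> b)\<rfloor> + 1) / 2 ^ k" if "b \<in> Basis" for b using that by (simp add: u_def)
  have 1: "box l u \<subseteq> dyadic_cube k x"
    unfolding dyadic_cube_def mem_box subset_iff mem_Collect_eq
    by (auto simp: l u field_simps intro!: floor_unique)
  have 2: "dyadic_cube k x \<subseteq> cbox l u"
  proof
    fix y assume y: "y \<in> dyadic_cube k x"
    have "l \<bullet> b \<le> y \<bullet> b \<and> y \<bullet> b \<le> u \<bullet> b" if b: "b \<in> Basis" for b
    proof -
      have "\<lfloor>2 ^ k * (y \<bullet> b)\<rfloor> = \<lfloor>2 ^ k * (x \<bullet> b)\<rfloor>" using y b by (simp add: dyadic_cube_def)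
      then have "of_int \<lfloor>2 ^ k * (x \<bullet> b)\<rfloor> \<le> 2 ^ k * (y \<bullet> b)" "2 ^ k * (y \<bullet> b) \<le> of_int \<lfloor>2 ^ k * (x \<bullet> b)\<rfloor> + 1"
        using of_int_floor_le[of "2 ^ k * (y \<bullet> b)"] real_of_int_floor_add_one_ge[of "2 ^ k * (y \<bullet> b)"] by simp_all
      then show ?thesis using b by (simp add: l u field_simps)
    qed
    then show "y \<in> cbox l u" by (simp add: mem_box)
  qed
  have "\<forall>b\<in>Basis. l \<bullet> b < u \<bullet> b" by (simp add: l u field_simps)
  moreover have "(\<Prod>b\<in>Basis. (u - l) \<bullet> b) = 1 / (2 ^ k) ^ DIM('a)"
    by (simp add: inner_diff_left l u field_simps power_one_over prod_dividef cong: prod.cong)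
  ultimately show ?thesis using that 1 2 by blast
qed

lemma dyadic_cube_props:
  fixes x :: "'a::euclidean_space"
  shows dyadic_cube_lmeasurable: "dyadic_cube k x \<in> lmeasurable"
    and measure_dyadic_cube: "measure lebesgue (dyadic_cube k x) = 1 / (2 ^ k) ^ DIM('a)"
proof -
  obtain l u where 1: "box l u \<subseteq> dyadic_cube k x" and 2: "dyadic_cube k x \<subseteq> cbox l u"
    and lu: "\<forall>b\<in>Basis. l \<bullet> b < u \<bullet> b" and c: "(\<Prod>b\<in>Basis. (u - l) \<bullet> b) = 1 / (2 ^ k) ^ DIM('a)"
    by (rule dyadic_cube_between_boxes[of k x])
  have m: "dyadic_cube k x \<in> sets lebesgue"
  proof -
    have "Measurable.pred borel (\<lambda>y. \<forall>b\<in>Basis. \<lfloor>2 ^ k * (y \<bullet> b)\<rfloor> = \<lfloor>2 ^ k * (x \<bullet> b)\<rfloor>)"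
      by measurable
    then show ?thesis by (simp add: dyadic_cube_def pred_def)
  qed
  show lm: "dyadic_cube k x \<in> lmeasurable"
    using m bounded_subset[OF bounded_cbox 2] by (rule bounded_set_imp_lmeasurable[rotated])
  have "measure lebesgue (box l u) \<le> measure lebesgue (dyadic_cube k x)"
    using 1 lm by (intro measure_mono_fmeasurable) auto
  moreover have "measure lebesgue (dyadic_cube k x) \<le> measure lebesgue (cbox l u)"
    using 2 m by (intro measure_mono_fmeasurable) auto
  moreover have "measure lebesgue (box l u) = 1 / (2 ^ k) ^ DIM('a)" "measure lebesgue (cbox l u) = 1 / (2 ^ k) ^ DIM('a)"
    using lu c by (simp_all add: measure_lborel_box_eq measure_lborel_cbox_eq less_imp_le)
  ultimately show "measure lebesgue (dyadic_cube k x) = 1 / (2 ^ k) ^ DIM('a)" by linarith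
qed

lemma dyadic_cube_meets_dense:
  fixes x :: "'a::euclidean_space"
  assumes D: "\<And>X :: 'a set. open X \<Longrightarrow> X \<noteq> {} \<Longrightarrow> \<exists>d\<in>D. d \<in> X"
  shows "\<exists>d\<in>D. x \<in> dyadic_cube k d"
proof -
  obtain l u where 1: "box l u \<subseteq> dyadic_cube k x" and "dyadic_cube k x \<subseteq> cbox l u"
    and lu: "\<forall>b\<in>Basis. l \<bullet> b < u \<bullet> b" and "(\<Prod>b\<in>Basis. (u - l) \<bullet> b) = 1 / (2 ^ k) ^ DIM('a)"
    by (rule dyadic_cube_between_boxes[of k x])
  have "box l u \<noteq> {}" using lu by (simp add: box_ne_empty)
  with D[OF open_box] 1 show ?thesis using dyadic_cube_sym by blast
qed

lemma dyadic_cube_sets [measurable]: "dyadic_cube k x \<in> sets lebesgue"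
  using dyadic_cube_lmeasurable by (rule fmeasurableD)

lemma norm_diff_dyadic_cube_le:
  fixes x y :: "'a::euclidean_space"
  assumes "y \<in> dyadic_cube k x"
  shows "norm (x - y) \<le> real DIM('a) / 2 ^ k"
proof -
  have "\<bar>(x - y) \<bullet> b\<bar> \<le> 1 / 2 ^ k" if b: "b \<in> Basis" for b
  proof -
    have "\<lfloor>2 ^ k * (y \<bullet> b)\<rfloor> = \<lfloor>2 ^ k * (x \<bullet> b)\<rfloor>" using assms b by (simp add: dyadic_cube_def)
    then have "\<bar>2 ^ k * (x \<bullet> b) - 2 ^ k * (y \<bullet> b)\<bar> \<le> 1" by linarith
    then have "2 ^ k * \<bar>x \<bullet> b - y \<bullet> b\<bar> \<le> 1" by (simp add: abs_mult right_diff_distrib[symmetric])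
    then show ?thesis by (simp add: inner_diff_left field_simps)
  qed
  then have "(\<Sum>b\<in>Basis. \<bar>(x - y) \<bullet> b\<bar>) \<le> (\<Sum>b\<in>(Basis::'a set). 1 / 2 ^ k)" by (rule sum_mono)
  then show ?thesis using norm_le_l1[of "x - y"] by simp
qed

text \<open>
  The mean of \<open>u\<close> over the dyadic cube of generation \<open>k\<close> around \<open>x\<close>; the factor is the
  reciprocal of the volume of the cube.
\<close>

definition cube_avg :: "nat \<Rightarrow> ('a::euclidean_space \<Rightarrow> real) \<Rightarrow> 'a \<Rightarrow> real" where
  "cube_avg k u x = (2 ^ k) ^ DIM('a) * (\<integral>y. u y \<partial>lebesgue_on (dyadic_cube k x))"

lemma cube_avg_cong_cube: "y \<in> dyadic_cube k x \<Longrightarrow> cube_avg k u y = cube_avg k u x"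
  using dyadic_cube_eq[of y k x] by (simp add: cube_avg_def)

lemma cube_avg_measurable [measurable]:
  assumes [measurable]: "u \<in> borel_measurable lebesgue"
  shows "cube_avg k u \<in> borel_measurable lebesgue"
proof -
  have "cube_avg k u = (\<lambda>x. (2 ^ k) ^ DIM('a) * (\<integral>y. (if y \<in> dyadic_cube k x then u y else 0) \<partial>lebesgue))"
  proof
    fix x
    have "(\<integral>y. u y \<partial>lebesgue_on (dyadic_cube k x)) = (\<integral>y. indicator (dyadic_cube k x) y *\<^sub>R u y \<partial>lebesgue)"
      by (rule integral_restrict_space) simp
    also have "\<dots> = (\<integral>y. (if y \<in> dyadic_cube k x then u y else 0) \<partial>lebesgue)"
      by (rule Bochner_Integration.integral_cong) auto
    finally show "cube_avg k u x = (2 ^ k) ^ DIM('a) * (\<integral>y. (if y \<in> dyadic_cube k x then u y else 0) \<partial>lebesgue)"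
      by (simp add: cube_avg_def)
  qed
  also have "\<dots> \<in> borel_measurable lebesgue"
  proof (intro borel_measurable_times borel_measurable_const lebesgue.borel_measurable_lebesgue_integral)
    show "(\<lambda>(x, y). if y \<in> dyadic_cube k x then u y else 0) \<in> borel_measurable (lebesgue \<Otimes>\<^sub>M lebesgue)"
      using pred_dyadic_cube[of k] unfolding case_prod_beta by measurable
  qed
  finally show ?thesis .
qed

lemma cube_avg_Jensen:
  fixes f :: "'a::euclidean_space \<Rightarrow> real"
  assumes f: "f \<in> borel_measurable lebesgue" and r: "r > 1"
  shows "ennreal (\<bar>cube_avg k f x\<bar> powr r)
    \<le> ennreal ((2 ^ k) ^ DIM('a)) * (\<integral>\<^sup>+y. ennreal (\<bar>f y\<bar> powr r) * indicator (dyadic_cube k x) y \<partial>lebesgue)"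
proof -
  define N :: real where "N = (2 ^ k) ^ DIM('a)"
  have N: "N > 0" by (simp add: N_def)
  have "ennreal (\<bar>cube_avg k f x\<bar> powr r) = ennreal (N powr r) * ennreal (\<bar>\<integral>y. f y \<partial>lebesgue_on (dyadic_cube k x)\<bar> powr r)"
    using N by (simp add: cube_avg_def N_def[symmetric] abs_mult powr_mult ennreal_mult)
  also have "\<dots> \<le> ennreal (N powr r) * (ennreal ((1 / N) powr (r - 1)) *
      (\<integral>\<^sup>+y. ennreal (\<bar>f y\<bar> powr r) * indicator (dyadic_cube k x) y \<partial>lebesgue))"
    using set_Jensen_powr[OF dyadic_cube_lmeasurable _ f r, of k x] N
    by (intro mult_left_mono) (simp_all add: measure_dyadic_cube N_def)
  also have "\<dots> = ennreal (N powr r * (1 / N) powr (r - 1)) *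
      (\<integral>\<^sup>+y. ennreal (\<bar>f y\<bar> powr r) * indicator (dyadic_cube k x) y \<partial>lebesgue)"
    by (simp add: ennreal_mult mult.assoc)
  also have "N powr r * (1 / N) powr (r - 1) = N"
    using N by (simp add: powr_divide powr_diff)
  finally show ?thesis by (simp add: N_def)
qed

lemma cube_avg_diff_const:
  fixes u :: "'a::euclidean_space \<Rightarrow> real"
  assumes "integrable (lebesgue_on (dyadic_cube k x)) u"
  shows "cube_avg k (\<lambda>y. u y - c) x = cube_avg k u x - c"
proof -
  have fm: "finite_measure (lebesgue_on (dyadic_cube k x))"
    by (rule finite_measure_lebesgue_on[OF dyadic_cube_lmeasurable])
  then have "(\<integral>y. u y - c \<partial>lebesgue_on (dyadic_cube k x)) = (\<integral>y. u y \<partial>lebesgue_on (dyadic_cube k x)) - c / (2 ^ k) ^ DIM('a)"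
    using assms by (simp add: finite_measure.integrable_const measure_restrict_space measure_dyadic_cube)
  then show ?thesis by (simp add: cube_avg_def right_diff_distrib)
qed

section \<open>Approximation by cube averages and the form bound\<close>

lemma measurable_difference_quotient:
  fixes u :: "'a::euclidean_space \<Rightarrow> real"
  assumes [measurable]: "u \<in> borel_measurable lebesgue"
  shows "(\<lambda>z. ennreal (\<bar>u (fst z) - u (snd z)\<bar> powr p / norm (fst z - snd z) powr a))
      \<in> borel_measurable (lebesgue \<Otimes>\<^sub>M lebesgue)"
proof -
  have [measurable]: "(\<lambda>z. u (fst z)) \<in> borel_measurable (lebesgue \<Otimes>\<^sub>M lebesgue)"
    "(\<lambda>z. u (snd z)) \<in> borel_measurable (lebesgue \<Otimes>\<^sub>M lebesgue)"
    by (rule measurable_compose[OF measurable_fst assms] measurable_compose[OF measurable_snd assms])+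
  show ?thesis by measurable
qed

lemma gagliardo_integral_UNIV:
  "gagliardo_integral s p UNIV (u :: 'a::euclidean_space \<Rightarrow> real) = (\<integral>\<^sup>+x. \<integral>\<^sup>+y.
     ennreal (\<bar>u x - u y\<bar> powr p / norm (x - y) powr (real DIM('a) + s * p)) \<partial>lebesgue \<partial>lebesgue)"
  by (simp add: gagliardo_integral_def lebesgue_on_UNIV_eq)

text \<open>
  \<open>\<parallel>u - u\<^sub>k\<parallel>\<^sub>p\<^sup>p \<le> C 2\<^sup>-\<^sup>k\<^sup>s\<^sup>p E u\<close>: by Jensen \<open>\<bar>u x - u\<^sub>k x\<bar>\<^sup>p\<close> is at most the mean of
  \<open>\<bar>u x - u y\<bar>\<^sup>p\<close> over the points \<open>y\<close> of the cube of \<open>x\<close>, where \<open>\<bar>x - y\<bar> \<le> n 2\<^sup>-\<^sup>k\<close>.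
\<close>

lemma cube_avg_approx:
  fixes u :: "'a::euclidean_space \<Rightarrow> real"
  assumes p: "p > 1" and s: "s > 0" and u[measurable]: "u \<in> borel_measurable lebesgue"
    and fin: "(\<integral>\<^sup>+x. ennreal (\<bar>u x\<bar> powr p) \<partial>lebesgue) < \<infinity>"
  shows "(\<integral>\<^sup>+x. ennreal (\<bar>u x - cube_avg k u x\<bar> powr p) \<partial>lebesgue)
    \<le> ennreal (real DIM('a) powr (real DIM('a) + s * p) * 2 powr (- (s * p) * k)) * gagliardo_integral s p UNIV u"
proof -
  define n where "n = real DIM('a)"
  define N :: real where "N = (2 ^ k) ^ DIM('a)"
  define a where "a = n + s * p"
  define f where "f = (\<lambda>x y. ennreal (\<bar>u x - u y\<bar> powr p / norm (x - y) powr a))"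
  have n: "n > 0" by (simp add: n_def)
  have a: "a > 0" using n p s by (simp add: a_def add_pos_pos)
  have fm: "(\<lambda>(x, y). f x y) \<in> borel_measurable (lebesgue \<Otimes>\<^sub>M lebesgue)"
    using measurable_difference_quotient[OF u] by (simp add: f_def case_prod_beta)
  have [measurable]: "f x \<in> borel_measurable lebesgue" for x
    using measurable_compose[OF measurable_Pair1' fm, of x] by simp
  have [measurable]: "(\<lambda>x. \<integral>\<^sup>+y. f x y \<partial>lebesgue) \<in> borel_measurable lebesgue"
    using fm by (rule lebesgue.borel_measurable_nn_integral)
  have pw: "ennreal (\<bar>u x - cube_avg k u x\<bar> powr p) \<le> ennreal (N * (n / 2 ^ k) powr a) * (\<integral>\<^sup>+y. f x y \<partial>lebesgue)" for x
  proof -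
    have "integrable (lebesgue_on (dyadic_cube k x)) u"
      using set_integrable_of_powr[OF dyadic_cube_lmeasurable u fin] p by simp
    then have "\<bar>u x - cube_avg k u x\<bar> = \<bar>cube_avg k (\<lambda>y. u y - u x) x\<bar>"
      by (simp add: cube_avg_diff_const)
    then have "ennreal (\<bar>u x - cube_avg k u x\<bar> powr p)
      \<le> ennreal N * (\<integral>\<^sup>+y. ennreal (\<bar>u y - u x\<bar> powr p) * indicator (dyadic_cube k x) y \<partial>lebesgue)"
      using cube_avg_Jensen[of "\<lambda>y. u y - u x" p k x] p by (simp add: N_def)
    also have "\<dots> \<le> ennreal N * (\<integral>\<^sup>+y. ennreal ((n / 2 ^ k) powr a) * f x y \<partial>lebesgue)"
    proof (intro mult_left_mono nn_integral_mono)
      fix y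
      show "ennreal (\<bar>u y - u x\<bar> powr p) * indicator (dyadic_cube k x) y \<le> ennreal ((n / 2 ^ k) powr a) * f x y"
      proof (cases "y \<in> dyadic_cube k x \<and> x \<noteq> y")
        case True
        then have *: "norm (x - y) powr a \<le> (n / 2 ^ k) powr a" "norm (x - y) powr a > 0"
          using norm_diff_dyadic_cube_le[of y k x] a by (auto intro!: powr_mono2 simp: n_def)
        have "\<bar>u y - u x\<bar> powr p = norm (x - y) powr a * (\<bar>u x - u y\<bar> powr p / norm (x - y) powr a)"
          using *(2) by (simp add: abs_minus_commute)
        also have "\<dots> \<le> (n / 2 ^ k) powr a * (\<bar>u x - u y\<bar> powr p / norm (x - y) powr a)"
          using * by (intro mult_right_mono) auto
        finally show ?thesis using True by (simp add: f_def ennreal_mult[symmetric] ennreal_leI)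
      qed (auto simp: indicator_def)
    qed simp
    also have "\<dots> = ennreal (N * (n / 2 ^ k) powr a) * (\<integral>\<^sup>+y. f x y \<partial>lebesgue)"
      by (subst nn_integral_cmult) (simp_all add: ennreal_mult N_def mult.assoc)
    finally show ?thesis .
  qed
  have "(\<integral>\<^sup>+x. ennreal (\<bar>u x - cube_avg k u x\<bar> powr p) \<partial>lebesgue)
    \<le> (\<integral>\<^sup>+x. ennreal (N * (n / 2 ^ k) powr a) * (\<integral>\<^sup>+y. f x y \<partial>lebesgue) \<partial>lebesgue)"
    using pw by (rule nn_integral_mono)
  also have "\<dots> = ennreal (N * (n / 2 ^ k) powr a) * gagliardo_integral s p UNIV u"
    by (subst nn_integral_cmult) (simp_all add: gagliardo_integral_UNIV f_def a_def n_def)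
  also have "N * (n / 2 ^ k) powr a = n powr a * 2 powr (- (s * p) * k)"
  proof -
    have "N = 2 powr (k * n)" by (simp add: N_def n_def powr_realpow[symmetric] powr_powr powr_mult)
    moreover have "(n / 2 ^ k) powr a = n powr a * 2 powr (- (k * a))"
      using n by (simp add: powr_divide powr_realpow[symmetric] powr_powr powr_minus_divide)
    ultimately have "N * (n / 2 ^ k) powr a = n powr a * 2 powr (k * n + - (k * a))"
      by (simp only: powr_add) simp
    then show ?thesis by (simp add: a_def algebra_simps)
  qed
  finally show ?thesis by (simp add: n_def a_def)
qed

text \<open>
  On a cube of generation \<open>k + 1\<close> the increment \<open>u\<^sub>k\<^sub>+\<^sub>1 - u\<^sub>k\<close> is constant and is the mean of
  \<open>u - u\<^sub>k\<close>. Hence, after Jensen and Fubini, the weight only enters through its integral over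
  single cubes, to which Hoelder's inequality applies.
\<close>

lemma weighted_increment_bound:
  fixes u V :: "'a::euclidean_space \<Rightarrow> real"
  assumes p: "p > 1" and q: "q > 1" and u[measurable]: "u \<in> borel_measurable lebesgue"
    and fin: "(\<integral>\<^sup>+x. ennreal (\<bar>u x\<bar> powr p) \<partial>lebesgue) < \<infinity>"
    and V[measurable]: "V \<in> borel_measurable lebesgue" and Vq: "integrable lebesgue (\<lambda>x. \<bar>V x\<bar> powr q)"
  shows "(\<integral>\<^sup>+x. ennreal (\<bar>V x\<bar> * \<bar>cube_avg (Suc k) u x - cube_avg k u x\<bar> powr p) \<partial>lebesgue)
    \<le> ennreal (2 powr (real (Suc k) * DIM('a) / q) * (\<integral>x. \<bar>V x\<bar> powr q \<partial>lebesgue) powr (1/q))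
        * (\<integral>\<^sup>+x. ennreal (\<bar>u x - cube_avg k u x\<bar> powr p) \<partial>lebesgue)"
proof -
  define N :: real where "N = (2 ^ Suc k) ^ DIM('a)"
  define L where "L = (\<integral>x. \<bar>V x\<bar> powr q \<partial>lebesgue) powr (1/q)"
  define g where "g x = ennreal (\<bar>u x - cube_avg k u x\<bar> powr p)" for x
  have [measurable]: "g \<in> borel_measurable lebesgue" unfolding g_def by measurable
  have N: "N > 0" by (simp add: N_def)
  let ?Q = "dyadic_cube (Suc k)"
  have pw: "ennreal (\<bar>cube_avg (Suc k) u x - cube_avg k u x\<bar> powr p)
      \<le> ennreal N * (\<integral>\<^sup>+y. g y * indicator (?Q x) y \<partial>lebesgue)" for x
  proof -
    have "integrable (lebesgue_on (?Q x)) u"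
      using set_integrable_of_powr[OF dyadic_cube_lmeasurable u fin] p by simp
    then have "cube_avg (Suc k) u x - cube_avg k u x = cube_avg (Suc k) (\<lambda>y. u y - cube_avg k u x) x"
      by (simp add: cube_avg_diff_const)
    then have "ennreal (\<bar>cube_avg (Suc k) u x - cube_avg k u x\<bar> powr p)
      \<le> ennreal N * (\<integral>\<^sup>+y. ennreal (\<bar>u y - cube_avg k u x\<bar> powr p) * indicator (?Q x) y \<partial>lebesgue)"
      using cube_avg_Jensen[of "\<lambda>y. u y - cube_avg k u x" p "Suc k" x] p by (simp add: N_def)
    also have "(\<integral>\<^sup>+y. ennreal (\<bar>u y - cube_avg k u x\<bar> powr p) * indicator (?Q x) y \<partial>lebesgue)
        = (\<integral>\<^sup>+y. g y * indicator (?Q x) y \<partial>lebesgue)"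
      using dyadic_cube_Suc_subset[of k x]
      by (intro nn_integral_cong) (auto simp: g_def indicator_def cube_avg_cong_cube subset_iff)
    finally show ?thesis .
  qed
  have ind: "(\<lambda>(x, y). indicator (?Q x) y :: ennreal) \<in> borel_measurable (lebesgue \<Otimes>\<^sub>M lebesgue)"
    using borel_measurable_indicator'[OF pred_dyadic_cube[of "Suc k", unfolded pred_def]] by (simp add: indicator_def case_prod_beta)
  have joint: "(\<lambda>(x, y). ennreal \<bar>V x\<bar> * (g y * indicator (?Q x) y)) \<in> borel_measurable (lebesgue \<Otimes>\<^sub>M lebesgue)"
    using ind measurable_compose[OF measurable_fst V, of lebesgue] measurable_compose[OF measurable_snd, of g lebesgue borel lebesgue]
    unfolding case_prod_beta by (intro borel_measurable_times_ennreal) auto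
  have "(\<integral>\<^sup>+x. ennreal (\<bar>V x\<bar> * \<bar>cube_avg (Suc k) u x - cube_avg k u x\<bar> powr p) \<partial>lebesgue)
     \<le> (\<integral>\<^sup>+x. ennreal N * (\<integral>\<^sup>+y. ennreal \<bar>V x\<bar> * (g y * indicator (?Q x) y) \<partial>lebesgue) \<partial>lebesgue)"
  proof (rule nn_integral_mono)
    fix x
    have "ennreal (\<bar>V x\<bar> * \<bar>cube_avg (Suc k) u x - cube_avg k u x\<bar> powr p)
       \<le> ennreal \<bar>V x\<bar> * (ennreal N * (\<integral>\<^sup>+y. g y * indicator (?Q x) y \<partial>lebesgue))"
      using pw[of x] by (simp add: ennreal_mult mult_left_mono)
    also have "\<dots> = ennreal N * (\<integral>\<^sup>+y. ennreal \<bar>V x\<bar> * (g y * indicator (?Q x) y) \<partial>lebesgue)"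
      by (subst nn_integral_cmult) (simp_all add: ac_simps)
    finally show "ennreal (\<bar>V x\<bar> * \<bar>cube_avg (Suc k) u x - cube_avg k u x\<bar> powr p)
       \<le> ennreal N * (\<integral>\<^sup>+y. ennreal \<bar>V x\<bar> * (g y * indicator (?Q x) y) \<partial>lebesgue)" .
  qed
  also have "\<dots> = ennreal N * (\<integral>\<^sup>+x. \<integral>\<^sup>+y. ennreal \<bar>V x\<bar> * (g y * indicator (?Q x) y) \<partial>lebesgue \<partial>lebesgue)"
    using joint by (intro nn_integral_cmult lebesgue.borel_measurable_nn_integral)
  also have "\<dots> = ennreal N * (\<integral>\<^sup>+y. \<integral>\<^sup>+x. ennreal \<bar>V x\<bar> * (g y * indicator (?Q x) y) \<partial>lebesgue \<partial>lebesgue)"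
    using lebesgue_pair.Fubini'[OF joint] by simp
  also have "\<dots> \<le> ennreal N * (\<integral>\<^sup>+y. ennreal (N powr (1/q - 1) * L) * g y \<partial>lebesgue)"
  proof (intro mult_left_mono nn_integral_mono)
    fix y
    have "(\<integral>\<^sup>+x. ennreal \<bar>V x\<bar> * (g y * indicator (?Q x) y) \<partial>lebesgue) = (\<integral>\<^sup>+x. g y * (ennreal \<bar>V x\<bar> * indicator (?Q y) x) \<partial>lebesgue)"
      by (intro nn_integral_cong) (auto simp: indicator_def dyadic_cube_sym ac_simps)
    also have "\<dots> = g y * (\<integral>\<^sup>+x. ennreal \<bar>V x\<bar> * indicator (?Q y) x \<partial>lebesgue)"
      by (rule nn_integral_cmult) measurable
    also have "\<dots> \<le> g y * ennreal ((1 / N) powr (1 - 1/q) * L)"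
      using set_nn_integral_le_powr[OF dyadic_cube_lmeasurable _ V Vq q, of "Suc k" y] N
      by (intro mult_left_mono) (simp_all add: measure_dyadic_cube L_def N_def)
    also have "(1 / N) powr (1 - 1/q) = N powr (1/q - 1)"
      using N by (simp add: powr_divide powr_diff)
    finally show "(\<integral>\<^sup>+x. ennreal \<bar>V x\<bar> * (g y * indicator (?Q x) y) \<partial>lebesgue) \<le> ennreal (N powr (1/q - 1) * L) * g y"
      by (simp add: mult.commute)
  qed simp
  also have "\<dots> = ennreal (N * (N powr (1/q - 1) * L)) * (\<integral>\<^sup>+y. g y \<partial>lebesgue)"
    using N by (subst nn_integral_cmult) (simp_all add: ennreal_mult mult.assoc L_def)
  also have "N * (N powr (1/q - 1) * L) = 2 powr (real (Suc k) * DIM('a) / q) * L"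
  proof -
    have "N * N powr (1/q - 1) = N powr (1/q)" using N by (simp add: powr_diff)
    also have "\<dots> = 2 powr (real (Suc k) * DIM('a) / q)"
      unfolding N_def by (subst power_mult[symmetric], subst powr_realpow[symmetric]) (simp_all add: powr_powr algebra_simps add_divide_distrib)
    finally show ?thesis by (simp add: mult.assoc[symmetric])
  qed
  finally show ?thesis by (simp add: g_def L_def)
qed

text \<open>
  If the weighted sum on the right is finite, then the increments decay geometrically, and the
  telescoping series from index \<open>k\<close> on is dominated by a geometric series.
\<close>

lemma telescoping_powr_bound:
  fixes a :: "nat \<Rightarrow> real"
  assumes t: "0 < t" "t < 1" and p: "p > 0" and a: "a \<longlonglongrightarrow> l"
  shows "ennreal (\<bar>l - a k\<bar> powr p) \<le> ennreal ((1 / (1 - t powr (1/p))) powr p * t ^ k)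
     * (\<Sum>j. ennreal ((1/t) ^ j * \<bar>a (Suc j) - a j\<bar> powr p))" (is "_ \<le> ennreal ?c * ?S")
proof -
  define h where "h = t powr (1/p)"
  have h: "0 < h" "h < 1" using t p powr_less_mono2[of "1/p" t 1] by (auto simp: h_def)
  have c: "?c > 0" using h t by (simp add: h_def[symmetric])
  show ?thesis
  proof (cases "?S")
    case top
    have "ennreal ?c \<noteq> 0" using c by (simp only: ennreal_eq_0_iff not_le)
    then show ?thesis unfolding top by (simp only: ennreal_mult_top if_False top_greatest)
  next
    case (real S)
    have d: "\<bar>a (Suc j) - a j\<bar> \<le> S powr (1/p) * h ^ j" for j
    proof -
      have "(\<Sum>i\<in>{j}. ennreal ((1/t) ^ i * \<bar>a (Suc i) - a i\<bar> powr p)) \<le> ?S"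
        by (rule sum_le_suminf) auto
      then have "(1/t) ^ j * \<bar>a (Suc j) - a j\<bar> powr p \<le> S" using real by (simp add: ennreal_le_iff)
      then have "\<bar>a (Suc j) - a j\<bar> powr p \<le> S * t ^ j" using t by (simp add: field_simps)
      then have "(\<bar>a (Suc j) - a j\<bar> powr p) powr (1/p) \<le> (S * t ^ j) powr (1/p)"
        using p by (intro powr_mono2) auto
      also have "(S * t ^ j) powr (1/p) = S powr (1/p) * h ^ j"
        using t by (simp add: powr_mult h_def powr_realpow[symmetric] powr_powr mult.commute)
      finally show ?thesis using p by (simp add: powr_powr)
    qed
    have step: "\<bar>a (k + m) - a k\<bar> \<le> S powr (1/p) * (h ^ k / (1 - h))" for m
    proof -
      have "a (k + m) - a k = (\<Sum>i<m. a (Suc (k + i)) - a (k + i))"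
        using sum_lessThan_telescope[of "\<lambda>i. a (k + i)" m] by simp
      then have "\<bar>a (k + m) - a k\<bar> \<le> (\<Sum>i<m. S powr (1/p) * h ^ (k + i))"
        using d by (auto intro!: order_trans[OF sum_abs] sum_mono)
      also have "\<dots> = S powr (1/p) * h ^ k * (\<Sum>i<m. h ^ i)" by (simp add: sum_distrib_left power_add mult.assoc)
      also have "(\<Sum>i<m. h ^ i) \<le> (\<Sum>i. h ^ i)" using h by (intro sum_le_suminf summable_geometric) auto
      also have "\<dots> = 1 / (1 - h)" using h by (simp add: suminf_geometric)
      finally show ?thesis using h by (simp add: mult_left_mono)
    qed
    have "(\<lambda>m. \<bar>a (k + m) - a k\<bar>) \<longlonglongrightarrow> \<bar>l - a k\<bar>"
      using LIMSEQ_ignore_initial_segment[OF a, of k] by (intro tendsto_intros) (simp add: add.commute)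
    then have "\<bar>l - a k\<bar> \<le> S powr (1/p) * (h ^ k / (1 - h))"
      using step by (intro LIMSEQ_le_const2) auto
    then have "\<bar>l - a k\<bar> powr p \<le> (S powr (1/p) * (h ^ k / (1 - h))) powr p"
      using p by (intro powr_mono2) auto
    also have "\<dots> = ?c * S"
    proof -
      have "(h ^ k) powr p = t ^ k" using t p by (simp add: h_def powr_realpow[symmetric] powr_powr mult.commute)
      then show ?thesis using real p h by (simp add: powr_mult powr_powr powr_divide h_def[symmetric])
    qed
    finally show ?thesis using real c by (simp add: ennreal_mult[symmetric] ennreal_leI)
  qed
qed

lemma abs_powr_tendsto_0D:
  fixes d :: "nat \<Rightarrow> real"
  assumes p: "p > 0" and "(\<lambda>k. \<bar>d k\<bar> powr p) \<longlonglongrightarrow> 0"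
  shows "d \<longlonglongrightarrow> 0"
proof -
  have "(\<lambda>k. (\<bar>d k\<bar> powr p) powr (1/p)) \<longlonglongrightarrow> 0 powr (1/p)"
    using assms by (intro tendsto_powr') auto
  then have "(\<lambda>k. \<bar>d k\<bar>) \<longlonglongrightarrow> 0" using p by (simp add: powr_powr)
  then show ?thesis by (simp add: tendsto_rabs_zero_iff)
qed

text \<open>
  For functions of finite energy this needs no differentiation theorem: the errors
  \<open>\<parallel>u - u\<^sub>k\<parallel>\<^sub>p\<^sup>p\<close> are summable.
\<close>

lemma AE_cube_avg_tendsto:
  fixes u :: "'a::euclidean_space \<Rightarrow> real"
  assumes p: "p > 1" and s: "s > 0" and u[measurable]: "u \<in> borel_measurable lebesgue"
    and fin: "(\<integral>\<^sup>+x. ennreal (\<bar>u x\<bar> powr p) \<partial>lebesgue) < \<infinity>" and E: "gagliardo_integral s p UNIV u < \<infinity>"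
  shows "AE x in lebesgue. (\<lambda>k. cube_avg k u x) \<longlonglongrightarrow> u x"
proof -
  define c where "c = real DIM('a) powr (real DIM('a) + s * p)"
  obtain e where e: "gagliardo_integral s p UNIV u = ennreal e" "e \<ge> 0"
    using E by (cases "gagliardo_integral s p UNIV u") auto
  define r where "r = 2 powr (- (s * p))"
  have r: "0 < r" "r < 1" using s p by (auto simp: r_def powr_less_one)
  have rk: "2 powr (- (s * p) * k) = r ^ k" for k :: nat
    by (simp add: r_def powr_realpow[symmetric] powr_powr)
  have c0: "c \<ge> 0" by (simp add: c_def)
  have "(\<integral>\<^sup>+x. (\<Sum>k. ennreal (\<bar>u x - cube_avg k u x\<bar> powr p)) \<partial>lebesgue)
     = (\<Sum>k. \<integral>\<^sup>+x. ennreal (\<bar>u x - cube_avg k u x\<bar> powr p) \<partial>lebesgue)"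
    by (intro nn_integral_suminf) measurable
  also have "\<dots> \<le> (\<Sum>k. ennreal (c * e * r ^ k))"
  proof (intro suminf_le)
    fix k
    show "(\<integral>\<^sup>+x. ennreal (\<bar>u x - cube_avg k u x\<bar> powr p) \<partial>lebesgue) \<le> ennreal (c * e * r ^ k)"
      using cube_avg_approx[OF p s u fin, of k] e(2) c0 r
      unfolding e(1) rk c_def[symmetric] by (simp add: ennreal_mult[symmetric] ac_simps)
  qed auto
  also have "\<dots> < \<infinity>"
    using summable_mult[OF summable_geometric, of r "c * e"] r c0 e(2) by (subst suminf_ennreal2) auto
  finally have "(\<integral>\<^sup>+x. (\<Sum>k. ennreal (\<bar>u x - cube_avg k u x\<bar> powr p)) \<partial>lebesgue) \<noteq> \<infinity>" by simp
  then have "AE x in lebesgue. (\<Sum>k. ennreal (\<bar>u x - cube_avg k u x\<bar> powr p)) \<noteq> \<infinity>"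
    by (intro nn_integral_PInf_AE) measurable
  then show ?thesis
  proof eventually_elim
    case (elim x)
    then have "summable (\<lambda>k. \<bar>u x - cube_avg k u x\<bar> powr p)"
      by (intro summable_suminf_not_top) auto
    from summable_LIMSEQ_zero[OF this] have "(\<lambda>k. u x - cube_avg k u x) \<longlonglongrightarrow> 0"
      using abs_powr_tendsto_0D[of p "\<lambda>k. u x - cube_avg k u x"] p by simp
    from tendsto_diff[OF tendsto_const[of "u x"] this] show ?case by simp
  qed
qed

text \<open>
  The weighted analogue of \<open>cube_avg_approx\<close>. Here \<open>t\<^sup>2\<close> is \<open>2\<close> to the power
  \<open>- (sp - n/q)\<close>, the ratio by which the weighted increments decay; half of this decay is spent on
  making the telescoping series converge.
\<close>

proposition weighted_cube_avg_approx:
  assumes s: "s > 0" and p: "p > 1" and q: "q > 1" and sub: "real DIM('a::euclidean_space) / (s * p) < q"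
  obtains C t where "C > 0" "0 < t" "t < 1"
    "\<And>(u :: 'a \<Rightarrow> real) V k. u \<in> borel_measurable lebesgue \<Longrightarrow>
       (\<integral>\<^sup>+x. ennreal (\<bar>u x\<bar> powr p) \<partial>lebesgue) < \<infinity> \<Longrightarrow> gagliardo_integral s p UNIV u < \<infinity> \<Longrightarrow>
       V \<in> borel_measurable lebesgue \<Longrightarrow> integrable lebesgue (\<lambda>x. \<bar>V x\<bar> powr q) \<Longrightarrow>
       (\<integral>\<^sup>+x. ennreal (\<bar>V x\<bar> * \<bar>u x - cube_avg k u x\<bar> powr p) \<partial>lebesgue)
         \<le> ennreal (C * t ^ k * (\<integral>x. \<bar>V x\<bar> powr q \<partial>lebesgue) powr (1/q)) * gagliardo_integral s p UNIV u"
proof -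
  define n where "n = real DIM('a)"
  define \<sigma> where "\<sigma> = s * p - n / q"
  define t where "t = 2 powr (- \<sigma> / 2)"
  define c0 where "c0 = n powr (n + s * p)"
  define c1 where "c1 = (1 / (1 - t powr (1/p))) powr p"
  define C where "C = c1 * (2 powr (n/q) * c0 / (1 - t))"
  have "\<sigma> > 0" using sub s p q by (simp add: \<sigma>_def n_def field_simps)
  then have t: "0 < t" "t < 1" by (auto simp: t_def powr_less_one)
  have n: "n > 0" by (simp add: n_def)
  have h: "t powr (1/p) < 1" using t p powr_less_mono2[of "1/p" t 1] by auto
  have c: "c0 > 0" "c1 > 0" "C > 0" using n h t by (auto simp: c0_def c1_def C_def intro!: divide_pos_pos mult_pos_pos)
  show ?thesis
  proof (rule that[OF c(3) t])
    fix u V :: "'a \<Rightarrow> real" and k :: nat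
    assume u[measurable]: "u \<in> borel_measurable lebesgue"
      and fin: "(\<integral>\<^sup>+x. ennreal (\<bar>u x\<bar> powr p) \<partial>lebesgue) < \<infinity>" and E: "gagliardo_integral s p UNIV u < \<infinity>"
      and V[measurable]: "V \<in> borel_measurable lebesgue" and Vq: "integrable lebesgue (\<lambda>x. \<bar>V x\<bar> powr q)"
    define L where "L = (\<integral>x. \<bar>V x\<bar> powr q \<partial>lebesgue) powr (1/q)"
    define d where "d j x = \<bar>cube_avg (Suc j) u x - cube_avg j u x\<bar> powr p" for j x
    have [measurable]: "d j \<in> borel_measurable lebesgue" for j unfolding d_def by measurable
    have d0: "d j x \<ge> 0" for j x by (simp add: d_def)
    obtain e where e: "gagliardo_integral s p UNIV u = ennreal e" "e \<ge> 0"
      using E by (cases "gagliardo_integral s p UNIV u") auto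
    have L: "L \<ge> 0" by (simp add: L_def)
    have inc: "(\<integral>\<^sup>+x. ennreal (\<bar>V x\<bar> * d j x) \<partial>lebesgue) \<le> ennreal (2 powr (n/q) * c0 * L * e * (t\<^sup>2) ^ j)" for j
    proof -
      have "(\<integral>\<^sup>+x. ennreal (\<bar>V x\<bar> * d j x) \<partial>lebesgue)
        \<le> ennreal (2 powr (real (Suc j) * n / q) * L) * (\<integral>\<^sup>+x. ennreal (\<bar>u x - cube_avg j u x\<bar> powr p) \<partial>lebesgue)"
        unfolding d_def L_def n_def by (rule weighted_increment_bound[OF p q u fin V Vq])
      also have "\<dots> \<le> ennreal (2 powr (real (Suc j) * n / q) * L) * (ennreal (c0 * 2 powr (- (s * p) * j)) * ennreal e)"
        using cube_avg_approx[OF p s u fin, of j] unfolding e(1) c0_def n_def by (intro mult_left_mono) auto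
      also have "\<dots> = ennreal (2 powr (real (Suc j) * n / q) * L * (c0 * 2 powr (- (s * p) * j) * e))"
        using L c(1) e(2) by (simp only: ennreal_mult[symmetric] mult_nonneg_nonneg powr_ge_zero less_imp_le)
      also have "2 powr (real (Suc j) * n / q) * L * (c0 * 2 powr (- (s * p) * j) * e)
          = (2 powr (real (Suc j) * n / q) * 2 powr (- (s * p) * j)) * (c0 * L * e)"
        by (simp add: ac_simps)
      also have "2 powr (real (Suc j) * n / q) * 2 powr (- (s * p) * j) = 2 powr (n/q) * (t\<^sup>2) ^ j"
      proof -
        have "(t\<^sup>2) ^ j = 2 powr (- \<sigma> * j)"
          by (simp add: t_def powr_realpow[symmetric] powr_powr power_mult[symmetric])
        then show ?thesis by (simp add: powr_add[symmetric] \<sigma>_def algebra_simps add_divide_distrib)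
      qed
      finally show ?thesis by (simp add: ac_simps)
    qed
    have "(\<integral>\<^sup>+x. ennreal (\<bar>V x\<bar> * \<bar>u x - cube_avg k u x\<bar> powr p) \<partial>lebesgue)
       \<le> (\<integral>\<^sup>+x. ennreal (c1 * t ^ k) * (\<Sum>j. ennreal ((1/t) ^ j) * ennreal (\<bar>V x\<bar> * d j x)) \<partial>lebesgue)"
    proof (rule nn_integral_mono_AE, use AE_cube_avg_tendsto[OF p s u fin E] in eventually_elim)
      case (elim x)
      have "ennreal (\<bar>V x\<bar> * \<bar>u x - cube_avg k u x\<bar> powr p) = ennreal \<bar>V x\<bar> * ennreal (\<bar>u x - cube_avg k u x\<bar> powr p)"
        by (simp add: ennreal_mult)
      also have "\<dots> \<le> ennreal \<bar>V x\<bar> * (ennreal (c1 * t ^ k) * (\<Sum>j. ennreal ((1/t) ^ j * d j x)))"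
        using telescoping_powr_bound[OF t _ elim, of p k] p by (intro mult_left_mono) (auto simp: c1_def d_def)
      also have "\<dots> = ennreal (c1 * t ^ k) * (\<Sum>j. ennreal \<bar>V x\<bar> * ennreal ((1/t) ^ j * d j x))"
        by (subst ennreal_suminf_cmult) (simp add: ac_simps)
      also have "(\<Sum>j. ennreal \<bar>V x\<bar> * ennreal ((1/t) ^ j * d j x)) = (\<Sum>j. ennreal ((1/t) ^ j) * ennreal (\<bar>V x\<bar> * d j x))"
        using d0 t by (intro suminf_cong) (simp add: ennreal_mult[symmetric] ac_simps)
      finally show ?case .
    qed
    also have "\<dots> = ennreal (c1 * t ^ k) * (\<Sum>j. ennreal ((1/t) ^ j) * (\<integral>\<^sup>+x. ennreal (\<bar>V x\<bar> * d j x) \<partial>lebesgue))"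
      by (subst nn_integral_cmult, measurable) (simp add: nn_integral_suminf nn_integral_cmult)
    also have "\<dots> \<le> ennreal (c1 * t ^ k) * (\<Sum>j. ennreal ((1/t) ^ j) * ennreal (2 powr (n/q) * c0 * L * e * (t\<^sup>2) ^ j))"
      by (intro mult_left_mono suminf_le inc) auto
    also have "(\<Sum>j. ennreal ((1/t) ^ j) * ennreal (2 powr (n/q) * c0 * L * e * (t\<^sup>2) ^ j))
        = (\<Sum>j. ennreal (2 powr (n/q) * c0 * L * e * t ^ j))"
    proof (intro suminf_cong)
      fix j
      have "(1/t) ^ j * (t\<^sup>2) ^ j = t ^ j" using t by (simp add: power_mult_distrib[symmetric] power2_eq_square)
      then have "(1/t) ^ j * (2 powr (n/q) * c0 * L * e * (t\<^sup>2) ^ j) = 2 powr (n/q) * c0 * L * e * t ^ j"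
        by (metis mult.left_commute)
      then show "ennreal ((1/t) ^ j) * ennreal (2 powr (n/q) * c0 * L * e * (t\<^sup>2) ^ j) = ennreal (2 powr (n/q) * c0 * L * e * t ^ j)"
        using t c L e by (simp add: ennreal_mult[symmetric])
    qed
    also have "\<dots> = ennreal (2 powr (n/q) * c0 * L * e * (1 / (1 - t)))"
      using t c L e by (subst suminf_ennreal2) (auto intro!: summable_mult summable_geometric simp: suminf_mult suminf_geometric)
    also have "ennreal (c1 * t ^ k) * \<dots> = ennreal (C * t ^ k * L) * ennreal e"
      using t c L e by (simp add: ennreal_mult[symmetric] C_def ac_simps)
    finally show "(\<integral>\<^sup>+x. ennreal (\<bar>V x\<bar> * \<bar>u x - cube_avg k u x\<bar> powr p) \<partial>lebesgue)
         \<le> ennreal (C * t ^ k * (\<integral>x. \<bar>V x\<bar> powr q \<partial>lebesgue) powr (1/q)) * gagliardo_integral s p UNIV u"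
      by (simp add: L_def e(1))
  qed
qed

proposition form_bound:
  fixes \<Omega> :: "'a::euclidean_space set"
  assumes s: "s > 0" and p: "p > 1" and q: "q > 1" and sub: "real DIM('a) / (s * p) < q"
    and \<Omega>: "bounded \<Omega>" and e: "e > 0"
  obtains K where "K > 0"
    "\<And>(u :: 'a \<Rightarrow> real) V. u \<in> borel_measurable lebesgue \<Longrightarrow>
       (\<integral>\<^sup>+x. ennreal (\<bar>u x\<bar> powr p) \<partial>lebesgue) < \<infinity> \<Longrightarrow> gagliardo_integral s p UNIV u < \<infinity> \<Longrightarrow>
       V \<in> borel_measurable lebesgue \<Longrightarrow> integrable lebesgue (\<lambda>x. \<bar>V x\<bar> powr q) \<Longrightarrow> (\<And>x. x \<notin> \<Omega> \<Longrightarrow> V x = 0) \<Longrightarrow>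
       (\<integral>\<^sup>+x. ennreal (\<bar>V x\<bar> * \<bar>u x\<bar> powr p) \<partial>lebesgue)
         \<le> ennreal ((\<integral>x. \<bar>V x\<bar> powr q \<partial>lebesgue) powr (1/q)) *
           (ennreal e * gagliardo_integral s p UNIV u + ennreal K * (\<integral>\<^sup>+x. ennreal (\<bar>u x\<bar> powr p) \<partial>lebesgue))"
proof -
  obtain C t where C: "C > 0" "0 < t" "t < 1" and approx:
    "\<And>(u :: 'a \<Rightarrow> real) V k. u \<in> borel_measurable lebesgue \<Longrightarrow>
       (\<integral>\<^sup>+x. ennreal (\<bar>u x\<bar> powr p) \<partial>lebesgue) < \<infinity> \<Longrightarrow> gagliardo_integral s p UNIV u < \<infinity> \<Longrightarrow>
       V \<in> borel_measurable lebesgue \<Longrightarrow> integrable lebesgue (\<lambda>x. \<bar>V x\<bar> powr q) \<Longrightarrow>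
       (\<integral>\<^sup>+x. ennreal (\<bar>V x\<bar> * \<bar>u x - cube_avg k u x\<bar> powr p) \<partial>lebesgue)
         \<le> ennreal (C * t ^ k * (\<integral>x. \<bar>V x\<bar> powr q \<partial>lebesgue) powr (1/q)) * gagliardo_integral s p UNIV u"
    using weighted_cube_avg_approx[OF s p q sub] by blast
  obtain R where R: "R > 0" "\<Omega> \<subseteq> ball 0 R" using bounded_subset_ballD[OF \<Omega>, of 0] by auto
  have "(\<lambda>k. 2 powr p * C * t ^ k) \<longlonglongrightarrow> 2 powr p * C * 0"
    using C by (intro tendsto_intros LIMSEQ_power_zero) auto
  then have "\<forall>\<^sub>F k in sequentially. 2 powr p * C * t ^ k < e" using e by (intro order_tendstoD) auto
  then obtain k where k: "2 powr p * C * t ^ k < e" by (auto dest: eventually_happens)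
  define N :: real where "N = (2 ^ k) ^ DIM('a)"
  define b where "b = measure lebesgue (ball (0::'a) R) powr (1 - 1/q)"
  have b: "b > 0" using R content_ball_pos[of R "0::'a"] by (simp add: b_def)
  define K where "K = 2 powr p * N * b"
  have N: "N > 0" by (simp add: N_def)
  show ?thesis
  proof (rule that)
    show "K > 0" using N b by (simp add: K_def)
    fix u V :: "'a \<Rightarrow> real"
    assume u[measurable]: "u \<in> borel_measurable lebesgue"
      and fin: "(\<integral>\<^sup>+x. ennreal (\<bar>u x\<bar> powr p) \<partial>lebesgue) < \<infinity>" and E: "gagliardo_integral s p UNIV u < \<infinity>"
      and V[measurable]: "V \<in> borel_measurable lebesgue" and Vq: "integrable lebesgue (\<lambda>x. \<bar>V x\<bar> powr q)"
      and V0: "\<And>x. x \<notin> \<Omega> \<Longrightarrow> V x = 0"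
    define L where "L = (\<integral>x. \<bar>V x\<bar> powr q \<partial>lebesgue) powr (1/q)"
    define U where "U = (\<integral>\<^sup>+x. ennreal (\<bar>u x\<bar> powr p) \<partial>lebesgue)"
    have L: "L \<ge> 0" by (simp add: L_def)
    have [measurable]: "ball 0 R \<in> sets (lebesgue :: 'a measure)" by simp
    have "(\<integral>\<^sup>+x. ennreal (\<bar>V x\<bar> * \<bar>u x\<bar> powr p) \<partial>lebesgue)
      \<le> (\<integral>\<^sup>+x. ennreal (2 powr p) * (ennreal (\<bar>V x\<bar> * \<bar>u x - cube_avg k u x\<bar> powr p)
            + (ennreal N * U) * (ennreal \<bar>V x\<bar> * indicator (ball 0 R) x)) \<partial>lebesgue)"
    proof (rule nn_integral_mono)
      fix x
      have 1: "ennreal (\<bar>cube_avg k u x\<bar> powr p) \<le> ennreal N * U"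
        using cube_avg_Jensen[OF u p, of k x] unfolding N_def U_def
        by (elim order_trans) (auto intro!: mult_left_mono nn_integral_mono simp: indicator_def)
      have 2: "ennreal \<bar>V x\<bar> = ennreal \<bar>V x\<bar> * indicator (ball 0 R) x"
        using V0 R(2) by (auto simp: indicator_def subset_iff)
      have "ennreal (\<bar>V x\<bar> * \<bar>u x\<bar> powr p) \<le> ennreal (\<bar>V x\<bar> * (2 powr p * (\<bar>u x - cube_avg k u x\<bar> powr p + \<bar>cube_avg k u x\<bar> powr p)))"
        using abs_add_powr_le[of p "u x - cube_avg k u x" "cube_avg k u x"] p by (intro ennreal_leI mult_left_mono) auto
      also have "\<dots> = ennreal (2 powr p) * (ennreal (\<bar>V x\<bar> * \<bar>u x - cube_avg k u x\<bar> powr p)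
            + ennreal (\<bar>cube_avg k u x\<bar> powr p) * ennreal \<bar>V x\<bar>)"
        by (simp add: ennreal_mult[symmetric] ennreal_plus[symmetric] algebra_simps del: ennreal_plus)
      also have "\<dots> \<le> ennreal (2 powr p) * (ennreal (\<bar>V x\<bar> * \<bar>u x - cube_avg k u x\<bar> powr p)
            + (ennreal N * U) * ennreal \<bar>V x\<bar>)"
        using 1 by (intro mult_left_mono add_left_mono mult_right_mono) auto
      finally show "ennreal (\<bar>V x\<bar> * \<bar>u x\<bar> powr p) \<le> ennreal (2 powr p) * (ennreal (\<bar>V x\<bar> * \<bar>u x - cube_avg k u x\<bar> powr p)
            + (ennreal N * U) * (ennreal \<bar>V x\<bar> * indicator (ball 0 R) x))"
        using 2 by simp
    qed
    also have "\<dots> = ennreal (2 powr p) * ((\<integral>\<^sup>+x. ennreal (\<bar>V x\<bar> * \<bar>u x - cube_avg k u x\<bar> powr p) \<partial>lebesgue)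
            + (ennreal N * U) * (\<integral>\<^sup>+x. ennreal \<bar>V x\<bar> * indicator (ball 0 R) x \<partial>lebesgue))"
      by (subst nn_integral_cmult, measurable, subst nn_integral_add, measurable, subst nn_integral_cmult, measurable)
    also have "\<dots> \<le> ennreal (2 powr p) * (ennreal (C * t ^ k * L) * gagliardo_integral s p UNIV u
            + (ennreal N * U) * ennreal (b * L))"
      using approx[OF u fin E V Vq, of k] set_nn_integral_le_powr[OF _ _ V Vq q, of "ball 0 R"] R content_ball_pos[of R "0::'a"]
      by (intro mult_left_mono add_mono) (auto simp: L_def b_def)
    also have "\<dots> = ennreal L * (ennreal (2 powr p * C * t ^ k) * gagliardo_integral s p UNIV u + ennreal K * U)"
      using L C N b by (simp add: K_def ennreal_mult algebra_simps)
    also have "\<dots> \<le> ennreal L * (ennreal e * gagliardo_integral s p UNIV u + ennreal K * U)"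
      using k by (intro mult_left_mono add_mono mult_right_mono ennreal_leI) auto
    finally show "(\<integral>\<^sup>+x. ennreal (\<bar>V x\<bar> * \<bar>u x\<bar> powr p) \<partial>lebesgue)
         \<le> ennreal ((\<integral>x. \<bar>V x\<bar> powr q \<partial>lebesgue) powr (1/q)) *
           (ennreal e * gagliardo_integral s p UNIV u + ennreal K * (\<integral>\<^sup>+x. ennreal (\<bar>u x\<bar> powr p) \<partial>lebesgue))"
      by (simp add: L_def U_def)
  qed
qed

section \<open>The energy space\<close>

text \<open>
  The space of zero extensions of the elements of \<^const>\<open>sobolev_space0\<close>, as functions on the
  whole space.
\<close>

definition zero_sobolev :: "real \<Rightarrow> real \<Rightarrow> 'a::euclidean_space set \<Rightarrow> ('a \<Rightarrow> real) set" where
  "zero_sobolev s p \<Omega> = {u \<in> borel_measurable lebesgue. (\<forall>x. x \<notin> \<Omega> \<longrightarrow> u x = 0) \<and>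
     integrable lebesgue (\<lambda>x. \<bar>u x\<bar> powr p) \<and> gagliardo_integral s p UNIV u < \<infinity>}"

text \<open>
  The \<open>p\<close>-th power of the Gagliardo seminorm over the whole space; it is \<open>0\<close> by convention where
  the defining integral is infinite.
\<close>

definition energy :: "real \<Rightarrow> real \<Rightarrow> ('a::euclidean_space \<Rightarrow> real) \<Rightarrow> real" where
  "energy s p u = enn2real (gagliardo_integral s p UNIV u)"

text \<open>
  The functional whose infimum defines \<^const>\<open>eigenvalue\<close>, for a potential that has been
  extended by zero.
\<close>

definition total_energy :: "real \<Rightarrow> real \<Rightarrow> ('a::euclidean_space \<Rightarrow> real) \<Rightarrow> ('a \<Rightarrow> real) \<Rightarrow> real" where
  "total_energy s p V u = 1/2 * energy s p u + (\<integral>x. V x * \<bar>u x\<bar> powr p \<partial>lebesgue)"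

text \<open>
  The measure \<open>\<bar>x - y\<bar>\<^sup>-\<^sup>n\<^sup>-\<^sup>s\<^sup>p dx dy\<close>. With it the energy of \<open>u\<close> becomes the single integral of
  \<open>\<bar>u x - u y\<bar>\<^sup>p\<close>. On the diagonal the density is \<open>1 / 0 = 0\<close>.
\<close>

definition kernel_measure :: "real \<Rightarrow> real \<Rightarrow> ('a::euclidean_space \<times> 'a) measure" where
  "kernel_measure s p = density (lebesgue \<Otimes>\<^sub>M lebesgue)
     (\<lambda>z. ennreal (1 / norm (fst z - snd z) powr (real DIM('a) + s * p)))"

text \<open>
  The difference \<open>u x - u y\<close> as a function of the pair \<open>(x, y)\<close>.
\<close>

definition gap :: "('a \<Rightarrow> real) \<Rightarrow> 'a \<times> 'a \<Rightarrow> real" where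
  "gap u z = u (fst z) - u (snd z)"

lemma sets_kernel_measure [measurable_cong]: "sets (kernel_measure s p) = sets (lebesgue \<Otimes>\<^sub>M lebesgue)"
  by (simp add: kernel_measure_def)

lemma gap_measurable [measurable]:
  assumes u: "u \<in> borel_measurable lebesgue"
  shows "gap u \<in> borel_measurable (kernel_measure s p)"
proof -
  have "gap u \<in> borel_measurable (lebesgue \<Otimes>\<^sub>M lebesgue)"
    unfolding gap_def[abs_def]
    using measurable_compose[OF measurable_fst u] measurable_compose[OF measurable_snd u] by measurable
  then show ?thesis by (simp add: measurable_cong_sets[OF sets_kernel_measure refl])
qed

lemma gagliardo_integral_gap:
  fixes u :: "'a::euclidean_space \<Rightarrow> real"
  assumes u: "u \<in> borel_measurable lebesgue"
  shows "gagliardo_integral s p UNIV u = (\<integral>\<^sup>+z. ennreal (\<bar>gap u z\<bar> powr p) \<partial>kernel_measure s p)"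
proof -
  have [measurable]: "(\<lambda>z. ennreal (\<bar>gap u z\<bar> powr p)) \<in> borel_measurable (lebesgue \<Otimes>\<^sub>M lebesgue)"
    using gap_measurable[OF u, of s p] by (simp add: measurable_cong_sets[OF sets_kernel_measure refl])
  have k: "(\<lambda>z::'a\<times>'a. ennreal (1 / norm (fst z - snd z) powr (real DIM('a) + s * p))) \<in> borel_measurable (lebesgue \<Otimes>\<^sub>M lebesgue)"
    by measurable
  have "(\<integral>\<^sup>+z. ennreal (\<bar>gap u z\<bar> powr p) \<partial>kernel_measure s p)
     = (\<integral>\<^sup>+z. ennreal (\<bar>u (fst z) - u (snd z)\<bar> powr p / norm (fst z - snd z) powr (real DIM('a) + s * p)) \<partial>(lebesgue \<Otimes>\<^sub>M lebesgue))"
    unfolding kernel_measure_def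
    by (subst nn_integral_density[OF k], measurable)
       (auto simp: gap_def ennreal_mult[symmetric] intro!: nn_integral_cong)
  also have "\<dots> = gagliardo_integral s p UNIV u"
    using lebesgue.nn_integral_fst[OF measurable_difference_quotient[OF u]] by (simp add: gagliardo_integral_UNIV)
  finally show ?thesis by simp
qed

lemma zero_sobolev_iff:
  "u \<in> zero_sobolev s p \<Omega> \<longleftrightarrow> u \<in> borel_measurable lebesgue \<and> (\<forall>x. x \<notin> \<Omega> \<longrightarrow> u x = 0) \<and>
     integrable lebesgue (\<lambda>x. \<bar>u x\<bar> powr p) \<and> integrable (kernel_measure s p) (\<lambda>z. \<bar>gap u z\<bar> powr p)"
proof -
  have "gagliardo_integral s p UNIV u < \<infinity> \<longleftrightarrow> integrable (kernel_measure s p) (\<lambda>z. \<bar>gap u z\<bar> powr p)"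
    if [measurable]: "u \<in> borel_measurable lebesgue"
    unfolding gagliardo_integral_gap[OF that] by (subst integrable_iff_bounded) simp
  then show ?thesis by (auto simp: zero_sobolev_def)
qed

lemma zero_sobolevD:
  assumes "u \<in> zero_sobolev s p \<Omega>"
  shows "u \<in> borel_measurable lebesgue" "\<And>x. x \<notin> \<Omega> \<Longrightarrow> u x = 0" "integrable lebesgue (\<lambda>x. \<bar>u x\<bar> powr p)"
    "integrable (kernel_measure s p) (\<lambda>z. \<bar>gap u z\<bar> powr p)" "gagliardo_integral s p UNIV u < \<infinity>"
  using assms unfolding zero_sobolev_iff by (auto simp: assms[unfolded zero_sobolev_def, simplified])

lemma energy_eq:
  assumes "u \<in> borel_measurable lebesgue"
  shows "energy s p u = (\<integral>z. \<bar>gap u z\<bar> powr p \<partial>kernel_measure s p)"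
  using assms unfolding energy_def gagliardo_integral_gap[OF assms]
  by (subst integral_eq_nn_integral) auto

lemma energy_nonneg: "energy s p u \<ge> 0"
  by (simp add: energy_def)

lemma gagliardo_eq_energy:
  assumes "u \<in> zero_sobolev s p \<Omega>"
  shows "gagliardo_integral s p UNIV u = ennreal (energy s p u)"
  using zero_sobolevD(5)[OF assms] by (simp add: energy_def)

lemma zero_sobolev_lincomb:
  assumes u: "u \<in> zero_sobolev s p \<Omega>" and w: "w \<in> zero_sobolev s p \<Omega>" and p: "p > 0"
  shows "(\<lambda>x. a * u x + b * w x) \<in> zero_sobolev s p \<Omega>"
proof -
  note U = zero_sobolevD[OF u] and W = zero_sobolevD[OF w]
  have "gap (\<lambda>x. a * u x + b * w x) = (\<lambda>z. a * gap u z + b * gap w z)"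
    by (auto simp: gap_def algebra_simps)
  then show ?thesis using U W p
    by (auto simp: zero_sobolev_iff intro!: integrable_abs_powr_add)
qed

lemma energy_diff_le:
  assumes u: "u \<in> zero_sobolev s p \<Omega>" and w: "w \<in> zero_sobolev s p \<Omega>" and p: "p > 0"
  shows "energy s p (\<lambda>x. u x - w x) \<le> 2 powr p * (energy s p u + energy s p w)"
proof -
  note U = zero_sobolevD[OF u] and W = zero_sobolevD[OF w]
  note UW = zero_sobolevD[OF zero_sobolev_lincomb[OF u w p, of 1 "-1"]]
  have g: "gap (\<lambda>x. u x - w x) = (\<lambda>z. gap u z - gap w z)"
    by (auto simp: gap_def algebra_simps)
  have "energy s p (\<lambda>x. u x - w x) \<le> (\<integral>z. 2 powr p * (\<bar>gap u z\<bar> powr p + \<bar>gap w z\<bar> powr p) \<partial>kernel_measure s p)"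
    unfolding energy_eq[OF UW(1)[simplified]] g
    using U(4) W(4) UW(4) abs_diff_powr_le[of p] p
    by (intro integral_mono Bochner_Integration.integrable_add integrable_mult_right) (simp_all add: g)
  also have "\<dots> = 2 powr p * (energy s p u + energy s p w)"
    using U W by (simp add: energy_eq)
  finally show ?thesis .
qed

lemma zero_ext_zero_sobolev:
  assumes "v \<in> zero_sobolev s p \<Omega>" shows "zero_ext \<Omega> v = v"
  using zero_sobolevD(2)[OF assms] by (auto simp: zero_ext_def)

lemma zero_ext_measurable:
  assumes "\<Omega> \<in> sets lebesgue" "V \<in> borel_measurable (lebesgue_on \<Omega>)"
  shows "zero_ext \<Omega> V \<in> borel_measurable lebesgue"
  using assms unfolding zero_ext_def by (rule borel_measurable_if_I[rotated])

lemma zero_ext_integral: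
  fixes f :: "'a::euclidean_space \<Rightarrow> real \<Rightarrow> real"
  assumes "\<Omega> \<in> sets lebesgue" "\<And>x. f x 0 = 0"
  shows "(\<integral>x. f x (zero_ext \<Omega> u x) \<partial>lebesgue) = (\<integral>x. f x (u x) \<partial>lebesgue_on \<Omega>)"
    and "integrable lebesgue (\<lambda>x. f x (zero_ext \<Omega> u x)) \<longleftrightarrow> integrable (lebesgue_on \<Omega>) (\<lambda>x. f x (u x))"
proof -
  have eq: "(\<lambda>x. f x (zero_ext \<Omega> u x)) = (\<lambda>x. indicator \<Omega> x *\<^sub>R f x (u x))"
    using assms(2) by (auto simp: zero_ext_def indicator_def)
  show "(\<integral>x. f x (zero_ext \<Omega> u x) \<partial>lebesgue) = (\<integral>x. f x (u x) \<partial>lebesgue_on \<Omega>)"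
    unfolding eq using assms(1) by (subst integral_restrict_space) auto
  show "integrable lebesgue (\<lambda>x. f x (zero_ext \<Omega> u x)) \<longleftrightarrow> integrable (lebesgue_on \<Omega>) (\<lambda>x. f x (u x))"
    unfolding eq using assms(1) by (subst integrable_restrict_space) auto
qed

lemma zero_sobolev_in_sobolev_space0:
  fixes v :: "'a::euclidean_space \<Rightarrow> real"
  assumes v: "v \<in> zero_sobolev s p \<Omega>" and \<Omega>: "\<Omega> \<in> sets lebesgue"
  shows "v \<in> sobolev_space0 s p \<Omega>"
proof -
  note D = zero_sobolevD[OF v]
  have "gagliardo_integral s p \<Omega> v \<le> gagliardo_integral s p UNIV v"
    unfolding gagliardo_integral_UNIV unfolding gagliardo_integral_def using \<Omega>
    by (auto simp: nn_integral_restrict_space intro!: nn_integral_mono simp: indicator_def)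
  then have "gagliardo_integral s p \<Omega> v < \<infinity>" using D(5) by (rule order_le_less_trans)
  moreover have "integrable (lebesgue_on \<Omega>) (\<lambda>x. \<bar>v x\<bar> powr p)"
    using zero_ext_integral(2)[OF \<Omega>, of "\<lambda>x t. \<bar>t\<bar> powr p" v] D(3) by (simp add: zero_ext_zero_sobolev[OF v])
  moreover have "v \<in> borel_measurable (lebesgue_on \<Omega>)" using D(1) by (rule measurable_restrict_space1)
  ultimately show ?thesis using D
    by (auto simp: sobolev_space0_def sobolev_space_def Lp_space_def lebesgue_on_UNIV_eq zero_ext_zero_sobolev[OF v])
qed

lemma sobolev_space0_zero_ext:
  fixes u :: "'a::euclidean_space \<Rightarrow> real"
  assumes "u \<in> sobolev_space0 s p \<Omega>"
  shows "zero_ext \<Omega> u \<in> zero_sobolev s p \<Omega>"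
  using assms by (auto simp: sobolev_space0_def sobolev_space_def Lp_space_def lebesgue_on_UNIV_eq zero_sobolev_def)
    (simp add: zero_ext_def)

text \<open>
  The eigenvalue as an infimum over functions on the whole space, with the extensions by zero
  carried out once and for all.
\<close>

lemma eigenvalue_eq:
  fixes \<Omega> :: "'a::euclidean_space set"
  assumes \<Omega>: "\<Omega> \<in> sets lebesgue" and p: "p > 0"
  shows "eigenvalue s p \<Omega> V =
    (INF v\<in>{v \<in> zero_sobolev s p \<Omega>. (\<integral>x. \<bar>v x\<bar> powr p \<partial>lebesgue) = 1}. ereal (total_energy s p (zero_ext \<Omega> V) v))"
proof -
  define F where "F = (\<lambda>u. ereal (1 / 2 * gagliardo_seminorm s p UNIV (zero_ext \<Omega> u) powr p
               + (LINT x|lebesgue_on \<Omega>. V x * \<bar>u x\<bar> powr p)))"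
  define G where "G = (\<lambda>v. ereal (total_energy s p (zero_ext \<Omega> V) v))"
  have norm: "Lp_norm p UNIV v = 1 \<longleftrightarrow> (\<integral>x. \<bar>v x\<bar> powr p \<partial>lebesgue) = 1" for v :: "'a \<Rightarrow> real"
  proof -
    have "t powr (1/p) = 1 \<longleftrightarrow> t = 1" if "t \<ge> 0" for t :: real
      using that p powr_powr[of t "1/p" p] by (cases "t = 0") auto
    then show ?thesis by (simp add: Lp_norm_def lebesgue_on_UNIV_eq)
  qed
  have FG: "F u = G (zero_ext \<Omega> u)" for u
  proof -
    have "(LINT x|lebesgue_on \<Omega>. V x * \<bar>u x\<bar> powr p) = (\<integral>x. V x * \<bar>zero_ext \<Omega> u x\<bar> powr p \<partial>lebesgue)"
      using zero_ext_integral(1)[OF \<Omega>, of "\<lambda>x t. V x * \<bar>t\<bar> powr p" u] by simp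
    also have "\<dots> = (\<integral>x. zero_ext \<Omega> V x * \<bar>zero_ext \<Omega> u x\<bar> powr p \<partial>lebesgue)"
      by (intro Bochner_Integration.integral_cong) (auto simp: zero_ext_def)
    finally show ?thesis using p
      by (simp add: F_def G_def total_energy_def energy_def gagliardo_seminorm_def powr_powr)
  qed
  have "F ` {u \<in> sobolev_space0 s p \<Omega>. Lp_norm p UNIV (zero_ext \<Omega> u) = 1}
      = G ` {v \<in> zero_sobolev s p \<Omega>. (\<integral>x. \<bar>v x\<bar> powr p \<partial>lebesgue) = 1}" (is "F ` ?A = G ` ?B")
  proof (intro equalityI subsetI)
    fix t assume "t \<in> F ` ?A"
    then show "t \<in> G ` ?B" using sobolev_space0_zero_ext norm by (force simp: FG)
  next
    fix t assume "t \<in> G ` ?B"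
    then obtain v where v: "t = G v" "v \<in> zero_sobolev s p \<Omega>" "(\<integral>x. \<bar>v x\<bar> powr p \<partial>lebesgue) = 1" by auto
    then have "v \<in> ?A" "t = F v"
      using zero_sobolev_in_sobolev_space0[OF v(2) \<Omega>] by (auto simp: FG norm zero_ext_zero_sobolev)
    then show "t \<in> F ` ?A" by blast
  qed
  then show ?thesis unfolding eigenvalue_def F_def[symmetric] G_def[symmetric] by (rule arg_cong)
qed

text \<open>
  The elements of \<open>L\<^sup>q(\<Omega>)\<close>, extended by zero.
\<close>

definition potentials :: "real \<Rightarrow> 'a::euclidean_space set \<Rightarrow> ('a \<Rightarrow> real) set" where
  "potentials q \<Omega> = {V \<in> borel_measurable lebesgue. (\<forall>x. x \<notin> \<Omega> \<longrightarrow> V x = 0) \<and>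
     integrable lebesgue (\<lambda>x. \<bar>V x\<bar> powr q)}"

lemma form_bound_real:
  fixes \<Omega> :: "'a::euclidean_space set"
  assumes s: "s > 0" and p: "p > 1" and q: "q > 1" and sub: "real DIM('a) / (s * p) < q"
    and \<Omega>: "bounded \<Omega>" and e: "e > 0"
  obtains K where "K > 0" "\<forall>u\<in>zero_sobolev s p \<Omega>. \<forall>V\<in>potentials q \<Omega>.
       integrable lebesgue (\<lambda>x. V x * \<bar>u x\<bar> powr p) \<and>
       (\<integral>x. \<bar>V x\<bar> * \<bar>u x\<bar> powr p \<partial>lebesgue)
         \<le> (\<integral>x. \<bar>V x\<bar> powr q \<partial>lebesgue) powr (1/q) * (e * energy s p u + K * (\<integral>x. \<bar>u x\<bar> powr p \<partial>lebesgue))"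
proof -
  obtain K where K: "K > 0" and *:
    "\<And>(u :: 'a \<Rightarrow> real) V. u \<in> borel_measurable lebesgue \<Longrightarrow>
       (\<integral>\<^sup>+x. ennreal (\<bar>u x\<bar> powr p) \<partial>lebesgue) < \<infinity> \<Longrightarrow> gagliardo_integral s p UNIV u < \<infinity> \<Longrightarrow>
       V \<in> borel_measurable lebesgue \<Longrightarrow> integrable lebesgue (\<lambda>x. \<bar>V x\<bar> powr q) \<Longrightarrow> (\<And>x. x \<notin> \<Omega> \<Longrightarrow> V x = 0) \<Longrightarrow>
       (\<integral>\<^sup>+x. ennreal (\<bar>V x\<bar> * \<bar>u x\<bar> powr p) \<partial>lebesgue)
         \<le> ennreal ((\<integral>x. \<bar>V x\<bar> powr q \<partial>lebesgue) powr (1/q)) *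
           (ennreal e * gagliardo_integral s p UNIV u + ennreal K * (\<integral>\<^sup>+x. ennreal (\<bar>u x\<bar> powr p) \<partial>lebesgue))"
    using form_bound[OF s p q sub \<Omega> e] by blast
  show ?thesis
  proof (rule that[OF K], intro ballI)
    fix u V :: "'a \<Rightarrow> real"
    assume u: "u \<in> zero_sobolev s p \<Omega>" and "V \<in> potentials q \<Omega>"
    then have V[measurable]: "V \<in> borel_measurable lebesgue"
      "integrable lebesgue (\<lambda>x. \<bar>V x\<bar> powr q)" and V0: "\<And>x. x \<notin> \<Omega> \<Longrightarrow> V x = 0"
      by (auto simp: potentials_def)
    note D = zero_sobolevD[OF u]
    note [measurable] = D(1)
    define R where "R = (\<integral>x. \<bar>V x\<bar> powr q \<partial>lebesgue) powr (1/q) * (e * energy s p u + K * (\<integral>x. \<bar>u x\<bar> powr p \<partial>lebesgue))"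
    have R: "R \<ge> 0" using e K by (simp add: R_def energy_nonneg)
    have up: "(\<integral>\<^sup>+x. ennreal (\<bar>u x\<bar> powr p) \<partial>lebesgue) = ennreal (\<integral>x. \<bar>u x\<bar> powr p \<partial>lebesgue)"
      using D(3) by (rule nn_integral_abs_powr_eq)
    have "(\<integral>\<^sup>+x. ennreal (\<bar>V x\<bar> * \<bar>u x\<bar> powr p) \<partial>lebesgue) \<le> ennreal R"
      using *[OF D(1) _ D(5) V V0] e K energy_nonneg[of s p u] up unfolding gagliardo_eq_energy[OF u]
      by (simp add: R_def ennreal_mult ennreal_plus)
    moreover have ab: "\<bar>V x\<bar> * \<bar>u x\<bar> powr p = norm (V x * \<bar>u x\<bar> powr p)" for x by (simp add: abs_mult)
    ultimately have bd: "(\<integral>\<^sup>+x. ennreal (norm (V x * \<bar>u x\<bar> powr p)) \<partial>lebesgue) \<le> ennreal R" by simp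
    then have int: "integrable lebesgue (\<lambda>x. V x * \<bar>u x\<bar> powr p)"
      by (intro integrableI_bounded) (auto intro: order_le_less_trans)
    have "ennreal (\<integral>x. norm (V x * \<bar>u x\<bar> powr p) \<partial>lebesgue) \<le> ennreal R"
      using bd nn_integral_eq_integral[OF integrable_norm[OF int]] by simp
    then show "integrable lebesgue (\<lambda>x. V x * \<bar>u x\<bar> powr p) \<and> (\<integral>x. \<bar>V x\<bar> * \<bar>u x\<bar> powr p \<partial>lebesgue)
         \<le> (\<integral>x. \<bar>V x\<bar> powr q \<partial>lebesgue) powr (1/q) * (e * energy s p u + K * (\<integral>x. \<bar>u x\<bar> powr p \<partial>lebesgue))"
      using int R unfolding ab R_def[symmetric] by simp
  qed
qed

section \<open>Compactness of the energy space\<close>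

lemma AE_lebesgue_pair:
  assumes "AE x in (lebesgue :: 'a::euclidean_space measure). P x"
  shows "AE z in (lebesgue \<Otimes>\<^sub>M lebesgue :: ('a \<times> 'a) measure). P (fst z) \<and> P (snd z)"
proof -
  obtain N where N: "N \<in> null_sets (lebesgue :: 'a measure)" "{x. \<not> P x} \<subseteq> N"
    using assms by (auto simp: eventually_ae_filter)
  have "N \<times> UNIV \<in> null_sets (lebesgue \<Otimes>\<^sub>M lebesgue :: ('a \<times> 'a) measure)"
    "UNIV \<times> N \<in> null_sets (lebesgue \<Otimes>\<^sub>M lebesgue :: ('a \<times> 'a) measure)"
    using N(1) by (auto simp: null_sets_def lebesgue.emeasure_pair_measure_Times)
  then have "N \<times> UNIV \<union> UNIV \<times> N \<in> null_sets (lebesgue \<Otimes>\<^sub>M lebesgue :: ('a \<times> 'a) measure)" by (rule null_sets.Un)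
  then show ?thesis by (rule AE_I') (use N(2) in auto)
qed

lemma AE_kernel_measure:
  fixes P :: "'a::euclidean_space \<times> 'a \<Rightarrow> bool"
  assumes "AE z in lebesgue \<Otimes>\<^sub>M lebesgue. P z"
  shows "AE z in kernel_measure s p. P z"
proof -
  have "(\<lambda>z::'a\<times>'a. ennreal (1 / norm (fst z - snd z) powr (real DIM('a) + s * p))) \<in> borel_measurable (lebesgue \<Otimes>\<^sub>M lebesgue)"
    by measurable
  then show ?thesis unfolding kernel_measure_def using assms by (auto simp: AE_density)
qed

lemma gagliardo_lower_semicontinuous:
  fixes u :: "'a::euclidean_space \<Rightarrow> real"
  assumes p: "p > 0" and w: "\<And>i. w i \<in> borel_measurable lebesgue" and u: "u \<in> borel_measurable lebesgue"
    and lim: "AE x in lebesgue. (\<lambda>i. w i x) \<longlonglongrightarrow> u x"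
  shows "gagliardo_integral s p UNIV u \<le> liminf (\<lambda>i. gagliardo_integral s p UNIV (w i))"
proof -
  have "(\<integral>\<^sup>+z. ennreal (\<bar>gap u z\<bar> powr p) \<partial>kernel_measure s p)
      = (\<integral>\<^sup>+z. liminf (\<lambda>i. ennreal (\<bar>gap (w i) z\<bar> powr p)) \<partial>kernel_measure s p)"
  proof (rule nn_integral_cong_AE, use AE_kernel_measure[OF AE_lebesgue_pair[OF lim]] in eventually_elim)
    case (elim z)
    then have "(\<lambda>i. gap (w i) z) \<longlonglongrightarrow> gap u z" unfolding gap_def by (intro tendsto_intros) auto
    then have "(\<lambda>i. ennreal (\<bar>gap (w i) z\<bar> powr p)) \<longlonglongrightarrow> ennreal (\<bar>gap u z\<bar> powr p)"
      using p by (intro tendsto_ennrealI tendsto_powr' tendsto_intros) auto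
    then show ?case using lim_imp_Liminf[of sequentially] by (metis trivial_limit_sequentially)
  qed
  also have "\<dots> \<le> liminf (\<lambda>i. \<integral>\<^sup>+z. ennreal (\<bar>gap (w i) z\<bar> powr p) \<partial>kernel_measure s p)"
    using w by (intro nn_integral_liminf) auto
  finally show ?thesis by (simp add: gagliardo_integral_gap u w)
qed

lemma cube_avg_abs_le:
  fixes u :: "'a::euclidean_space \<Rightarrow> real"
  assumes p: "p > 1" and u: "u \<in> borel_measurable lebesgue"
    and le: "(\<integral>\<^sup>+x. ennreal (\<bar>u x\<bar> powr p) \<partial>lebesgue) \<le> 1"
  shows "\<bar>cube_avg k u x\<bar> \<le> (2 ^ k) ^ DIM('a)"
proof -
  define N :: real where "N = (2 ^ k) ^ DIM('a)"
  have N: "N \<ge> 1" by (simp add: N_def one_le_power)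
  have "ennreal (\<bar>cube_avg k u x\<bar> powr p) \<le> ennreal N * (\<integral>\<^sup>+y. ennreal (\<bar>u y\<bar> powr p) * indicator (dyadic_cube k x) y \<partial>lebesgue)"
    unfolding N_def by (rule cube_avg_Jensen[OF u p])
  also have "\<dots> \<le> ennreal N * (\<integral>\<^sup>+x. ennreal (\<bar>u x\<bar> powr p) \<partial>lebesgue)"
    by (intro mult_left_mono nn_integral_mono) (auto simp: indicator_def)
  also have "\<dots> \<le> ennreal N * 1" using le by (intro mult_left_mono) auto
  finally have *: "\<bar>cube_avg k u x\<bar> powr p \<le> N" using N by simp
  show ?thesis
  proof (rule ccontr)
    assume "\<not> ?thesis"
    then have a: "\<bar>cube_avg k u x\<bar> > N" by (simp add: N_def)
    have "N powr 1 \<le> N powr p" using N p by (intro powr_mono) auto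
    also have "\<dots> < \<bar>cube_avg k u x\<bar> powr p" using a N p by (intro powr_less_mono2) auto
    finally show False using * N by simp
  qed
qed

text \<open>
  All means converge along one subsequence, since every cube contains a point of a fixed
  countable dense set and the mean only depends on the cube.
\<close>

lemma cube_avg_convergent_subsequence:
  fixes w :: "nat \<Rightarrow> 'a::euclidean_space \<Rightarrow> real"
  assumes bd: "\<And>i k x. \<bar>cube_avg k (w i) x\<bar> \<le> (2 ^ k) ^ DIM('a)"
  obtains r where "strict_mono (r :: nat \<Rightarrow> nat)" "\<And>k x. convergent (\<lambda>i. cube_avg k (w (r i)) x)"
proof -
  obtain D :: "'a set" where D: "countable D" "\<And>X. open X \<Longrightarrow> X \<noteq> {} \<Longrightarrow> \<exists>d\<in>D. d \<in> X"
    using countable_dense_exists by metis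
  define f where "f = (\<lambda>i kd. cube_avg (fst kd) (w i) (snd kd) / (2 ^ fst kd) ^ DIM('a))"
  have "norm (f i kd) \<le> 1" for i kd
    using bd[of "fst kd" i "snd kd"] by (simp add: f_def)
  then obtain r where r: "strict_mono (r :: nat \<Rightarrow> nat)"
      "\<And>kd. kd \<in> UNIV \<times> D \<Longrightarrow> \<exists>l. (\<lambda>i. f (r i) kd) \<longlonglongrightarrow> l"
    using function_convergent_subsequence[of "UNIV \<times> D" f 1] D(1) by (metis countable_SIGMA countableI_type)
  have "convergent (\<lambda>i. cube_avg k (w (r i)) x)" for k x
  proof -
    obtain d where d: "d \<in> D" "x \<in> dyadic_cube k d" using dyadic_cube_meets_dense[OF D(2)] by blast
    obtain l where "(\<lambda>i. f (r i) (k, d)) \<longlonglongrightarrow> l" using r(2)[of "(k, d)"] d(1) by auto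
    then have "(\<lambda>i. (2 ^ k) ^ DIM('a) * f (r i) (k, d)) \<longlonglongrightarrow> (2 ^ k) ^ DIM('a) * l" by (intro tendsto_intros)
    then show ?thesis using cube_avg_cong_cube[OF d(2)] by (auto simp: f_def convergent_def)
  qed
  with r(1) show ?thesis using that by blast
qed

text \<open>
  Fix a generation \<open>k\<close> for which \<open>w\<^sub>i\<close> is uniformly close to its averages; the averages converge
  boundedly on \<open>\<Omega>\<close>, hence in \<open>L\<^sup>p(\<Omega>)\<close>.
\<close>

lemma cube_avg_Cauchy_imp_Cauchy:
  fixes w :: "nat \<Rightarrow> 'a::euclidean_space \<Rightarrow> real"
  assumes s: "s > 0" and p: "p > 1" and \<Omega>: "\<Omega> \<in> lmeasurable"
    and w: "\<And>i. w i \<in> zero_sobolev s p \<Omega>" and w1: "\<And>i. (\<integral>\<^sup>+x. ennreal (\<bar>w i x\<bar> powr p) \<partial>lebesgue) \<le> 1"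
    and M: "\<And>i. energy s p (w i) \<le> M"
    and conv: "\<And>k x. convergent (\<lambda>i. cube_avg k (w i) x)" and e: "e > 0"
  shows "\<exists>N. \<forall>i\<ge>N. \<forall>j\<ge>N. (\<integral>\<^sup>+x. ennreal (\<bar>w i x - w j x\<bar> powr p) \<partial>lebesgue) \<le> ennreal e"
proof -
  note [measurable] = zero_sobolevD(1)[OF w]
  have \<Omega>s[measurable]: "\<Omega> \<in> sets lebesgue" using \<Omega> by (rule fmeasurableD)
  have M0: "M \<ge> 0" using M[of 0] energy_nonneg[of s p "w 0"] by linarith
  define c where "c = real DIM('a) powr (real DIM('a) + s * p)"
  define t where "t = 2 powr (- (s * p))"
  have t: "0 < t" "t < 1" using s p by (auto simp: t_def powr_less_one)
  have c: "c \<ge> 0" by (simp add: c_def)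
  \<comment> \<open>two applications of \<open>abs_add_powr_le\<close> split \<open>w i - w j\<close> into four terms\<close>
  define b where "b = 4 * 2 powr p * 2 powr p"
  have b: "b > 0" by (simp add: b_def)
  have "(\<lambda>k. c * t ^ k * M) \<longlonglongrightarrow> c * 0 * M" using t by (intro tendsto_intros LIMSEQ_power_zero) auto
  then have "\<forall>\<^sub>F k in sequentially. c * t ^ k * M < e / b" using e b by (intro order_tendstoD) auto
  then obtain k where k: "c * t ^ k * M < e / b" by (auto dest: eventually_happens)
  have app: "(\<integral>\<^sup>+x. ennreal (\<bar>w i x - cube_avg k (w i) x\<bar> powr p) \<partial>lebesgue) \<le> ennreal (e / b)" for i
  proof -
    have "(\<integral>\<^sup>+x. ennreal (\<bar>w i x - cube_avg k (w i) x\<bar> powr p) \<partial>lebesgue)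
       \<le> ennreal (c * 2 powr (- (s * p) * k)) * ennreal (energy s p (w i))"
      using cube_avg_approx[OF p s zero_sobolevD(1)[OF w], of i k] w1[of i]
      unfolding gagliardo_eq_energy[OF w] c_def by (auto simp: order_le_less_trans)
    also have "\<dots> = ennreal (c * t ^ k * energy s p (w i))"
      using c energy_nonneg[of s p "w i"] by (simp add: t_def powr_realpow[symmetric] powr_powr ennreal_mult)
    also have "\<dots> \<le> ennreal (e / b)" using k M[of i] c t mult_left_mono[OF M[of i], of "c * t ^ k"]
      by (intro ennreal_leI) auto
    finally show ?thesis .
  qed
  define h where "h x = lim (\<lambda>i. cube_avg k (w i) x)" for x
  have h: "(\<lambda>i. cube_avg k (w i) x) \<longlonglongrightarrow> h x" for x
    using conv[of k x] by (simp add: h_def convergent_LIMSEQ_iff)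
  have [measurable]: "h \<in> borel_measurable lebesgue" unfolding h_def by measurable
  define N :: real where "N = (2 ^ k) ^ DIM('a)"
  have avgN: "\<bar>cube_avg k (w i) x\<bar> \<le> N" for i x
    unfolding N_def by (rule cube_avg_abs_le[OF p zero_sobolevD(1)[OF w] w1])
  have hN: "\<bar>h x\<bar> \<le> N" for x
    using LIMSEQ_le_const2[OF tendsto_rabs[OF h[of x]]] avgN by blast
  have "(\<lambda>i. \<integral>\<^sup>+x. ennreal (\<bar>cube_avg k (w i) x - h x\<bar> powr p) * indicator \<Omega> x \<partial>lebesgue) \<longlonglongrightarrow> (\<integral>\<^sup>+x. 0 \<partial>(lebesgue :: 'a measure))"
  proof (rule nn_integral_dominated_convergence[where w="\<lambda>x. ennreal ((2 * N) powr p) * indicator \<Omega> x"])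
    show "AE x in lebesgue. ennreal (\<bar>cube_avg k (w i) x - h x\<bar> powr p) * indicator \<Omega> x \<le> ennreal ((2 * N) powr p) * indicator \<Omega> x" for i
    proof (intro AE_I2 mult_right_mono ennreal_leI powr_mono2)
      fix x show "\<bar>cube_avg k (w i) x - h x\<bar> \<le> 2 * N" using avgN[of i x] hN[of x] by linarith
    qed (use p in auto)
    have "emeasure lebesgue \<Omega> < \<infinity>" using \<Omega> by (simp add: fmeasurable_def)
    then show "(\<integral>\<^sup>+x. ennreal ((2 * N) powr p) * indicator \<Omega> x \<partial>lebesgue) < \<infinity>"
      by (simp add: nn_integral_cmult_indicator ennreal_mult_less_top)
    show "AE x in lebesgue. (\<lambda>i. ennreal (\<bar>cube_avg k (w i) x - h x\<bar> powr p) * indicator \<Omega> x) \<longlonglongrightarrow> 0"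
    proof (intro AE_I2)
      fix x
      have *: "(\<lambda>i. cube_avg k (w i) x - h x) \<longlonglongrightarrow> h x - h x" by (intro tendsto_intros h)
      have "(\<lambda>i. \<bar>cube_avg k (w i) x - h x\<bar> powr p) \<longlonglongrightarrow> \<bar>h x - h x\<bar> powr p"
        using p tendsto_powr'[OF tendsto_rabs[OF *] tendsto_const[of p]] by simp
      then have "(\<lambda>i. ennreal (\<bar>cube_avg k (w i) x - h x\<bar> powr p)) \<longlonglongrightarrow> 0"
        using tendsto_ennrealI by fastforce
      then show "(\<lambda>i. ennreal (\<bar>cube_avg k (w i) x - h x\<bar> powr p) * indicator \<Omega> x) \<longlonglongrightarrow> 0"
        by (cases "x \<in> \<Omega>") auto
    qed
  qed measurable
  then have "\<forall>\<^sub>F i in sequentially. (\<integral>\<^sup>+x. ennreal (\<bar>cube_avg k (w i) x - h x\<bar> powr p) * indicator \<Omega> x \<partial>lebesgue) < ennreal (e / b)"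
    using e b by (intro order_tendstoD) auto
  then obtain I where I: "\<And>i. i \<ge> I \<Longrightarrow> (\<integral>\<^sup>+x. ennreal (\<bar>cube_avg k (w i) x - h x\<bar> powr p) * indicator \<Omega> x \<partial>lebesgue) \<le> ennreal (e / b)"
    by (auto simp: eventually_sequentially intro: less_imp_le)
  have close: "(\<integral>\<^sup>+x. ennreal (\<bar>w i x - w j x\<bar> powr p) \<partial>lebesgue) \<le> ennreal e" if "i \<ge> I" "j \<ge> I" for i j
  proof -
    let ?a = "\<lambda>i x. ennreal (\<bar>w i x - cube_avg k (w i) x\<bar> powr p)"
    let ?b = "\<lambda>i x. ennreal (\<bar>cube_avg k (w i) x - h x\<bar> powr p) * indicator \<Omega> x"
    have "(\<integral>\<^sup>+x. ennreal (\<bar>w i x - w j x\<bar> powr p) \<partial>lebesgue)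
       \<le> (\<integral>\<^sup>+x. ennreal (2 powr p * 2 powr p) * ((?a i x + ?b i x) + (?a j x + ?b j x)) \<partial>lebesgue)"
    proof (rule nn_integral_mono)
      fix x
      show "ennreal (\<bar>w i x - w j x\<bar> powr p) \<le> ennreal (2 powr p * 2 powr p) * ((?a i x + ?b i x) + (?a j x + ?b j x))"
      proof (cases "x \<in> \<Omega>")
        case False
        then show ?thesis using zero_sobolevD(2)[OF w] by simp
      next
        case True
        have 1: "\<bar>w i x - h x\<bar> powr p \<le> 2 powr p * (\<bar>w i x - cube_avg k (w i) x\<bar> powr p + \<bar>cube_avg k (w i) x - h x\<bar> powr p)" for i
          using abs_add_powr_le[of p "w i x - cube_avg k (w i) x" "cube_avg k (w i) x - h x"] p by simp
        have "\<bar>w i x - w j x\<bar> powr p \<le> 2 powr p * (\<bar>w i x - h x\<bar> powr p + \<bar>w j x - h x\<bar> powr p)"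
          using abs_diff_powr_le[of p "w i x - h x" "w j x - h x"] p by simp
        also have "\<dots> \<le> 2 powr p * (2 powr p * (\<bar>w i x - cube_avg k (w i) x\<bar> powr p + \<bar>cube_avg k (w i) x - h x\<bar> powr p)
           + 2 powr p * (\<bar>w j x - cube_avg k (w j) x\<bar> powr p + \<bar>cube_avg k (w j) x - h x\<bar> powr p))"
          by (intro mult_left_mono add_mono 1) auto
        also have "\<dots> = 2 powr p * 2 powr p * ((\<bar>w i x - cube_avg k (w i) x\<bar> powr p + \<bar>cube_avg k (w i) x - h x\<bar> powr p)
           + (\<bar>w j x - cube_avg k (w j) x\<bar> powr p + \<bar>cube_avg k (w j) x - h x\<bar> powr p))" by (simp add: algebra_simps)
        finally show ?thesis using True
          by (simp add: ennreal_mult[symmetric] ennreal_plus[symmetric] ennreal_leI del: ennreal_plus)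
      qed
    qed
    also have "\<dots> = ennreal (2 powr p * 2 powr p) * (((\<integral>\<^sup>+x. ?a i x \<partial>lebesgue) + (\<integral>\<^sup>+x. ?b i x \<partial>lebesgue))
        + ((\<integral>\<^sup>+x. ?a j x \<partial>lebesgue) + (\<integral>\<^sup>+x. ?b j x \<partial>lebesgue)))"
      by (simp add: nn_integral_cmult nn_integral_add)
    also have "\<dots> \<le> ennreal (2 powr p * 2 powr p) * ((ennreal (e/b) + ennreal (e/b)) + (ennreal (e/b) + ennreal (e/b)))"
      using app I that by (intro mult_left_mono add_mono) auto
    also have "\<dots> = ennreal (2 powr p * 2 powr p * ((e/b + e/b) + (e/b + e/b)))"
      using e b by (simp add: ennreal_mult[symmetric] ennreal_plus[symmetric] del: ennreal_plus)
    also have "2 powr p * 2 powr p * ((e/b + e/b) + (e/b + e/b)) = e" by (simp add: b_def field_simps)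
    finally show ?thesis .
  qed
  then show ?thesis by blast
qed

proposition zero_sobolev_compact:
  fixes u :: "nat \<Rightarrow> 'a::euclidean_space \<Rightarrow> real"
  assumes s: "s > 0" and p: "p > 1" and \<Omega>: "\<Omega> \<in> lmeasurable"
    and u: "\<And>i. u i \<in> zero_sobolev s p \<Omega>" and u1: "\<And>i. (\<integral>x. \<bar>u i x\<bar> powr p \<partial>lebesgue) \<le> 1"
    and M: "\<And>i. energy s p (u i) \<le> M"
  obtains v r where "v \<in> zero_sobolev s p \<Omega>" "strict_mono (r :: nat \<Rightarrow> nat)"
    "(\<lambda>i. \<integral>x. \<bar>u (r i) x - v x\<bar> powr p \<partial>lebesgue) \<longlonglongrightarrow> 0"
    "\<forall>e>0. \<forall>\<^sub>F i in sequentially. energy s p v \<le> energy s p (u (r i)) + e"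
proof -
  note um[measurable] = zero_sobolevD(1)[OF u]
  have \<Omega>s[measurable]: "\<Omega> \<in> sets lebesgue" using \<Omega> by (rule fmeasurableD)
  have u1': "(\<integral>\<^sup>+x. ennreal (\<bar>u i x\<bar> powr p) \<partial>lebesgue) \<le> 1" for i
    using nn_integral_abs_powr_eq[OF zero_sobolevD(3)[OF u], of i] u1[of i] by (metis ennreal_1 ennreal_leI)
  have "energy s p (u i) \<in> {0..M}" for i using M energy_nonneg by auto
  then obtain l r1 where r1: "strict_mono (r1 :: nat \<Rightarrow> nat)" "((\<lambda>i. energy s p (u i)) \<circ> r1) \<longlonglongrightarrow> l"
    using seq_compactE[OF compact_imp_seq_compact[OF compact_Icc[of 0 M]], of "\<lambda>i. energy s p (u i)"] by metis
  obtain r2 where r2: "strict_mono (r2 :: nat \<Rightarrow> nat)" "\<And>k x. convergent (\<lambda>i. cube_avg k (u (r1 (r2 i))) x)"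
    using cube_avg_convergent_subsequence[of "\<lambda>i. u (r1 i)"] cube_avg_abs_le[OF p um u1'] by blast
  define w where "w i = u (r1 (r2 i))" for i
  have wm[measurable]: "w i \<in> borel_measurable lebesgue" for i by (simp add: w_def)
  have Cauchy: "\<exists>N. \<forall>i\<ge>N. \<forall>j\<ge>N. (\<integral>\<^sup>+x. ennreal (\<bar>w i x - w j x\<bar> powr p) \<partial>lebesgue) \<le> ennreal e" if "e > 0" for e
    by (rule cube_avg_Cauchy_imp_Cauchy[OF s p \<Omega> _ _ _ _ that]) (use u u1' M r2(2) in \<open>auto simp: w_def\<close>)
  obtain g n where gm[measurable]: "g \<in> borel_measurable lebesgue" and n: "strict_mono (n :: nat \<Rightarrow> nat)"
    and ae: "AE x in lebesgue. (\<lambda>k. w (n k) x) \<longlonglongrightarrow> g x"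
    and lim: "(\<lambda>i. \<integral>\<^sup>+x. ennreal (\<bar>w i x - g x\<bar> powr p) \<partial>lebesgue) \<longlonglongrightarrow> 0"
    using powr_Cauchy_imp_convergent[of p w lebesgue, OF _ wm Cauchy] p by auto
  define v where "v x = (if x \<in> \<Omega> then g x else 0)" for x
  have vm[measurable]: "v \<in> borel_measurable lebesgue" unfolding v_def by measurable
  have w0: "w i x = 0" if "x \<notin> \<Omega>" for i x using zero_sobolevD(2)[OF u that] by (simp add: w_def)
  have ae': "AE x in lebesgue. (\<lambda>k. w (n k) x) \<longlonglongrightarrow> v x"
    using ae by eventually_elim (auto simp: v_def w0)
  have lim': "(\<lambda>i. \<integral>\<^sup>+x. ennreal (\<bar>w i x - v x\<bar> powr p) \<partial>lebesgue) \<longlonglongrightarrow> 0"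
    by (rule tendsto_sandwich[OF _ _ tendsto_const lim])
       (auto simp: v_def w0 intro!: nn_integral_mono always_eventually)
  have El: "(\<lambda>k. energy s p (w (n k))) \<longlonglongrightarrow> l"
    using LIMSEQ_subseq_LIMSEQ[OF LIMSEQ_subseq_LIMSEQ[OF r1(2) r2(1)] n] by (simp add: w_def comp_def)
  have l0: "l \<ge> 0" using El energy_nonneg by (intro LIMSEQ_le_const) auto
  have gv: "gagliardo_integral s p UNIV v \<le> ennreal l"
  proof -
    have "gagliardo_integral s p UNIV v \<le> liminf (\<lambda>k. gagliardo_integral s p UNIV (w (n k)))"
      by (rule gagliardo_lower_semicontinuous[OF _ wm vm ae']) (use p in simp)
    also have "\<dots> = liminf (\<lambda>k. ennreal (energy s p (w (n k))))"
      using gagliardo_eq_energy[OF u] by (simp add: w_def)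
    also have "\<dots> = ennreal l"
      by (intro lim_imp_Liminf tendsto_ennrealI El) simp
    finally show ?thesis .
  qed
  have wi: "integrable lebesgue (\<lambda>x. \<bar>w i x\<bar> powr p)" for i using zero_sobolevD(3)[OF u] by (simp add: w_def)
  have "\<forall>\<^sub>F i in sequentially. (\<integral>\<^sup>+x. ennreal (\<bar>w i x - v x\<bar> powr p) \<partial>lebesgue) < 1"
    using lim' by (intro order_tendstoD) auto
  then obtain i0 where i0: "\<And>i. i \<ge> i0 \<Longrightarrow> (\<integral>\<^sup>+x. ennreal (\<bar>w i x - v x\<bar> powr p) \<partial>lebesgue) < 1"
    by (auto simp: eventually_sequentially)
  have di: "integrable lebesgue (\<lambda>x. \<bar>w i x - v x\<bar> powr p)" if "i \<ge> i0" for i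
    using i0[OF that] by (intro integrableI_nonneg) (auto intro: less_trans)
  have vi: "integrable lebesgue (\<lambda>x. \<bar>v x\<bar> powr p)"
    using integrable_abs_powr_add[OF wm _ _ wi di[OF order_refl], of 1 i0 "-1"] p by simp
  have v: "v \<in> zero_sobolev s p \<Omega>"
    using vm vi gv by (auto simp: zero_sobolev_def v_def intro: order_le_less_trans)
  have Ev: "energy s p v \<le> l" using gv l0 unfolding gagliardo_eq_energy[OF v] by simp
  have vint: "integrable lebesgue (\<lambda>x. \<bar>w i x - v x\<bar> powr p)" for i
    using integrable_abs_powr_add[OF wm vm _ wi vi, of 1 i "-1"] p by simp
  have limr: "(\<lambda>i. \<integral>x. \<bar>w i x - v x\<bar> powr p \<partial>lebesgue) \<longlonglongrightarrow> 0"
  proof -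
    have "(\<lambda>i. ennreal (\<integral>x. \<bar>w i x - v x\<bar> powr p \<partial>lebesgue)) \<longlonglongrightarrow> ennreal 0"
      using lim' nn_integral_abs_powr_eq[OF vint] by simp
    then show ?thesis by (subst (asm) tendsto_ennreal_iff) auto
  qed
  show ?thesis
  proof (rule that[OF v, of "\<lambda>i. r1 (r2 (n i))"])
    show "strict_mono (\<lambda>i. r1 (r2 (n i)))"
      using r1(1) r2(1) n by (simp add: strict_mono_def)
    show "(\<lambda>i. \<integral>x. \<bar>u (r1 (r2 (n i))) x - v x\<bar> powr p \<partial>lebesgue) \<longlonglongrightarrow> 0"
      using LIMSEQ_subseq_LIMSEQ[OF limr n] by (simp add: w_def comp_def)
    show "\<forall>e>0. \<forall>\<^sub>F i in sequentially. energy s p v \<le> energy s p (u (r1 (r2 (n i)))) + e"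
    proof (intro allI impI)
      fix e :: real assume "e > 0"
      then have "\<forall>\<^sub>F i in sequentially. l - e < energy s p (w (n i))"
        using El by (intro order_tendstoD) auto
      then show "\<forall>\<^sub>F i in sequentially. energy s p v \<le> energy s p (u (r1 (r2 (n i)))) + e"
        by eventually_elim (use Ev in \<open>simp add: w_def\<close>)
    qed
  qed
qed

section \<open>Existence of minimisers and of extremal potentials\<close>

text \<open>
  The setting: a bounded open set, and exponents for which the form bound holds.
\<close>

locale fractional_eigenvalue_problem =
  fixes s p q :: real and \<Omega> :: "'a::euclidean_space set"
  assumes s: "0 < s" "s < 1" and p: "p > 1" and q: "q > 1"
    and subcritical: "real DIM('a) / (s * p) < q"
    and bounded_dom: "bounded \<Omega>" and open_dom: "open \<Omega>"
begin

text \<open>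
  \<open>X\<close> is the energy space, \<open>X1\<close> its subset of functions of \<open>L\<^sup>p\<close> norm \<open>1\<close>, \<open>J V\<close> the
  functional to be minimised over \<open>X1\<close> and \<open>\<E>\<close> the energy.
\<close>

abbreviation "X \<equiv> zero_sobolev s p \<Omega>"
abbreviation "X1 \<equiv> {v \<in> X. (\<integral>x. \<bar>v x\<bar> powr p \<partial>lebesgue) = 1}"
abbreviation "J \<equiv> total_energy s p"
abbreviation "\<E> \<equiv> energy s p"

lemma dom_lmeasurable: "\<Omega> \<in> lmeasurable"
  using bounded_dom open_dom by (rule lmeasurable_open)

lemma dom_sets [measurable]: "\<Omega> \<in> sets lebesgue"
  using dom_lmeasurable by (rule fmeasurableD)

lemma potentialsD:
  assumes "V \<in> potentials q \<Omega>"
  shows "V \<in> borel_measurable lebesgue" "integrable lebesgue (\<lambda>x. \<bar>V x\<bar> powr q)" "\<And>x. x \<notin> \<Omega> \<Longrightarrow> V x = 0"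
  using assms by (auto simp: potentials_def)

lemma potentials_lincomb:
  assumes "V \<in> potentials q \<Omega>" "W \<in> potentials q \<Omega>"
  shows "(\<lambda>x. a * V x + b * W x) \<in> potentials q \<Omega>"
  using assms q by (auto simp: potentials_def intro!: integrable_abs_powr_add)

lemma indicator_potentials: "indicator \<Omega> \<in> potentials q \<Omega>"
proof -
  have "\<bar>indicator \<Omega> x :: real\<bar> powr q = indicator \<Omega> x" for x by (simp add: indicator_def)
  then show ?thesis using dom_lmeasurable by (auto simp: potentials_def fmeasurable_def)
qed

lemma zero_ext_potentials:
  assumes "V \<in> Lp_space q \<Omega>" shows "zero_ext \<Omega> V \<in> potentials q \<Omega>"
  using Lp_spaceD[OF assms] zero_ext_integral(2)[OF dom_sets, of "\<lambda>x t. \<bar>t\<bar> powr q" V]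
    zero_ext_measurable[OF dom_sets, of V] q
  by (auto simp: potentials_def) (simp add: zero_ext_def)

lemma zero_ext_norm: "(\<integral>x. \<bar>zero_ext \<Omega> V x\<bar> powr q \<partial>lebesgue) powr (1/q) = Lp_norm q \<Omega> V"
  using zero_ext_integral(1)[OF dom_sets, of "\<lambda>x t. \<bar>t\<bar> powr q" V] q by (simp add: Lp_norm_def)

lemma form_bound_potentials:
  assumes "e > 0"
  obtains K where "K > 0" "\<forall>u\<in>X. \<forall>V\<in>potentials q \<Omega>. integrable lebesgue (\<lambda>x. V x * \<bar>u x\<bar> powr p) \<and>
    (\<integral>x. \<bar>V x\<bar> * \<bar>u x\<bar> powr p \<partial>lebesgue)
      \<le> (\<integral>x. \<bar>V x\<bar> powr q \<partial>lebesgue) powr (1/q) * (e * \<E> u + K * (\<integral>x. \<bar>u x\<bar> powr p \<partial>lebesgue))"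
  by (rule form_bound_real[OF s(1) p q subcritical bounded_dom assms])

lemma potential_integrable:
  assumes "u \<in> X" "V \<in> potentials q \<Omega>"
  shows "integrable lebesgue (\<lambda>x. V x * \<bar>u x\<bar> powr p)"
  by (rule form_bound_potentials[OF zero_less_one]) (use assms in blast)

lemma abs_potential_integrable:
  assumes "u \<in> X" "V \<in> potentials q \<Omega>"
  shows "integrable lebesgue (\<lambda>x. \<bar>V x\<bar> * \<bar>u x\<bar> powr p)"
  using integrable_abs[OF potential_integrable[OF assms]] by (simp add: abs_mult)

lemma coercive:
  obtains K where "\<forall>V\<in>potentials q \<Omega>. \<forall>v\<in>X1. (\<integral>x. \<bar>V x\<bar> powr q \<partial>lebesgue) powr (1/q) \<le> B \<longrightarrow> \<E> v / 4 - K \<le> J V v"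
proof -
  define B' where "B' = \<bar>B\<bar> + 1"
  have B': "B' > 0" by (simp add: B'_def add_nonneg_pos)
  then have pos: "1 / (4 * B') > 0" by simp
  obtain K where K0: "K > 0" and Ka: "\<forall>u\<in>X. \<forall>V\<in>potentials q \<Omega>. integrable lebesgue (\<lambda>x. V x * \<bar>u x\<bar> powr p) \<and>
    (\<integral>x. \<bar>V x\<bar> * \<bar>u x\<bar> powr p \<partial>lebesgue)
      \<le> (\<integral>x. \<bar>V x\<bar> powr q \<partial>lebesgue) powr (1/q) * (1 / (4 * B') * \<E> u + K * (\<integral>x. \<bar>u x\<bar> powr p \<partial>lebesgue))"
    by (rule form_bound_potentials[OF pos])
  note K = K0 Ka[rule_format, THEN conjunct2]
  show ?thesis
  proof (rule that[of "B' * K"], intro ballI impI)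
    fix V v assume V0: "V \<in> potentials q \<Omega>" and v: "v \<in> X1" and V1: "(\<integral>x. \<bar>V x\<bar> powr q \<partial>lebesgue) powr (1/q) \<le> B"
    note V = V0 V1
    have "\<bar>\<integral>x. V x * \<bar>v x\<bar> powr p \<partial>lebesgue\<bar> \<le> (\<integral>x. \<bar>V x * \<bar>v x\<bar> powr p\<bar> \<partial>lebesgue)"
      by (rule integral_abs_bound)
    also have "\<dots> = (\<integral>x. \<bar>V x\<bar> * \<bar>v x\<bar> powr p \<partial>lebesgue)" by (simp add: abs_mult)
    also have "\<dots> \<le> (\<integral>x. \<bar>V x\<bar> powr q \<partial>lebesgue) powr (1/q) * (1 / (4 * B') * \<E> v + K)"
      using K(2)[of v V] V v by simp
    also have "\<dots> \<le> B' * (1 / (4 * B') * \<E> v + K)"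
      using V(2) B' K(1) energy_nonneg[of s p v] by (intro mult_right_mono) (auto simp: B'_def)
    also have "\<dots> = \<E> v / 4 + B' * K" using B' by (simp add: field_simps)
    finally show "\<E> v / 4 - B' * K \<le> J V v"
      using energy_nonneg[of s p v] by (simp add: total_energy_def abs_le_iff)
  qed
qed

text \<open>
  Since the form bound is uniform over a ball of \<open>L\<^sup>q\<close>, the potential term converges along a
  sequence that is bounded in energy and converges in \<open>L\<^sup>p\<close>, even when the potentials vary.
\<close>

lemma potential_term_convergence:
  assumes w: "\<And>i. w i \<in> X" and u: "u \<in> X" and M: "\<And>i. \<E> (w i) \<le> M"
    and lim: "(\<lambda>i. \<integral>x. \<bar>w i x - u x\<bar> powr p \<partial>lebesgue) \<longlonglongrightarrow> 0"
    and V: "\<And>i. V i \<in> potentials q \<Omega>" and B: "\<And>i. (\<integral>x. \<bar>V i x\<bar> powr q \<partial>lebesgue) powr (1/q) \<le> B"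
  shows "(\<lambda>i. (\<integral>x. V i x * \<bar>w i x\<bar> powr p \<partial>lebesgue) - (\<integral>x. V i x * \<bar>u x\<bar> powr p \<partial>lebesgue)) \<longlonglongrightarrow> 0"
proof (rule LIMSEQ_I)
  fix e :: real assume e: "e > 0"
  define U where "U = (\<integral>x. \<bar>u x\<bar> powr p \<partial>lebesgue)"
  have U: "U \<ge> 0" by (simp add: U_def)
  have B0: "B \<ge> 0" using B[of 0] powr_ge_zero order_trans by blast
  have M0: "M \<ge> 0" using M[of 0] energy_nonneg order_trans by blast
  obtain K1 where K10: "K1 > 0" and K1a: "\<forall>u\<in>X. \<forall>V\<in>potentials q \<Omega>. integrable lebesgue (\<lambda>x. V x * \<bar>u x\<bar> powr p) \<and>
    (\<integral>x. \<bar>V x\<bar> * \<bar>u x\<bar> powr p \<partial>lebesgue)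
      \<le> (\<integral>x. \<bar>V x\<bar> powr q \<partial>lebesgue) powr (1/q) * (1 * \<E> u + K1 * (\<integral>x. \<bar>u x\<bar> powr p \<partial>lebesgue))"
    by (rule form_bound_potentials[OF zero_less_one])
  note K1 = K10 K1a[rule_format, THEN conjunct2]
  define A where "A = B * (\<E> u + K1 * U)"
  have A0: "A \<ge> 0" using B0 K1 U energy_nonneg[of s p u] by (simp add: A_def)
  \<comment> \<open>\<open>\<eta>\<close> and \<open>\<epsilon>\<close> make two of the three error terms in the bound below at most \<open>e / 3\<close>\<close>
  define \<eta> where "\<eta> = e / (3 * (A + 1))"
  have \<eta>: "\<eta> > 0" using e A0 by (simp add: \<eta>_def)
  obtain C where C: "C > 0" "\<And>a b. \<bar>\<bar>a\<bar> powr p - \<bar>b\<bar> powr p\<bar> \<le> \<eta> * \<bar>b\<bar> powr p + C * \<bar>a - b\<bar> powr p"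
    using abs_powr_diff_le[of p \<eta>] p \<eta> by auto
  define M' where "M' = 2 powr p * (M + \<E> u)"
  have M'0: "M' \<ge> 0" using M0 energy_nonneg[of s p u] by (simp add: M'_def)
  define \<epsilon> where "\<epsilon> = e / (3 * (C * B * M' + 1))"
  have CBM: "C * B * M' \<ge> 0" using C B0 M'0 by simp
  have \<epsilon>: "\<epsilon> > 0" using e CBM by (simp add: \<epsilon>_def)
  obtain K where K0: "K > 0" and Ka: "\<forall>u\<in>X. \<forall>V\<in>potentials q \<Omega>. integrable lebesgue (\<lambda>x. V x * \<bar>u x\<bar> powr p) \<and>
    (\<integral>x. \<bar>V x\<bar> * \<bar>u x\<bar> powr p \<partial>lebesgue)
      \<le> (\<integral>x. \<bar>V x\<bar> powr q \<partial>lebesgue) powr (1/q) * (\<epsilon> * \<E> u + K * (\<integral>x. \<bar>u x\<bar> powr p \<partial>lebesgue))"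
    by (rule form_bound_potentials[OF \<epsilon>])
  note K = K0 Ka[rule_format, THEN conjunct2]
  define \<delta> where "\<delta> i = (\<integral>x. \<bar>w i x - u x\<bar> powr p \<partial>lebesgue)" for i
  have \<delta>0: "\<delta> i \<ge> 0" for i by (simp add: \<delta>_def)
  have wu: "(\<lambda>x. w i x - u x) \<in> X" for i
    using zero_sobolev_lincomb[OF w[of i] u, of 1 "-1"] p by simp
  have bound: "\<bar>(\<integral>x. V i x * \<bar>w i x\<bar> powr p \<partial>lebesgue) - (\<integral>x. V i x * \<bar>u x\<bar> powr p \<partial>lebesgue)\<bar>
     \<le> \<eta> * A + (C * B * M') * \<epsilon> + (C * B * K) * \<delta> i" for i
  proof -
    have "\<bar>(\<integral>x. V i x * \<bar>w i x\<bar> powr p \<partial>lebesgue) - (\<integral>x. V i x * \<bar>u x\<bar> powr p \<partial>lebesgue)\<bar>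
       = \<bar>\<integral>x. V i x * \<bar>w i x\<bar> powr p - V i x * \<bar>u x\<bar> powr p \<partial>lebesgue\<bar>"
      using potential_integrable[OF w V, of i i] potential_integrable[OF u V, of i] by simp
    also have "\<dots> \<le> (\<integral>x. \<bar>V i x * \<bar>w i x\<bar> powr p - V i x * \<bar>u x\<bar> powr p\<bar> \<partial>lebesgue)" by (rule integral_abs_bound)
    also have "\<dots> \<le> (\<integral>x. \<eta> * (\<bar>V i x\<bar> * \<bar>u x\<bar> powr p) + C * (\<bar>V i x\<bar> * \<bar>w i x - u x\<bar> powr p) \<partial>lebesgue)"
    proof (rule integral_mono)
      fix x
      have "\<bar>V i x * \<bar>w i x\<bar> powr p - V i x * \<bar>u x\<bar> powr p\<bar> = \<bar>V i x\<bar> * \<bar>\<bar>w i x\<bar> powr p - \<bar>u x\<bar> powr p\<bar>"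
        by (simp add: abs_mult[symmetric] right_diff_distrib)
      also have "\<dots> \<le> \<bar>V i x\<bar> * (\<eta> * \<bar>u x\<bar> powr p + C * \<bar>w i x - u x\<bar> powr p)"
        by (intro mult_left_mono C) auto
      finally show "\<bar>V i x * \<bar>w i x\<bar> powr p - V i x * \<bar>u x\<bar> powr p\<bar> \<le> \<eta> * (\<bar>V i x\<bar> * \<bar>u x\<bar> powr p) + C * (\<bar>V i x\<bar> * \<bar>w i x - u x\<bar> powr p)"
        by (simp add: algebra_simps)
    qed (use potential_integrable[OF w V, of i i] potential_integrable[OF u V, of i]
         abs_potential_integrable[OF u V, of i] abs_potential_integrable[OF wu V, of i i] in auto)
    also have "\<dots> = \<eta> * (\<integral>x. \<bar>V i x\<bar> * \<bar>u x\<bar> powr p \<partial>lebesgue) + C * (\<integral>x. \<bar>V i x\<bar> * \<bar>w i x - u x\<bar> powr p \<partial>lebesgue)"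
      using abs_potential_integrable[OF u V, of i] abs_potential_integrable[OF wu V, of i i] by simp
    also have "\<dots> \<le> \<eta> * A + C * (B * (\<epsilon> * M' + K * \<delta> i))"
    proof (intro add_mono mult_left_mono)
      have "(\<integral>x. \<bar>V i x\<bar> * \<bar>u x\<bar> powr p \<partial>lebesgue) \<le> (\<integral>x. \<bar>V i x\<bar> powr q \<partial>lebesgue) powr (1/q) * (1 * \<E> u + K1 * U)"
        using K1(2)[OF u V, of i] by (simp add: U_def)
      also have "\<dots> \<le> B * (1 * \<E> u + K1 * U)"
        using B K1(1) U energy_nonneg[of s p u] by (intro mult_right_mono) auto
      finally show "(\<integral>x. \<bar>V i x\<bar> * \<bar>u x\<bar> powr p \<partial>lebesgue) \<le> A" by (simp add: A_def)
      have "(\<integral>x. \<bar>V i x\<bar> * \<bar>w i x - u x\<bar> powr p \<partial>lebesgue)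
         \<le> (\<integral>x. \<bar>V i x\<bar> powr q \<partial>lebesgue) powr (1/q) * (\<epsilon> * \<E> (\<lambda>x. w i x - u x) + K * \<delta> i)"
        using K(2)[OF wu V, of i i] by (simp add: \<delta>_def)
      also have "\<dots> \<le> B * (\<epsilon> * M' + K * \<delta> i)"
      proof -
        have "0 \<le> \<epsilon> * \<E> (\<lambda>x. w i x - u x) + K * \<delta> i"
          using \<epsilon> K(1) \<delta>0[of i] by (intro add_nonneg_nonneg mult_nonneg_nonneg energy_nonneg) auto
        moreover have "\<epsilon> * \<E> (\<lambda>x. w i x - u x) + K * \<delta> i \<le> \<epsilon> * M' + K * \<delta> i"
        proof (intro add_mono mult_left_mono)
          have "\<E> (\<lambda>x. w i x - u x) \<le> 2 powr p * (\<E> (w i) + \<E> u)" using energy_diff_le[OF w u] p by simp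
          also have "\<dots> \<le> M'" unfolding M'_def using M by (intro mult_left_mono add_mono) auto
          finally show "\<E> (\<lambda>x. w i x - u x) \<le> M'" .
        qed (use \<epsilon> K(1) in auto)
        ultimately show ?thesis using B[of i] B0 by (intro mult_mono) auto
      qed
      finally show "(\<integral>x. \<bar>V i x\<bar> * \<bar>w i x - u x\<bar> powr p \<partial>lebesgue) \<le> B * (\<epsilon> * M' + K * \<delta> i)" .
    qed (use \<eta> C in auto)
    finally show ?thesis by (simp add: algebra_simps)
  qed
  have "(\<lambda>i. (C * B * K) * \<delta> i) \<longlonglongrightarrow> (C * B * K) * 0" using lim unfolding \<delta>_def by (intro tendsto_intros)
  then have "\<forall>\<^sub>F i in sequentially. (C * B * K) * \<delta> i < e / 3" using e by (intro order_tendstoD) auto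
  then obtain N where N: "\<And>i. i \<ge> N \<Longrightarrow> (C * B * K) * \<delta> i < e / 3" by (auto simp: eventually_sequentially)
  have 1: "\<eta> * A \<le> e / 3"
  proof -
    have "\<eta> * A \<le> \<eta> * (A + 1)" using \<eta> by (intro mult_left_mono) auto
    also have "\<dots> = e / 3" using A0 by (simp add: \<eta>_def field_simps)
    finally show ?thesis .
  qed
  have 2: "(C * B * M') * \<epsilon> \<le> e / 3"
  proof -
    have "(C * B * M') * \<epsilon> \<le> (C * B * M' + 1) * \<epsilon>" using \<epsilon> by (intro mult_right_mono) auto
    also have "\<dots> = e / 3" using CBM by (simp add: \<epsilon>_def field_simps)
    finally show ?thesis .
  qed
  show "\<exists>N. \<forall>i\<ge>N. norm ((\<integral>x. V i x * \<bar>w i x\<bar> powr p \<partial>lebesgue) - (\<integral>x. V i x * \<bar>u x\<bar> powr p \<partial>lebesgue) - 0) < e"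
  proof (intro exI allI impI)
    fix i assume "i \<ge> N"
    from N[OF this] bound[of i] 1 2
    show "norm ((\<integral>x. V i x * \<bar>w i x\<bar> powr p \<partial>lebesgue) - (\<integral>x. V i x * \<bar>u x\<bar> powr p \<partial>lebesgue) - 0) < e" by simp
  qed
qed

text \<open>
  The direct method with varying potentials. The constraint passes to the limit by
  \<open>potential_term_convergence\<close> for the indicator function of \<open>\<Omega>\<close> as potential.
\<close>

lemma minimizing_limit:
  assumes u: "\<And>i. u i \<in> X1" and V: "\<And>i. V i \<in> potentials q \<Omega>"
    and B: "\<And>i. (\<integral>x. \<bar>V i x\<bar> powr q \<partial>lebesgue) powr (1/q) \<le> B" and c: "\<And>i. J (V i) (u i) \<le> c"
  obtains v r where "v \<in> X1" "strict_mono (r :: nat \<Rightarrow> nat)"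
    "\<forall>e>0. \<forall>\<^sub>F i in sequentially. J (V (r i)) v \<le> J (V (r i)) (u (r i)) + e"
proof -
  obtain K where K: "\<forall>V\<in>potentials q \<Omega>. \<forall>v\<in>X1. (\<integral>x. \<bar>V x\<bar> powr q \<partial>lebesgue) powr (1/q) \<le> B \<longrightarrow> \<E> v / 4 - K \<le> J V v"
    by (rule coercive)
  define M where "M = 4 * (c + K)"
  have M: "\<E> (u i) \<le> M" for i using K[rule_format, OF V u B, of i i] c[of i] by (simp add: M_def)
  have uX: "u i \<in> X" for i using u by blast
  have u1: "(\<integral>x. \<bar>u i x\<bar> powr p \<partial>lebesgue) = 1" for i using u by blast
  obtain v r where v: "v \<in> X" and r: "strict_mono (r :: nat \<Rightarrow> nat)"
    and lim: "(\<lambda>i. \<integral>x. \<bar>u (r i) x - v x\<bar> powr p \<partial>lebesgue) \<longlonglongrightarrow> 0"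
    and lsc: "\<forall>e>0. \<forall>\<^sub>F i in sequentially. \<E> v \<le> \<E> (u (r i)) + e"
    by (rule zero_sobolev_compact[OF s(1) p dom_lmeasurable uX eq_refl[OF u1] M])
  have on_dom: "(\<integral>x. indicator \<Omega> x * \<bar>w x\<bar> powr p \<partial>lebesgue) = (\<integral>x. \<bar>w x\<bar> powr p \<partial>lebesgue)" if "w \<in> X" for w
    using zero_sobolevD(2)[OF that] by (intro Bochner_Integration.integral_cong) (auto simp: indicator_def)
  have "(\<lambda>i. (\<integral>x. indicator \<Omega> x * \<bar>u (r i) x\<bar> powr p \<partial>lebesgue) - (\<integral>x. indicator \<Omega> x * \<bar>v x\<bar> powr p \<partial>lebesgue)) \<longlonglongrightarrow> 0"
    by (rule potential_term_convergence[OF uX v M lim indicator_potentials order_refl])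
  then have "(\<integral>x. \<bar>v x\<bar> powr p \<partial>lebesgue) = 1"
    by (simp add: on_dom v uX u1 LIMSEQ_const_iff)
  then have v1: "v \<in> X1" using v by simp
  show ?thesis
  proof (rule that[OF v1 r], intro allI impI)
    fix e :: real assume e: "e > 0"
    have "(\<lambda>i. (\<integral>x. V (r i) x * \<bar>u (r i) x\<bar> powr p \<partial>lebesgue) - (\<integral>x. V (r i) x * \<bar>v x\<bar> powr p \<partial>lebesgue)) \<longlonglongrightarrow> 0"
      by (rule potential_term_convergence[OF uX v M lim V B])
    then have "\<forall>\<^sub>F i in sequentially. - (e/2) < (\<integral>x. V (r i) x * \<bar>u (r i) x\<bar> powr p \<partial>lebesgue) - (\<integral>x. V (r i) x * \<bar>v x\<bar> powr p \<partial>lebesgue)"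
      using e by (intro order_tendstoD) auto
    with lsc[rule_format, OF e] show "\<forall>\<^sub>F i in sequentially. J (V (r i)) v \<le> J (V (r i)) (u (r i)) + e"
      by eventually_elim (simp add: total_energy_def)
  qed
qed

lemma eigenvalue_INF: "eigenvalue s p \<Omega> V = (INF v\<in>X1. ereal (J (zero_ext \<Omega> V) v))"
  using eigenvalue_eq[OF dom_sets] p by simp

text \<open>
  Here \<open>m\<close> is the infimum of \<open>J\<close> over all pairs of a potential and a function. Only the function
  can be chosen optimally at this stage, as nothing is assumed about closedness of \<open>\<V>\<close>.
\<close>

lemma joint_minimizer:
  assumes \<V>: "\<V> \<subseteq> potentials q \<Omega>" "\<V> \<noteq> {}" and B: "\<And>V. V \<in> \<V> \<Longrightarrow> (\<integral>x. \<bar>V x\<bar> powr q \<partial>lebesgue) powr (1/q) \<le> B"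
    and X1: "X1 \<noteq> {}"
  obtains v m where "v \<in> X1" "\<forall>V\<in>\<V>. \<forall>w\<in>X1. m \<le> J V w" "\<forall>e>0. \<exists>V\<in>\<V>. J V v \<le> m + e"
proof -
  define S where "S = (\<lambda>(V, w). J V w) ` (\<V> \<times> X1)"
  obtain K where K: "\<forall>V\<in>potentials q \<Omega>. \<forall>v\<in>X1. (\<integral>x. \<bar>V x\<bar> powr q \<partial>lebesgue) powr (1/q) \<le> B \<longrightarrow> \<E> v / 4 - K \<le> J V v"
    by (rule coercive)
  have lb: "- K \<le> J V w" if "V \<in> \<V>" "w \<in> X1" for V w
  proof -
    have "V \<in> potentials q \<Omega>" using that \<V> by blast
    from K[rule_format, OF this that(2) B[OF that(1)]] show ?thesis using energy_nonneg[of s p w] by linarith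
  qed
  have bdd: "bdd_below S" using lb by (auto simp: S_def intro!: bdd_belowI[of _ "- K"])
  have ne: "S \<noteq> {}" using \<V>(2) X1 by (auto simp: S_def)
  define m where "m = Inf S"
  have m: "m \<le> J V w" if "V \<in> \<V>" "w \<in> X1" for V w
    unfolding m_def using that by (intro cInf_lower bdd) (auto simp: S_def)
  have "\<exists>z. z \<in> \<V> \<times> X1 \<and> J (fst z) (snd z) < m + 1 / Suc i" for i
  proof -
    obtain x where "x \<in> S" "x < m + 1 / Suc i" using cInf_lessD[OF ne, of "m + 1 / Suc i"] by (auto simp: m_def)
    then obtain z where "z \<in> \<V> \<times> X1" "x = J (fst z) (snd z)" by (auto simp: S_def)
    with \<open>x < m + 1 / Suc i\<close> show ?thesis by blast
  qed
  then obtain z where z: "\<forall>i. z i \<in> \<V> \<times> X1 \<and> J (fst (z i)) (snd (z i)) < m + 1 / Suc i"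
    using choice[of "\<lambda>i z. z \<in> \<V> \<times> X1 \<and> J (fst z) (snd z) < m + 1 / Suc i"] by blast
  define V where "V i = fst (z i)" for i
  define u where "u i = snd (z i)" for i
  have Vu: "V i \<in> \<V>" "u i \<in> X1" "J (V i) (u i) < m + 1 / Suc i" for i
    using z[rule_format, of i] by (auto simp: V_def u_def mem_Times_iff)
  have Jb: "J (V i) (u i) \<le> m + 1" for i
  proof -
    have "1 / real (Suc i) \<le> 1" by simp
    then show ?thesis using Vu(3)[of i] by linarith
  qed
  obtain v r where v: "v \<in> X1" and r: "strict_mono (r :: nat \<Rightarrow> nat)"
    and le: "\<forall>e>0. \<forall>\<^sub>F i in sequentially. J (V (r i)) v \<le> J (V (r i)) (u (r i)) + e"
  proof (rule minimizing_limit[of u V B "m + 1"])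
    show "V i \<in> potentials q \<Omega>" for i using Vu(1) \<V>(1) by blast
  qed (use Vu B Jb in auto)
  show ?thesis
  proof (rule that[OF v], use m in blast, intro allI impI)
    fix e :: real assume e: "e > 0"
    have "(\<lambda>i. 1 / real (Suc i)) \<longlonglongrightarrow> 0" by (rule LIMSEQ_Suc[OF lim_1_over_n])
    then have "\<forall>\<^sub>F i in sequentially. 1 / real (Suc (r i)) < e/2"
      using LIMSEQ_subseq_LIMSEQ[OF _ r, of "\<lambda>i. 1 / real (Suc i)" 0] e
      by (intro order_tendstoD) (auto simp: comp_def)
    moreover have "\<forall>\<^sub>F i in sequentially. J (V (r i)) v \<le> J (V (r i)) (u (r i)) + e/2" using le[rule_format, of "e/2"] e by simp
    ultimately have "\<forall>\<^sub>F i in sequentially. J (V (r i)) v \<le> m + e"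
      by eventually_elim (use Vu(3) in \<open>smt (verit) field_sum_of_halves\<close>)
    then obtain i where "J (V (r i)) v \<le> m + e" using eventually_happens'[OF sequentially_bot] by blast
    then show "\<exists>V\<in>\<V>. J V v \<le> m + e" using Vu(1) by blast
  qed
qed

lemma eigenvalue_attained:
  assumes V: "V \<in> Lp_space q \<Omega>" and X1: "X1 \<noteq> {}"
  obtains v where "v \<in> X1" "eigenvalue s p \<Omega> V = ereal (J (zero_ext \<Omega> V) v)" "\<forall>w\<in>X1. J (zero_ext \<Omega> V) v \<le> J (zero_ext \<Omega> V) w"
proof -
  obtain v m where v: "v \<in> X1" and m: "\<forall>W\<in>{zero_ext \<Omega> V}. \<forall>w\<in>X1. m \<le> J W w" and le: "\<forall>e>0. \<exists>W\<in>{zero_ext \<Omega> V}. J W v \<le> m + e"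
    by (rule joint_minimizer[of "{zero_ext \<Omega> V}" "Lp_norm q \<Omega> V"])
       (use zero_ext_potentials[OF V] X1 in \<open>auto simp: zero_ext_norm\<close>)
  have "J (zero_ext \<Omega> V) v \<le> m" by (rule field_le_epsilon) (use le in blast)
  then have min: "J (zero_ext \<Omega> V) v \<le> J (zero_ext \<Omega> V) w" if "w \<in> X1" for w using m that by force
  have "eigenvalue s p \<Omega> V = ereal (J (zero_ext \<Omega> V) v)"
    unfolding eigenvalue_INF using v min by (intro antisym INF_lower INF_greatest) auto
  with v min show ?thesis using that by blast
qed

lemma J_lincomb:
  assumes v: "v \<in> X" and V: "V \<in> Lp_space q \<Omega>" "W \<in> Lp_space q \<Omega>" and ab: "a + b = 1"
  shows "J (zero_ext \<Omega> (\<lambda>x. a * V x + b * W x)) v = a * J (zero_ext \<Omega> V) v + b * J (zero_ext \<Omega> W) v"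
proof -
  have "(\<integral>x. zero_ext \<Omega> (\<lambda>x. a * V x + b * W x) x * \<bar>v x\<bar> powr p \<partial>lebesgue)
    = (\<integral>x. a * (zero_ext \<Omega> V x * \<bar>v x\<bar> powr p) + b * (zero_ext \<Omega> W x * \<bar>v x\<bar> powr p) \<partial>lebesgue)"
    by (intro Bochner_Integration.integral_cong) (auto simp: zero_ext_def algebra_simps)
  also have "\<dots> = a * (\<integral>x. zero_ext \<Omega> V x * \<bar>v x\<bar> powr p \<partial>lebesgue) + b * (\<integral>x. zero_ext \<Omega> W x * \<bar>v x\<bar> powr p \<partial>lebesgue)"
    using potential_integrable[OF v zero_ext_potentials[OF V(1)]] potential_integrable[OF v zero_ext_potentials[OF V(2)]] by simp
  finally show ?thesis using ab unfolding total_energy_def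
    by (simp add: algebra_simps flip: distrib_right add_divide_distrib)
qed

lemma J_tendsto:
  assumes v: "v \<in> X" and F: "\<And>k. F k \<in> Lp_space q \<Omega>" and V: "V \<in> Lp_space q \<Omega>"
    and lim: "(\<lambda>k. Lp_norm q \<Omega> (\<lambda>x. F k x - V x)) \<longlonglongrightarrow> 0"
  shows "(\<lambda>k. J (zero_ext \<Omega> (F k)) v) \<longlonglongrightarrow> J (zero_ext \<Omega> V) v"
proof -
  obtain K where K0: "K > 0" and Ka: "\<forall>u\<in>X. \<forall>V\<in>potentials q \<Omega>. integrable lebesgue (\<lambda>x. V x * \<bar>u x\<bar> powr p) \<and>
    (\<integral>x. \<bar>V x\<bar> * \<bar>u x\<bar> powr p \<partial>lebesgue)
      \<le> (\<integral>x. \<bar>V x\<bar> powr q \<partial>lebesgue) powr (1/q) * (1 * \<E> u + K * (\<integral>x. \<bar>u x\<bar> powr p \<partial>lebesgue))"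
    by (rule form_bound_potentials[OF zero_less_one])
  note K = K0 Ka[rule_format, THEN conjunct2]
  define c where "c = 1 * \<E> v + K * (\<integral>x. \<bar>v x\<bar> powr p \<partial>lebesgue)"
  have bound: "norm (J (zero_ext \<Omega> (F k)) v - J (zero_ext \<Omega> V) v) \<le> Lp_norm q \<Omega> (\<lambda>x. F k x - V x) * c" for k
  proof -
    let ?D = "zero_ext \<Omega> (\<lambda>x. F k x - V x)"
    have D: "?D \<in> potentials q \<Omega>"
      using Lp_space_lincomb[OF F[of k] V, of 1 "-1"] q by (intro zero_ext_potentials) simp
    have "J (zero_ext \<Omega> (F k)) v - J (zero_ext \<Omega> V) v
       = (\<integral>x. zero_ext \<Omega> (F k) x * \<bar>v x\<bar> powr p - zero_ext \<Omega> V x * \<bar>v x\<bar> powr p \<partial>lebesgue)"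
      using potential_integrable[OF v zero_ext_potentials[OF F]] potential_integrable[OF v zero_ext_potentials[OF V]]
      by (simp add: total_energy_def)
    also have "\<dots> = (\<integral>x. ?D x * \<bar>v x\<bar> powr p \<partial>lebesgue)"
      by (intro Bochner_Integration.integral_cong) (auto simp: zero_ext_def algebra_simps)
    finally have "norm (J (zero_ext \<Omega> (F k)) v - J (zero_ext \<Omega> V) v) \<le> (\<integral>x. \<bar>?D x * \<bar>v x\<bar> powr p\<bar> \<partial>lebesgue)"
      using integral_abs_bound[of lebesgue "\<lambda>x. ?D x * \<bar>v x\<bar> powr p"] by simp
    also have "\<dots> = (\<integral>x. \<bar>?D x\<bar> * \<bar>v x\<bar> powr p \<partial>lebesgue)" by (simp add: abs_mult)
    also have "\<dots> \<le> Lp_norm q \<Omega> (\<lambda>x. F k x - V x) * c"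
      using K(2)[OF v D] unfolding zero_ext_norm c_def .
    finally show ?thesis .
  qed
  have "(\<lambda>k. Lp_norm q \<Omega> (\<lambda>x. F k x - V x) * c) \<longlonglongrightarrow> 0 * c" by (intro tendsto_intros lim)
  then have lim0: "(\<lambda>k. Lp_norm q \<Omega> (\<lambda>x. F k x - V x) * c) \<longlonglongrightarrow> 0" by simp
  have "(\<lambda>k. J (zero_ext \<Omega> (F k)) v - J (zero_ext \<Omega> V) v) \<longlonglongrightarrow> 0"
    by (rule Lim_null_comparison[OF always_eventually[OF allI[OF bound]] lim0])
  then show ?thesis by (rule LIM_zero_cancel)
qed

text \<open>
  The sign \<open>\<sigma>\<close> allows the lemma to serve both for superlevel sets of \<open>\<lambda>\<close> (\<open>\<sigma> = 1\<close>, all of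
  \<open>X1\<close>) and for sublevel sets of \<open>V \<mapsto> J V v\<close> (\<open>\<sigma> = -1\<close>, one \<open>v\<close>).
\<close>

lemma half_space_closed_convex:
  assumes sub: "\<C> \<subseteq> Lp_space q \<Omega>" and cl: "Lp_closed q \<Omega> \<C>" and cv: "fun_convex \<C>" and Y: "Y \<subseteq> X"
  shows "Lp_closed q \<Omega> {V \<in> \<C>. \<forall>v\<in>Y. c \<le> ereal (\<sigma> * J (zero_ext \<Omega> V) v)}"
    and "fun_convex {V \<in> \<C>. \<forall>v\<in>Y. c \<le> ereal (\<sigma> * J (zero_ext \<Omega> V) v)}"
proof -
  show "Lp_closed q \<Omega> {V \<in> \<C>. \<forall>v\<in>Y. c \<le> ereal (\<sigma> * J (zero_ext \<Omega> V) v)}"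
    unfolding Lp_closed_def
  proof (intro allI impI CollectI conjI ballI)
    fix F V assume F: "\<forall>k. F k \<in> {V \<in> \<C>. \<forall>v\<in>Y. c \<le> ereal (\<sigma> * J (zero_ext \<Omega> V) v)}"
      and V: "V \<in> Lp_space q \<Omega>" and lim: "(\<lambda>k. Lp_norm q \<Omega> (\<lambda>x. F k x - V x)) \<longlonglongrightarrow> 0"
    show "V \<in> \<C>" using cl F V lim unfolding Lp_closed_def by blast
    fix v assume v: "v \<in> Y"
    have "(\<lambda>k. J (zero_ext \<Omega> (F k)) v) \<longlonglongrightarrow> J (zero_ext \<Omega> V) v"
      using v Y F sub V lim by (intro J_tendsto) auto
    then have "(\<lambda>k. ereal (\<sigma> * J (zero_ext \<Omega> (F k)) v)) \<longlonglongrightarrow> ereal (\<sigma> * J (zero_ext \<Omega> V) v)"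
      by (intro tendsto_intros)
    then show "c \<le> ereal (\<sigma> * J (zero_ext \<Omega> V) v)"
      by (rule LIMSEQ_le_const) (use F v in auto)
  qed
  show "fun_convex {V \<in> \<C>. \<forall>v\<in>Y. c \<le> ereal (\<sigma> * J (zero_ext \<Omega> V) v)}"
    unfolding fun_convex_def
  proof (intro ballI allI impI CollectI conjI)
    fix V W and a b :: real
    assume V: "V \<in> {V \<in> \<C>. \<forall>v\<in>Y. c \<le> ereal (\<sigma> * J (zero_ext \<Omega> V) v)}"
      and W: "W \<in> {V \<in> \<C>. \<forall>v\<in>Y. c \<le> ereal (\<sigma> * J (zero_ext \<Omega> V) v)}" and ab: "0 \<le> a" "0 \<le> b" "a + b = 1"
    show "(\<lambda>x. a * V x + b * W x) \<in> \<C>" using cv V W ab unfolding fun_convex_def by blast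
    fix v assume v: "v \<in> Y"
    have eq: "J (zero_ext \<Omega> (\<lambda>x. a * V x + b * W x)) v = a * J (zero_ext \<Omega> V) v + b * J (zero_ext \<Omega> W) v"
      using v Y V W sub ab by (intro J_lincomb) auto
    have cV: "c \<le> ereal (\<sigma> * J (zero_ext \<Omega> V) v)" and cW: "c \<le> ereal (\<sigma> * J (zero_ext \<Omega> W) v)" using V W v by auto
    show "c \<le> ereal (\<sigma> * J (zero_ext \<Omega> (\<lambda>x. a * V x + b * W x)) v)"
    proof (cases c)
      case (real t)
      have "t = a * t + b * t" using ab by (simp flip: distrib_right)
      also have "\<dots> \<le> a * (\<sigma> * J (zero_ext \<Omega> V) v) + b * (\<sigma> * J (zero_ext \<Omega> W) v)"
        using cV cW real ab by (intro add_mono mult_left_mono) auto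
      finally show ?thesis using real by (simp add: eq algebra_simps)
    qed (use cV in auto)
  qed
qed

lemma eigenvalue_max_exists:
  assumes sub: "\<C> \<subseteq> Lp_space q \<Omega>" and ne: "\<C> \<noteq> {}" and bd: "Lp_bounded q \<Omega> \<C>"
    and cl: "Lp_closed q \<Omega> \<C>" and cv: "fun_convex \<C>"
  shows "\<exists>V\<in>\<C>. \<forall>W\<in>\<C>. eigenvalue s p \<Omega> W \<le> eigenvalue s p \<Omega> V"
proof (rule quasiconcave_attains_max[OF q sub ne bd])
  fix c
  have eq: "{V \<in> \<C>. c \<le> eigenvalue s p \<Omega> V} = {V \<in> \<C>. \<forall>v\<in>X1. c \<le> ereal (1 * J (zero_ext \<Omega> V) v)}"
    unfolding eigenvalue_INF le_INF_iff by simp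
  show "Lp_closed q \<Omega> {V \<in> \<C>. c \<le> eigenvalue s p \<Omega> V}" "fun_convex {V \<in> \<C>. c \<le> eigenvalue s p \<Omega> V}"
    unfolding eq by (rule half_space_closed_convex[OF sub cl cv]; blast)+
qed

lemma eigenvalue_min_exists:
  assumes sub: "\<C> \<subseteq> Lp_space q \<Omega>" and ne: "\<C> \<noteq> {}" and bd: "Lp_bounded q \<Omega> \<C>"
    and cl: "Lp_closed q \<Omega> \<C>" and cv: "fun_convex \<C>" and X1: "X1 \<noteq> {}"
  shows "\<exists>V\<in>\<C>. \<forall>W\<in>\<C>. eigenvalue s p \<Omega> V \<le> eigenvalue s p \<Omega> W"
proof -
  obtain B where B: "\<And>V. V \<in> \<C> \<Longrightarrow> Lp_norm q \<Omega> V \<le> B" using bd by (auto simp: Lp_bounded_def)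
  obtain v m where v: "v \<in> X1" and m: "\<forall>V\<in>zero_ext \<Omega> ` \<C>. \<forall>w\<in>X1. m \<le> J V w"
    and le: "\<forall>e>0. \<exists>V\<in>zero_ext \<Omega> ` \<C>. J V v \<le> m + e"
    by (rule joint_minimizer[of "zero_ext \<Omega> ` \<C>" B])
       (use sub ne B X1 zero_ext_potentials in \<open>auto simp: zero_ext_norm\<close>)
  have "\<exists>V\<in>\<C>. \<forall>W\<in>\<C>. ereal (- 1 * J (zero_ext \<Omega> W) v) \<le> ereal (- 1 * J (zero_ext \<Omega> V) v)"
  proof (rule quasiconcave_attains_max[OF q sub ne bd])
    fix c
    have eq: "{V \<in> \<C>. c \<le> ereal (- 1 * J (zero_ext \<Omega> V) v)} = {V \<in> \<C>. \<forall>v\<in>{v}. c \<le> ereal (- 1 * J (zero_ext \<Omega> V) v)}"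
      by simp
    show "Lp_closed q \<Omega> {V \<in> \<C>. c \<le> ereal (- 1 * J (zero_ext \<Omega> V) v)}" "fun_convex {V \<in> \<C>. c \<le> ereal (- 1 * J (zero_ext \<Omega> V) v)}"
      unfolding eq by (rule half_space_closed_convex[OF sub cl cv]; use v in blast)+
  qed
  then obtain V where V: "V \<in> \<C>" "\<And>W. W \<in> \<C> \<Longrightarrow> J (zero_ext \<Omega> V) v \<le> J (zero_ext \<Omega> W) v" by auto
  have "J (zero_ext \<Omega> V) v \<le> m + e" if e: "e > 0" for e
  proof -
    obtain W where "W \<in> \<C>" "J (zero_ext \<Omega> W) v \<le> m + e" using le e by blast
    with V(2)[of W] show ?thesis by linarith
  qed
  then have Jm: "J (zero_ext \<Omega> V) v \<le> m" by (rule field_le_epsilon)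
  have "eigenvalue s p \<Omega> V \<le> eigenvalue s p \<Omega> W" if W: "W \<in> \<C>" for W
  proof -
    have "eigenvalue s p \<Omega> V \<le> ereal (J (zero_ext \<Omega> V) v)" unfolding eigenvalue_INF by (rule INF_lower[OF v])
    also have "\<dots> \<le> ereal m" using Jm by simp
    also have "\<dots> \<le> eigenvalue s p \<Omega> W" unfolding eigenvalue_INF using m W by (intro INF_greatest) auto
    finally show ?thesis .
  qed
  then show ?thesis using V(1) by blast
qed

end

section \<open>Lipschitz functions have finite energy\<close>

lemma dyadic_scale:
  fixes t :: real
  assumes t: "t > 0"
  shows "(t \<ge> 1 \<and> (\<exists>i::nat. 2 powr i \<le> t \<and> t \<le> 2 powr (real i + 1))) \<or>
         (t \<le> 1 \<and> (\<exists>i::nat. 2 powr (- real i - 1) \<le> t \<and> t \<le> 2 powr (- real i)))"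
proof -
  define z where "z = \<lfloor>log 2 t\<rfloor>"
  have z: "real_of_int z \<le> log 2 t" "log 2 t \<le> real_of_int z + 1" by (auto simp: z_def)
  have e: "2 powr (log 2 t) = t" using t by simp
  have 1: "2 powr z \<le> t" using powr_mono[OF z(1), of 2] e by simp
  have 2: "t \<le> 2 powr (z + 1)" using powr_mono[OF z(2), of 2] e by simp
  show ?thesis
  proof (cases "z \<ge> 0")
    case True
    have "(2::real) powr 0 \<le> 2 powr z" using True by (intro powr_mono) auto
    then have "t \<ge> 1" using 1 by simp
    moreover have "real (nat z) = z" using True by simp
    ultimately show ?thesis using 1 2 by (metis of_int_add of_int_1)
  next
    case False
    have "(2::real) powr (z + 1) \<le> 2 powr 0" using False by (intro powr_mono) auto
    then have "t \<le> 1" using 2 by simp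
    moreover have "real (nat (- z - 1)) = - z - 1" using False by simp
    then have "2 powr (- real (nat (- z - 1)) - 1) \<le> t" "t \<le> 2 powr (- real (nat (- z - 1)))"
      using 1 2 by (simp_all add: algebra_simps)
    ultimately show ?thesis by blast
  qed
qed

text \<open>
  The kernel \<open>min 1 (\<bar>h\<bar>\<^sup>p) / \<bar>h\<bar>\<^sup>n\<^sup>+\<^sup>s\<^sup>p\<close> is integrable: bound it on the dyadic shells
  \<open>2\<^sup>i \<le> \<bar>h\<bar> \<le> 2\<^sup>i\<^sup>+\<^sup>1\<close> by constants. The contributions of the shells form geometric series with
  ratios \<open>2\<^sup>-\<^sup>s\<^sup>p\<close> at infinity and \<open>2\<^sup>-\<^sup>(\<^sup>1\<^sup>-\<^sup>s\<^sup>)\<^sup>p\<close> at the origin.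
\<close>

lemma kernel_integral_bounded:
  fixes s p :: real
  assumes s: "0 < s" "s < 1" and p: "p > 1"
  obtains c where "c \<ge> 0" "\<forall>x::'a::euclidean_space. (\<integral>\<^sup>+y. ennreal (min 1 (norm (x - y) powr p) / norm (x - y) powr (real DIM('a) + s * p)) \<partial>lebesgue) \<le> ennreal c"
proof -
  define n where "n = real DIM('a)"
  define a where "a = n + s * p"
  define \<nu> where "\<nu> = unit_ball_vol n"
  have n: "n > 0" by (simp add: n_def)
  have a: "a > 0" using n s p by (simp add: a_def add_pos_pos)
  have \<nu>: "\<nu> \<ge> 0" by (simp add: \<nu>_def n_def)
  define A where "A i = 2 powr (- real i * p) * 2 powr ((real i + 1) * a)" for i :: nat
  define B where "B i = 2 powr (- real i * a)" for i :: nat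
  define rA where "rA i = 2 powr (- real i)" for i :: nat
  define rB where "rB i = 2 powr (real i + 1)" for i :: nat
  have ball: "(\<integral>\<^sup>+y. ennreal c * indicator (cball x r) y \<partial>lebesgue) = ennreal (c * (\<nu> * r powr n))" if "c \<ge> 0" "r > 0" for x :: 'a and c r
    using that \<nu> emeasure_cball[of r x]
    by (simp add: nn_integral_cmult_indicator \<nu>_def n_def powr_realpow ennreal_mult)
  define gA where "gA = 2 powr (- (p - s * p))"
  define gB where "gB = 2 powr (- (s * p))"
  have "s * p < 1 * p" using s p by (intro mult_strict_right_mono) auto
  then have gA: "0 < gA" "gA < 1" by (auto simp: gA_def powr_less_one)
  have gB: "0 < gB" "gB < 1" using s p by (auto simp: gB_def powr_less_one)
  have sA: "A i * (\<nu> * rA i powr n) = (2 powr a * \<nu>) * gA ^ i" for i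
  proof -
    have "A i * rA i powr n = 2 powr (- real i * p + (real i + 1) * a + - real i * n)"
      unfolding A_def rA_def powr_add by (simp add: powr_powr)
    also have "- real i * p + (real i + 1) * a + - real i * n = a + - (p - s * p) * real i" by (simp add: a_def algebra_simps)
    also have "2 powr (a + - (p - s * p) * real i) = 2 powr a * gA ^ i"
      unfolding powr_add gA_def by (simp add: powr_realpow[symmetric] powr_powr)
    finally show ?thesis by (simp add: ac_simps)
  qed
  have sB: "B i * (\<nu> * rB i powr n) = (2 powr n * \<nu>) * gB ^ i" for i
  proof -
    have "B i * rB i powr n = 2 powr (- real i * a + (real i + 1) * n)"
      unfolding B_def rB_def powr_powr powr_add[symmetric] ..
    also have "- real i * a + (real i + 1) * n = n + - (s * p) * real i" by (simp add: a_def algebra_simps)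
    also have "2 powr (n + - (s * p) * real i) = 2 powr n * gB ^ i"
      unfolding powr_add gB_def by (simp add: powr_realpow[symmetric] powr_powr)
    finally show ?thesis by (simp add: ac_simps)
  qed
  define c where "c = (2 powr a * \<nu>) * (1 / (1 - gA)) + (2 powr n * \<nu>) * (1 / (1 - gB))"
  show ?thesis
  proof (rule that[of c])
    show "c \<ge> 0" using \<nu> gA gB by (simp add: c_def)
    show "\<forall>x::'a. (\<integral>\<^sup>+y. ennreal (min 1 (norm (x - y) powr p) / norm (x - y) powr (real DIM('a) + s * p)) \<partial>lebesgue) \<le> ennreal c"
    proof
      fix x :: 'a
      have "(\<integral>\<^sup>+y. ennreal (min 1 (norm (x - y) powr p) / norm (x - y) powr a) \<partial>lebesgue)
         \<le> (\<integral>\<^sup>+y. (\<Sum>i. ennreal (A i) * indicator (cball x (rA i)) y) + (\<Sum>i. ennreal (B i) * indicator (cball x (rB i)) y) \<partial>lebesgue)"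
      proof (rule nn_integral_mono)
        fix y
        define t where "t = norm (x - y)"
        let ?SA = "\<Sum>i. ennreal (A i) * indicator (cball x (rA i)) y" and ?SB = "\<Sum>i. ennreal (B i) * indicator (cball x (rB i)) y"
        have single: "f i \<le> suminf f" for f :: "nat \<Rightarrow> ennreal" and i
          using sum_le_suminf[of f "{i}"] by simp
        have leA: "ennreal (A i) * indicator (cball x (rA i)) y \<le> ?SA" for i
          by (rule single)
        have leB: "ennreal (B i) * indicator (cball x (rB i)) y \<le> ?SB" for i
          by (rule single)
        show "ennreal (min 1 (norm (x - y) powr p) / norm (x - y) powr a) \<le> ?SA + ?SB"
        proof (cases "t = 0")
          case True
          then show ?thesis by (simp add: t_def)
        next
          case False
          then have t: "t > 0" by (simp add: t_def)
          from dyadic_scale[OF t] show ?thesis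
          proof (elim disjE conjE exE)
            fix i :: nat assume i: "2 powr i \<le> t" "t \<le> 2 powr (real i + 1)"
            have "(2 powr i) powr a \<le> t powr a" using i a by (intro powr_mono2) auto
            then have "min 1 (t powr p) / t powr a \<le> 1 / (2 powr i) powr a"
              using t by (intro frac_le) auto
            also have "\<dots> = B i" by (simp add: B_def powr_powr powr_minus_divide)
            finally have "ennreal (min 1 (t powr p) / t powr a) \<le> ennreal (B i) * indicator (cball x (rB i)) y"
              using i(2) by (simp add: ennreal_leI rB_def t_def dist_norm)
            also have "\<dots> \<le> ?SA + ?SB" using leB[of i] by (simp add: add_increasing)
            finally show ?thesis by (simp add: t_def)
          next
            fix i :: nat assume i: "2 powr (- real i - 1) \<le> t" "t \<le> 2 powr (- real i)"
            have "(2 powr (- real i - 1)) powr a \<le> t powr a" using i a by (intro powr_mono2) auto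
            moreover have "t powr p \<le> (2 powr (- real i)) powr p" using i t p by (intro powr_mono2) auto
            ultimately have "min 1 (t powr p) / t powr a \<le> (2 powr (- real i)) powr p / (2 powr (- real i - 1)) powr a"
              using t by (intro frac_le) auto
            also have "\<dots> = A i"
              by (simp add: A_def powr_powr divide_powr_uminus algebra_simps)
            finally have "ennreal (min 1 (t powr p) / t powr a) \<le> ennreal (A i) * indicator (cball x (rA i)) y"
              using i(2) by (simp add: ennreal_leI rA_def t_def dist_norm)
            also have "\<dots> \<le> ?SA + ?SB" using leA[of i] by (simp add: add_increasing2)
            finally show ?thesis by (simp add: t_def)
          qed
        qed
      qed
      also have "\<dots> = (\<Sum>i. \<integral>\<^sup>+y. ennreal (A i) * indicator (cball x (rA i)) y \<partial>lebesgue) + (\<Sum>i. \<integral>\<^sup>+y. ennreal (B i) * indicator (cball x (rB i)) y \<partial>lebesgue)"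
      proof -
        have [measurable]: "cball x r \<in> sets lebesgue" for r by simp
        show ?thesis by (subst nn_integral_add, measurable) (simp add: nn_integral_suminf)
      qed
      also have "\<dots> = (\<Sum>i. ennreal ((2 powr a * \<nu>) * gA ^ i)) + (\<Sum>i. ennreal ((2 powr n * \<nu>) * gB ^ i))"
        by (intro arg_cong2[where f="(+)"] suminf_cong; subst ball) (auto simp: sA sB, auto simp: A_def B_def rA_def rB_def)
      also have "\<dots> = ennreal ((2 powr a * \<nu>) * (1 / (1 - gA))) + ennreal ((2 powr n * \<nu>) * (1 / (1 - gB)))"
        using gA gB \<nu> by (subst (1 2) suminf_ennreal2) (auto intro!: summable_mult summable_geometric simp: suminf_mult suminf_geometric)
      also have "\<dots> = ennreal c" unfolding c_def using gA gB \<nu> by (intro ennreal_plus[symmetric]) auto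
      finally show "(\<integral>\<^sup>+y. ennreal (min 1 (norm (x - y) powr p) / norm (x - y) powr (real DIM('a) + s * p)) \<partial>lebesgue) \<le> ennreal c"
        by (simp add: a_def n_def)
    qed
  qed
qed

lemma Lipschitz_zero_sobolev:
  fixes w :: "'a::euclidean_space \<Rightarrow> real"
  assumes s: "0 < s" "s < 1" and p: "p > 1" and \<Omega>: "\<Omega> \<in> lmeasurable"
    and L: "\<And>x y. \<bar>w x - w y\<bar> \<le> L * norm (x - y)" and S: "\<And>x. \<bar>w x\<bar> \<le> S" and w0: "\<And>x. x \<notin> \<Omega> \<Longrightarrow> w x = 0"
  shows "w \<in> zero_sobolev s p \<Omega>"
proof -
  have \<Omega>s[measurable]: "\<Omega> \<in> sets lebesgue" using \<Omega> by (rule fmeasurableD)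
  have \<Omega>f: "emeasure lebesgue \<Omega> < \<infinity>" using \<Omega> by (simp add: fmeasurable_def)
  have L0: "L \<ge> 0"
  proof -
    obtain b :: 'a where b: "b \<in> Basis" by (meson nonempty_Basis ex_in_conv)
    from L[of b 0] b show ?thesis by (simp add: order_trans[OF abs_ge_zero])
  qed
  have "continuous_on UNIV w"
    by (rule lipschitz_on_continuous_on[of L]) (use L L0 in \<open>auto simp: lipschitz_on_def dist_norm dist_real_def\<close>)
  then have wb: "w \<in> borel_measurable borel" by (rule borel_measurable_continuous_onI)
  then have wm[measurable]: "w \<in> borel_measurable lebesgue" by (intro measurable_completion) simp
  have S0: "S \<ge> 0" using S[of 0] by linarith
  have "integrable lebesgue (\<lambda>x. \<bar>w x\<bar> powr p)"
  proof (rule Bochner_Integration.integrable_bound[of _ "\<lambda>x. S powr p * indicator \<Omega> x"])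
    show "integrable lebesgue (\<lambda>x. S powr p * indicator \<Omega> x)" using \<Omega>f by simp
    show "AE x in lebesgue. norm (\<bar>w x\<bar> powr p) \<le> norm (S powr p * indicator \<Omega> x)"
      using S w0 p by (auto simp: indicator_def intro!: powr_mono2)
  qed measurable
  moreover have "gagliardo_integral s p UNIV w < \<infinity>"
  proof -
    define a where "a = real DIM('a) + s * p"
    define C where "C = max (L powr p) ((2 * S) powr p)"
    define k where "k = (\<lambda>x y::'a. ennreal (min 1 (norm (x - y) powr p) / norm (x - y) powr a))"
    obtain c where c: "c \<ge> 0" "\<forall>x::'a. (\<integral>\<^sup>+y. k x y \<partial>lebesgue) \<le> ennreal c"
      unfolding k_def a_def by (rule kernel_integral_bounded[OF s p])
    have km: "(\<lambda>(x, y). k x y) \<in> borel_measurable (lebesgue \<Otimes>\<^sub>M lebesgue)" unfolding k_def case_prod_beta by measurable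
    have [measurable]: "k x \<in> borel_measurable lebesgue" for x
      using measurable_compose[OF measurable_Pair1' km, of x] by simp
    have [measurable]: "(\<lambda>x. \<integral>\<^sup>+y. k x y \<partial>lebesgue) \<in> borel_measurable lebesgue"
      using km by (rule lebesgue.borel_measurable_nn_integral)
    have C: "C \<ge> 0" by (simp add: C_def le_max_iff_disj)
    have pw: "ennreal (\<bar>w x - w y\<bar> powr p / norm (x - y) powr a)
        \<le> ennreal C * (indicator \<Omega> x * k x y) + ennreal C * (indicator \<Omega> y * k x y)" for x y
    proof (cases "x \<in> \<Omega> \<or> y \<in> \<Omega>")
      case False
      then show ?thesis using w0 by simp
    next
      case True
      have "\<bar>w x - w y\<bar> powr p \<le> C * min 1 (norm (x - y) powr p)"
      proof (cases "norm (x - y) powr p \<le> 1")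
        case True
        have "\<bar>w x - w y\<bar> powr p \<le> (L * norm (x - y)) powr p" using L p by (intro powr_mono2) auto
        also have "\<dots> = L powr p * norm (x - y) powr p" using L0 by (simp add: powr_mult)
        also have "\<dots> \<le> C * norm (x - y) powr p" by (intro mult_right_mono) (auto simp: C_def)
        finally show ?thesis using True by simp
      next
        case False
        have "\<bar>w x - w y\<bar> \<le> 2 * S" using S[of x] S[of y] by linarith
        then have "\<bar>w x - w y\<bar> powr p \<le> (2 * S) powr p" using p by (intro powr_mono2) auto
        then show ?thesis using False by (auto simp: C_def min_def)
      qed
      then have "\<bar>w x - w y\<bar> powr p / norm (x - y) powr a \<le> C * (min 1 (norm (x - y) powr p) / norm (x - y) powr a)"
        by (simp add: divide_right_mono)
      then have "ennreal (\<bar>w x - w y\<bar> powr p / norm (x - y) powr a) \<le> ennreal C * k x y"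
        using C unfolding k_def by (subst ennreal_mult[symmetric]) (auto intro: ennreal_leI)
      then show ?thesis using True by (auto simp: indicator_def add_increasing add_increasing2)
    qed
    have Fub: "(\<integral>\<^sup>+x. \<integral>\<^sup>+y. indicator \<Omega> y * k x y \<partial>lebesgue \<partial>lebesgue) = (\<integral>\<^sup>+x. \<integral>\<^sup>+y. indicator \<Omega> x * k x y \<partial>lebesgue \<partial>lebesgue)"
    proof -
      have "(\<integral>\<^sup>+x. \<integral>\<^sup>+y. indicator \<Omega> y * k x y \<partial>lebesgue \<partial>lebesgue) = (\<integral>\<^sup>+y. \<integral>\<^sup>+x. indicator \<Omega> y * k x y \<partial>lebesgue \<partial>lebesgue)"
        by (rule lebesgue_pair.Fubini'[symmetric]) (use km in measurable)
      then show ?thesis by (simp add: k_def norm_minus_commute)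
    qed
    have one: "(\<integral>\<^sup>+x. \<integral>\<^sup>+y. indicator \<Omega> x * k x y \<partial>lebesgue \<partial>lebesgue) \<le> ennreal c * emeasure lebesgue \<Omega>"
    proof -
      have "(\<integral>\<^sup>+x. \<integral>\<^sup>+y. indicator \<Omega> x * k x y \<partial>lebesgue \<partial>lebesgue) \<le> (\<integral>\<^sup>+x. ennreal c * indicator \<Omega> x \<partial>lebesgue)"
        using c(2) by (intro nn_integral_mono) (auto simp: nn_integral_cmult indicator_def)
      then show ?thesis by (simp add: nn_integral_cmult_indicator)
    qed
    have m1: "(\<lambda>(x, y). indicator \<Omega> x * k x y) \<in> borel_measurable (lebesgue \<Otimes>\<^sub>M lebesgue)"
      and m2: "(\<lambda>(x, y). indicator \<Omega> y * k x y) \<in> borel_measurable (lebesgue \<Otimes>\<^sub>M lebesgue)"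
      using km by measurable
    note [measurable] = lebesgue.borel_measurable_nn_integral[OF m1] lebesgue.borel_measurable_nn_integral[OF m2]
    have "gagliardo_integral s p UNIV w
       \<le> (\<integral>\<^sup>+x. \<integral>\<^sup>+y. ennreal C * (indicator \<Omega> x * k x y) + ennreal C * (indicator \<Omega> y * k x y) \<partial>lebesgue \<partial>lebesgue)"
      unfolding gagliardo_integral_UNIV a_def[symmetric] by (intro nn_integral_mono pw)
    also have "\<dots> = ennreal C * (\<integral>\<^sup>+x. \<integral>\<^sup>+y. indicator \<Omega> x * k x y \<partial>lebesgue \<partial>lebesgue)
        + ennreal C * (\<integral>\<^sup>+x. \<integral>\<^sup>+y. indicator \<Omega> y * k x y \<partial>lebesgue \<partial>lebesgue)"
    proof -
      have "(\<integral>\<^sup>+y. ennreal C * (indicator \<Omega> x * k x y) + ennreal C * (indicator \<Omega> y * k x y) \<partial>lebesgue)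
         = ennreal C * (\<integral>\<^sup>+y. indicator \<Omega> x * k x y \<partial>lebesgue) + ennreal C * (\<integral>\<^sup>+y. indicator \<Omega> y * k x y \<partial>lebesgue)" for x
        by (subst nn_integral_add, measurable) (subst (1 2) nn_integral_cmult, measurable)
      then show ?thesis by (simp add: nn_integral_add nn_integral_cmult)
    qed
    also have "\<dots> \<le> ennreal C * (ennreal c * emeasure lebesgue \<Omega>) + ennreal C * (ennreal c * emeasure lebesgue \<Omega>)"
      unfolding Fub using one by (intro add_mono mult_left_mono) auto
    also have "\<dots> < \<infinity>" using \<Omega>f by (simp add: ennreal_mult_less_top)
    finally show ?thesis .
  qed
  ultimately show ?thesis using wm w0 by (simp add: zero_sobolev_def)
qed

section \<open>Differentiation of powers under the integral sign\<close>

lemma integrable_weighted_powr_sum: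
  fixes a b \<rho> :: "'a \<Rightarrow> real"
  assumes p: "p > 0" and [measurable]: "a \<in> borel_measurable M" "b \<in> borel_measurable M" "\<rho> \<in> borel_measurable M"
    and ia: "integrable M (\<lambda>x. \<rho> x * \<bar>a x\<bar> powr p)" and ib: "integrable M (\<lambda>x. \<rho> x * \<bar>b x\<bar> powr p)"
  shows "integrable M (\<lambda>x. \<bar>\<rho> x\<bar> * (\<bar>a x\<bar> + \<bar>b x\<bar>) powr p)"
proof (rule Bochner_Integration.integrable_bound[of _ "\<lambda>x. 2 powr p * (norm (\<rho> x * \<bar>a x\<bar> powr p) + norm (\<rho> x * \<bar>b x\<bar> powr p))"])
  show "integrable M (\<lambda>x. 2 powr p * (norm (\<rho> x * \<bar>a x\<bar> powr p) + norm (\<rho> x * \<bar>b x\<bar> powr p)))"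
    using ia ib by auto
  have "\<bar>\<rho> x\<bar> * (\<bar>a x\<bar> + \<bar>b x\<bar>) powr p \<le> 2 powr p * (norm (\<rho> x * \<bar>a x\<bar> powr p) + norm (\<rho> x * \<bar>b x\<bar> powr p))" for x
  proof -
    have "\<bar>\<rho> x\<bar> * (\<bar>a x\<bar> + \<bar>b x\<bar>) powr p \<le> \<bar>\<rho> x\<bar> * (2 powr p * (\<bar>a x\<bar> powr p + \<bar>b x\<bar> powr p))"
      using abs_add_powr_le[of p "\<bar>a x\<bar>" "\<bar>b x\<bar>"] p by (intro mult_left_mono) auto
    then show ?thesis by (simp add: abs_mult algebra_simps)
  qed
  then show "AE x in M. norm (\<bar>\<rho> x\<bar> * (\<bar>a x\<bar> + \<bar>b x\<bar>) powr p) \<le> norm (2 powr p * (norm (\<rho> x * \<bar>a x\<bar> powr p) + norm (\<rho> x * \<bar>b x\<bar> powr p)))"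
    by (intro AE_I2) (auto simp: abs_mult)
qed measurable

lemma has_real_derivative_integral_powr:
  fixes a b \<rho> :: "'a \<Rightarrow> real"
  assumes p: "p > 1" and [measurable]: "a \<in> borel_measurable M" "b \<in> borel_measurable M" "\<rho> \<in> borel_measurable M"
    and ia: "integrable M (\<lambda>x. \<rho> x * \<bar>a x\<bar> powr p)" and ib: "integrable M (\<lambda>x. \<rho> x * \<bar>b x\<bar> powr p)"
  shows "((\<lambda>t. \<integral>x. \<rho> x * \<bar>a x + t * b x\<bar> powr p \<partial>M) has_real_derivative
      (\<integral>x. \<rho> x * (p * sgn (a x) * \<bar>a x\<bar> powr (p - 1) * b x) \<partial>M)) (at 0)"
    and "integrable M (\<lambda>x. \<rho> x * (p * sgn (a x) * \<bar>a x\<bar> powr (p - 1) * b x))"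
proof -
  define D where "D x = p * sgn (a x) * \<bar>a x\<bar> powr (p - 1) * b x" for x
  define Q where "Q t x = (\<bar>a x + t * b x\<bar> powr p - \<bar>a x\<bar> powr p) / t" for t x
  define g where "g x = p * (\<bar>\<rho> x\<bar> * (\<bar>a x\<bar> + \<bar>b x\<bar>) powr p)" for x
  have g: "integrable M g" unfolding g_def using integrable_weighted_powr_sum[OF _ _ _ _ ia ib] p by simp
  have [measurable]: "Q t \<in> borel_measurable M" "D \<in> borel_measurable M" for t unfolding Q_def D_def by measurable
  have Qb: "\<bar>\<rho> x * Q t x\<bar> \<le> g x" if "\<bar>t\<bar> \<le> 1" for t x
  proof (cases "t = 0")
    case True
    then show ?thesis using p by (simp add: Q_def g_def)
  next
    case False
    have "\<bar>Q t x\<bar> \<le> p * (\<bar>a x\<bar> + \<bar>b x\<bar>) powr p"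
      using abs_powr_increment_le[OF p that, of "a x" "b x"] False by (simp add: Q_def field_simps)
    then have "\<bar>\<rho> x\<bar> * \<bar>Q t x\<bar> \<le> \<bar>\<rho> x\<bar> * (p * (\<bar>a x\<bar> + \<bar>b x\<bar>) powr p)" by (rule mult_left_mono) simp
    then show ?thesis by (simp add: g_def abs_mult ac_simps)
  qed
  have Qi: "integrable M (\<lambda>x. \<rho> x * Q t x)" if "\<bar>t\<bar> \<le> 1" for t
    by (rule Bochner_Integration.integrable_bound[OF g]) (use Qb[OF that] in \<open>auto simp: order_trans[OF _ abs_ge_self]\<close>)
  have QD: "((\<lambda>t. Q t x) \<longlongrightarrow> D x) (at 0)" for x
  proof -
    have "((\<lambda>t. \<bar>a x + t * b x\<bar> powr p) has_real_derivative (p * sgn (a x + 0 * b x) * \<bar>a x + 0 * b x\<bar> powr (p - 1)) * b x) (at 0)"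
      by (rule DERIV_chain2[OF has_real_derivative_abs_powr[OF p]]) (auto intro!: derivative_eq_intros)
    then show ?thesis by (simp add: has_field_derivative_iff Q_def D_def)
  qed
  have Qeq: "((\<integral>x. \<rho> x * \<bar>a x + t * b x\<bar> powr p \<partial>M) - (\<integral>x. \<rho> x * \<bar>a x\<bar> powr p \<partial>M)) / t = (\<integral>x. \<rho> x * Q t x \<partial>M)"
    if t: "\<bar>t\<bar> \<le> 1" "t \<noteq> 0" for t
  proof -
    have e: "\<rho> x * \<bar>a x + t * b x\<bar> powr p = \<rho> x * \<bar>a x\<bar> powr p + t * (\<rho> x * Q t x)" for x
      using t by (simp add: Q_def field_simps)
    show ?thesis unfolding e using ia Qi[OF t(1)] t by simp
  qed
  have lim: "(\<lambda>i. \<integral>x. \<rho> x * Q (X i) x \<partial>M) \<longlonglongrightarrow> (\<integral>x. \<rho> x * D x \<partial>M)"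
    if X: "\<And>i. X i \<noteq> 0" "\<And>i. \<bar>X i\<bar> \<le> 1" "X \<longlonglongrightarrow> 0" for X
  proof (rule integral_dominated_convergence[OF _ _ g])
    have "(\<lambda>i. Q (X i) x) \<longlonglongrightarrow> D x" for x
      using QD[of x] X(1,3) by (auto simp: tendsto_at_iff_sequentially comp_def)
    then show "AE x in M. (\<lambda>i. \<rho> x * Q (X i) x) \<longlonglongrightarrow> \<rho> x * D x" by (intro AE_I2 tendsto_intros)
    show "AE x in M. norm (\<rho> x * Q (X i) x) \<le> g x" for i using Qb[OF X(2)] by auto
  qed measurable
  have "((\<lambda>t. ((\<integral>x. \<rho> x * \<bar>a x + t * b x\<bar> powr p \<partial>M) - (\<integral>x. \<rho> x * \<bar>a x\<bar> powr p \<partial>M)) / t) \<longlongrightarrow> (\<integral>x. \<rho> x * D x \<partial>M)) (at 0)"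
    unfolding tendsto_at_iff_sequentially comp_def
  proof (intro allI impI)
    fix X :: "nat \<Rightarrow> real" assume X: "\<forall>i. X i \<in> UNIV - {0}" "X \<longlonglongrightarrow> 0"
    then have "\<forall>\<^sub>F i in sequentially. \<bar>X i\<bar> < 1" using tendsto_rabs[OF X(2)] by (intro order_tendstoD) auto
    then obtain N where N: "\<And>i. i \<ge> N \<Longrightarrow> \<bar>X i\<bar> < 1" by (auto simp: eventually_sequentially)
    have "(\<lambda>i. \<integral>x. \<rho> x * Q (X (i + N)) x \<partial>M) \<longlonglongrightarrow> (\<integral>x. \<rho> x * D x \<partial>M)"
      by (rule lim) (use X N LIMSEQ_ignore_initial_segment[OF X(2), of N] in \<open>auto intro: less_imp_le\<close>)
    then have "(\<lambda>i. ((\<integral>x. \<rho> x * \<bar>a x + X (i + N) * b x\<bar> powr p \<partial>M) - (\<integral>x. \<rho> x * \<bar>a x\<bar> powr p \<partial>M)) / X (i + N)) \<longlonglongrightarrow> (\<integral>x. \<rho> x * D x \<partial>M)"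
      using N X(1) by (subst Qeq) (auto intro: less_imp_le)
    then show "(\<lambda>i. ((\<integral>x. \<rho> x * \<bar>a x + X i * b x\<bar> powr p \<partial>M) - (\<integral>x. \<rho> x * \<bar>a x\<bar> powr p \<partial>M)) / X i) \<longlonglongrightarrow> (\<integral>x. \<rho> x * D x \<partial>M)"
      by (rule LIMSEQ_offset)
  qed
  then show "((\<lambda>t. \<integral>x. \<rho> x * \<bar>a x + t * b x\<bar> powr p \<partial>M) has_real_derivative
      (\<integral>x. \<rho> x * (p * sgn (a x) * \<bar>a x\<bar> powr (p - 1) * b x) \<partial>M)) (at 0)"
    by (simp add: has_field_derivative_iff D_def)
  have "\<bar>\<rho> x * D x\<bar> \<le> g x" for x
  proof -
    have nz: "(\<lambda>i. 1 / real (Suc i)) \<longlonglongrightarrow> 0" by (rule LIMSEQ_Suc[OF lim_1_over_n])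
    have l: "(\<lambda>i. \<rho> x * Q (1 / Suc i) x) \<longlonglongrightarrow> \<rho> x * D x"
      using QD[of x, unfolded tendsto_at_iff_sequentially comp_def, rule_format, of "\<lambda>i. 1 / real (Suc i)"]
        nz
      by (intro tendsto_mult_left) (simp add: field_simps)
    show ?thesis
      by (rule LIMSEQ_le_const2[OF tendsto_rabs[OF l]]) (use Qb in auto)
  qed
  then show "integrable M (\<lambda>x. \<rho> x * (p * sgn (a x) * \<bar>a x\<bar> powr (p - 1) * b x))"
    unfolding D_def[symmetric]
    by (intro Bochner_Integration.integrable_bound[OF g]) (auto simp: order_trans[OF _ abs_ge_self])
qed

section \<open>Submodularity and homogeneity of the energy\<close>

lemma convex_on_abs_powr:
  fixes p :: real
  assumes p: "p > 1"
  shows "convex_on UNIV (\<lambda>x::real. \<bar>x\<bar> powr p)"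
proof (rule convex_on_realI)
  fix x y :: real assume "x \<le> y"
  consider "0 \<le> x" | "y \<le> 0" | "x < 0" "0 < y" by linarith
  then have "sgn x * \<bar>x\<bar> powr (p - 1) \<le> sgn y * \<bar>y\<bar> powr (p - 1)"
  proof cases
    case 1
    then have "\<bar>x\<bar> powr (p - 1) \<le> \<bar>y\<bar> powr (p - 1)" using \<open>x \<le> y\<close> p by (intro powr_mono2) auto
    then show ?thesis using 1 \<open>x \<le> y\<close> by (auto simp: sgn_if)
  next
    case 2
    then have "\<bar>y\<bar> powr (p - 1) \<le> \<bar>x\<bar> powr (p - 1)" using \<open>x \<le> y\<close> p by (intro powr_mono2) auto
    then show ?thesis using 2 \<open>x \<le> y\<close> by (auto simp: sgn_if)
  next
    case 3
    then show ?thesis by (simp add: order_trans[of _ 0])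
  qed
  then have "p * (sgn x * \<bar>x\<bar> powr (p - 1)) \<le> p * (sgn y * \<bar>y\<bar> powr (p - 1))" using p by (intro mult_left_mono) auto
  then show "p * sgn x * \<bar>x\<bar> powr (p - 1) \<le> p * sgn y * \<bar>y\<bar> powr (p - 1)" by (simp add: mult.assoc)
qed (use has_real_derivative_abs_powr[OF p] in auto)

text \<open>
  \<open>P\<close> and \<open>Q\<close> lie between \<open>S\<close> and \<open>R\<close> and have the same sum, so that convexity applies.
\<close>

lemma abs_powr_majorization:
  fixes p P Q R S :: real
  assumes p: "p > 1" and "S \<le> P" "P \<le> R" and sum: "P + Q = R + S"
  shows "\<bar>P\<bar> powr p + \<bar>Q\<bar> powr p \<le> \<bar>R\<bar> powr p + \<bar>S\<bar> powr p"
proof (cases "R = S")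
  case True
  then have "P = R" "Q = S" using assms by auto
  then show ?thesis by simp
next
  case False
  then have RS: "R - S > 0" using assms by simp
  define t where "t = (P - S) / (R - S)"
  have t: "0 \<le> t" "t \<le> 1" using RS assms by (auto simp: t_def)
  have tRS: "t * (R - S) = P - S" using RS by (simp add: t_def)
  have P: "P = (1 - t) * S + t * R" using tRS by (simp add: algebra_simps)
  have Q: "Q = (1 - t) * R + t * S" using tRS sum by (simp add: algebra_simps)
  note c = convex_onD[OF convex_on_abs_powr[OF p] t]
  have "\<bar>P\<bar> powr p \<le> (1 - t) * \<bar>S\<bar> powr p + t * \<bar>R\<bar> powr p" using c[of S R] P by simp
  moreover have "\<bar>Q\<bar> powr p \<le> (1 - t) * \<bar>R\<bar> powr p + t * \<bar>S\<bar> powr p" using c[of R S] Q by simp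
  ultimately show ?thesis by (simp add: algebra_simps)
qed

lemma abs_powr_max_min_le:
  fixes p a b c d :: real
  assumes p: "p > 1"
  shows "\<bar>max a c - max b d\<bar> powr p + \<bar>min a c - min b d\<bar> powr p \<le> \<bar>a - b\<bar> powr p + \<bar>c - d\<bar> powr p"
proof -
  consider "a \<le> c" "b \<le> d" | "c \<le> a" "d \<le> b" | "c \<le> a" "b \<le> d" | "a \<le> c" "d \<le> b" by linarith
  then show ?thesis
  proof cases
    case 3
    then show ?thesis using abs_powr_majorization[OF p, of "c - d" "a - d" "a - b" "c - b"]
      by (simp add: max_absorb1 max_absorb2 min_absorb1 min_absorb2)
  next
    case 4
    then show ?thesis using abs_powr_majorization[OF p, of "a - b" "c - b" "c - d" "a - d"]
      by (simp add: max_absorb1 max_absorb2 min_absorb1 min_absorb2)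
  qed (auto simp: max_absorb1 max_absorb2 min_absorb1 min_absorb2)
qed

lemma zero_sobolev_max_min:
  fixes f g :: "'a::euclidean_space \<Rightarrow> real"
  assumes f: "f \<in> zero_sobolev s p \<Omega>" and g: "g \<in> zero_sobolev s p \<Omega>" and p: "p > 1"
  shows "(\<lambda>x. max (f x) (g x)) \<in> zero_sobolev s p \<Omega>" "(\<lambda>x. min (f x) (g x)) \<in> zero_sobolev s p \<Omega>"
    "energy s p (\<lambda>x. max (f x) (g x)) + energy s p (\<lambda>x. min (f x) (g x)) \<le> energy s p f + energy s p g"
proof -
  note F = zero_sobolevD[OF f] and G = zero_sobolevD[OF g]
  note [measurable] = F(1) G(1)
  let ?M = "\<lambda>x. max (f x) (g x)" and ?m = "\<lambda>x. min (f x) (g x)"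
  have Mm[measurable]: "?M \<in> borel_measurable lebesgue" "?m \<in> borel_measurable lebesgue" by measurable
  have pw: "\<bar>gap ?M z\<bar> powr p + \<bar>gap ?m z\<bar> powr p \<le> \<bar>gap f z\<bar> powr p + \<bar>gap g z\<bar> powr p" for z
    unfolding gap_def by (rule abs_powr_max_min_le[OF p])
  have fg: "integrable (kernel_measure s p) (\<lambda>z. \<bar>gap f z\<bar> powr p + \<bar>gap g z\<bar> powr p)" using F(4) G(4) by simp
  have nn: "0 \<le> \<bar>gap h z\<bar> powr p" for h and z :: "'a \<times> 'a" by simp
  have iM: "integrable (kernel_measure s p) (\<lambda>z. \<bar>gap ?M z\<bar> powr p)"
  proof (rule Bochner_Integration.integrable_bound[OF fg])
    show "(\<lambda>z. \<bar>gap ?M z\<bar> powr p) \<in> borel_measurable (kernel_measure s p)" using gap_measurable[OF Mm(1)] by measurable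
    have "\<bar>gap ?M z\<bar> powr p \<le> \<bar>gap f z\<bar> powr p + \<bar>gap g z\<bar> powr p" for z using pw[of z] nn[of ?m z] by linarith
    then show "AE z in kernel_measure s p. norm (\<bar>gap ?M z\<bar> powr p) \<le> norm (\<bar>gap f z\<bar> powr p + \<bar>gap g z\<bar> powr p)" by auto
  qed
  have im: "integrable (kernel_measure s p) (\<lambda>z. \<bar>gap ?m z\<bar> powr p)"
  proof (rule Bochner_Integration.integrable_bound[OF fg])
    show "(\<lambda>z. \<bar>gap ?m z\<bar> powr p) \<in> borel_measurable (kernel_measure s p)" using gap_measurable[OF Mm(2)] by measurable
    have "\<bar>gap ?m z\<bar> powr p \<le> \<bar>gap f z\<bar> powr p + \<bar>gap g z\<bar> powr p" for z using pw[of z] nn[of ?M z] by linarith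
    then show "AE z in kernel_measure s p. norm (\<bar>gap ?m z\<bar> powr p) \<le> norm (\<bar>gap f z\<bar> powr p + \<bar>gap g z\<bar> powr p)" by auto
  qed
  have fgL: "integrable lebesgue (\<lambda>x. \<bar>f x\<bar> powr p + \<bar>g x\<bar> powr p)" using F(3) G(3) by simp
  have "integrable lebesgue (\<lambda>x. \<bar>?M x\<bar> powr p)"
    by (rule Bochner_Integration.integrable_bound[OF fgL]) (auto simp: max_def)
  moreover have "integrable lebesgue (\<lambda>x. \<bar>?m x\<bar> powr p)"
    by (rule Bochner_Integration.integrable_bound[OF fgL]) (auto simp: min_def)
  ultimately show "?M \<in> zero_sobolev s p \<Omega>" "?m \<in> zero_sobolev s p \<Omega>"
    using Mm iM im F(2) G(2) by (auto simp: zero_sobolev_iff)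
  have "(\<integral>z. \<bar>gap ?M z\<bar> powr p + \<bar>gap ?m z\<bar> powr p \<partial>kernel_measure s p) \<le> (\<integral>z. \<bar>gap f z\<bar> powr p + \<bar>gap g z\<bar> powr p \<partial>kernel_measure s p)"
    using iM im fg pw by (intro integral_mono) auto
  then show "energy s p ?M + energy s p ?m \<le> energy s p f + energy s p g"
    using iM im F(4) G(4) by (simp add: energy_eq[OF Mm(1)] energy_eq[OF Mm(2)] energy_eq[OF F(1)] energy_eq[OF G(1)])
qed

lemma zero_sobolev_abs:
  fixes u :: "'a::euclidean_space \<Rightarrow> real"
  assumes u: "u \<in> zero_sobolev s p \<Omega>" and p: "p > 1"
  shows "(\<lambda>x. \<bar>u x\<bar>) \<in> zero_sobolev s p \<Omega>" "energy s p (\<lambda>x. \<bar>u x\<bar>) \<le> energy s p u"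
proof -
  note U = zero_sobolevD[OF u]
  note [measurable] = U(1)
  let ?a = "\<lambda>x. \<bar>u x\<bar>"
  have am[measurable]: "?a \<in> borel_measurable lebesgue" by measurable
  have pw: "\<bar>gap ?a z\<bar> powr p \<le> \<bar>gap u z\<bar> powr p" for z
    unfolding gap_def using p by (intro powr_mono2) auto
  have i: "integrable (kernel_measure s p) (\<lambda>z. \<bar>gap ?a z\<bar> powr p)"
  proof (rule Bochner_Integration.integrable_bound[OF U(4)])
    show "(\<lambda>z. \<bar>gap ?a z\<bar> powr p) \<in> borel_measurable (kernel_measure s p)" using gap_measurable[OF am] by measurable
  qed (use pw in auto)
  then show "?a \<in> zero_sobolev s p \<Omega>" using am U by (auto simp: zero_sobolev_iff)
  show "energy s p ?a \<le> energy s p u"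
    unfolding energy_eq[OF am] energy_eq[OF U(1)] using i U(4) pw by (rule integral_mono)
qed

lemma energy_scale:
  assumes "u \<in> borel_measurable lebesgue"
  shows "energy s p (\<lambda>x. c * u x) = \<bar>c\<bar> powr p * energy s p u"
proof -
  have cu: "(\<lambda>x. c * u x) \<in> borel_measurable lebesgue" using assms by measurable
  have "gap (\<lambda>x. c * u x) z = c * gap u z" for z by (simp add: gap_def algebra_simps)
  then show ?thesis unfolding energy_eq[OF assms] energy_eq[OF cu] by (simp add: abs_mult powr_mult)
qed

section \<open>Euler-Lagrange equation and uniqueness of the maximal potential\<close>

context fractional_eigenvalue_problem
begin

lemma X_scale: "w \<in> X \<Longrightarrow> (\<lambda>x. c * w x) \<in> X"
  using zero_sobolev_lincomb[of w s p \<Omega> w c 0] p by simp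

lemma J_scale:
  assumes "w \<in> X" shows "J Z (\<lambda>x. c * w x) = \<bar>c\<bar> powr p * J Z w"
proof -
  have "(\<integral>x. Z x * \<bar>c * w x\<bar> powr p \<partial>lebesgue) = (\<integral>x. \<bar>c\<bar> powr p * (Z x * \<bar>w x\<bar> powr p) \<partial>lebesgue)"
    by (intro Bochner_Integration.integral_cong) (auto simp: abs_mult powr_mult)
  also have "\<dots> = \<bar>c\<bar> powr p * (\<integral>x. Z x * \<bar>w x\<bar> powr p \<partial>lebesgue)" by (rule integral_mult_right_zero)
  finally show ?thesis
    by (simp add: total_energy_def energy_scale[OF zero_sobolevD(1)[OF assms]] algebra_simps)
qed

lemma normalize_X1:
  assumes w: "w \<in> X" and c: "c = (\<integral>x. \<bar>w x\<bar> powr p \<partial>lebesgue)" "c > 0"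
  shows "(\<lambda>x. c powr (- 1 / p) * w x) \<in> X1"
proof -
  have "(c powr (- 1 / p)) powr p = c powr (- 1 / p * p)" by (simp only: powr_powr)
  then have "(c powr (- 1 / p)) powr p = 1 / c" using p c by (simp add: powr_minus_divide)
  then have "(\<integral>x. \<bar>c powr (- 1 / p) * w x\<bar> powr p \<partial>lebesgue) = 1"
    using c by (simp add: abs_mult powr_mult)
  then show ?thesis using X_scale[OF w] by simp
qed

text \<open>
  Homogeneity removes the constraint: the least value on \<open>X1\<close> becomes a lower bound on all of
  \<open>X\<close>.
\<close>

lemma J_ge_of_min:
  assumes min: "\<forall>v\<in>X1. l \<le> J V v" and w: "w \<in> X"
  shows "l * (\<integral>x. \<bar>w x\<bar> powr p \<partial>lebesgue) \<le> J V w"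
proof -
  define c where "c = (\<integral>x. \<bar>w x\<bar> powr p \<partial>lebesgue)"
  note W = zero_sobolevD[OF w]
  note [measurable] = W(1)
  show ?thesis
  proof (cases "c = 0")
    case True
    then have ae: "AE x in lebesgue. w x = 0"
      using integral_nonneg_eq_0_iff_AE[OF W(3)] by (auto simp: c_def elim: eventually_mono)
    then have "AE z in kernel_measure s p. gap w z = 0"
      by (auto simp: gap_def dest!: AE_lebesgue_pair AE_kernel_measure elim!: eventually_mono)
    then have "AE z in kernel_measure s p. \<bar>gap w z\<bar> powr p = 0" by (auto elim: eventually_mono)
    then have "energy s p w = 0" unfolding energy_eq[OF W(1)] by (rule integral_eq_zero_AE)
    moreover have "AE x in lebesgue. V x * \<bar>w x\<bar> powr p = 0" using ae by (auto elim: eventually_mono)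
    then have "(\<integral>x. V x * \<bar>w x\<bar> powr p \<partial>lebesgue) = 0" by (rule integral_eq_zero_AE)
    ultimately show ?thesis using True by (simp add: total_energy_def c_def)
  next
    case False
    then have c: "c > 0" by (simp add: c_def order_less_le)
    have "(c powr (- 1 / p)) powr p = c powr (- 1 / p * p)" by (simp only: powr_powr)
    then have cp: "(c powr (- 1 / p)) powr p = 1 / c" using p c by (simp add: powr_minus_divide)
    have "l \<le> J V (\<lambda>x. c powr (- 1 / p) * w x)" using min normalize_X1[OF w c_def c] by blast
    also have "\<dots> = J V w / c" using J_scale[OF w, of V "c powr (- 1 / p)"] cp by simp
    finally show ?thesis using c by (simp add: c_def[symmetric] field_simps)
  qed
qed

lemma J_max_min:
  assumes f: "f \<in> X" and g: "g \<in> X" and Z: "Z \<in> potentials q \<Omega>"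
  shows "J Z (\<lambda>x. max (f x) (g x)) + J Z (\<lambda>x. min (f x) (g x)) \<le> J Z f + J Z g"
proof -
  note mm = zero_sobolev_max_min[OF f g p]
  note int = potential_integrable[OF _ Z]
  have "(\<integral>x. Z x * \<bar>max (f x) (g x)\<bar> powr p \<partial>lebesgue) + (\<integral>x. Z x * \<bar>min (f x) (g x)\<bar> powr p \<partial>lebesgue)
    = (\<integral>x. Z x * \<bar>max (f x) (g x)\<bar> powr p + Z x * \<bar>min (f x) (g x)\<bar> powr p \<partial>lebesgue)"
    using int[OF mm(1)] int[OF mm(2)] by simp
  also have "\<dots> = (\<integral>x. Z x * \<bar>f x\<bar> powr p + Z x * \<bar>g x\<bar> powr p \<partial>lebesgue)"
    by (intro Bochner_Integration.integral_cong) (auto simp: max_def min_def)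
  also have "\<dots> = (\<integral>x. Z x * \<bar>f x\<bar> powr p \<partial>lebesgue) + (\<integral>x. Z x * \<bar>g x\<bar> powr p \<partial>lebesgue)"
    using int[OF f] int[OF g] by simp
  finally show ?thesis using mm(3) by (simp add: total_energy_def)
qed

text \<open>
  The derivative of \<open>t \<mapsto> J Z (u + t w)\<close> vanishes at its minimum \<open>t = 0\<close>. The eigenvalue is
  absorbed into the potential \<open>Z\<close>.
\<close>

lemma euler_lagrange:
  assumes u: "u \<in> X" and w: "w \<in> X" and Z: "Z \<in> potentials q \<Omega>"
    and J0: "J Z u = 0" and J: "\<forall>v\<in>X. 0 \<le> J Z v"
  shows "1/2 * (\<integral>z. p * sgn (gap u z) * \<bar>gap u z\<bar> powr (p - 1) * gap w z \<partial>kernel_measure s p)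
     + (\<integral>x. Z x * (p * sgn (u x) * \<bar>u x\<bar> powr (p - 1) * w x) \<partial>lebesgue) = 0"
proof -
  note U = zero_sobolevD[OF u] and W = zero_sobolevD[OF w]
  note [measurable] = U(1) W(1) potentialsD(1)[OF Z]
  have 1: "((\<lambda>t. \<integral>z. 1 * \<bar>gap u z + t * gap w z\<bar> powr p \<partial>kernel_measure s p) has_real_derivative
      (\<integral>z. 1 * (p * sgn (gap u z) * \<bar>gap u z\<bar> powr (p - 1) * gap w z) \<partial>kernel_measure s p)) (at 0)"
    using U(4) W(4) gap_measurable[OF U(1)] gap_measurable[OF W(1)]
    by (intro has_real_derivative_integral_powr(1)[OF p]) auto
  have 2: "((\<lambda>t. \<integral>x. Z x * \<bar>u x + t * w x\<bar> powr p \<partial>lebesgue) has_real_derivative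
      (\<integral>x. Z x * (p * sgn (u x) * \<bar>u x\<bar> powr (p - 1) * w x) \<partial>lebesgue)) (at 0)"
    using potential_integrable[OF u Z] potential_integrable[OF w Z]
    by (intro has_real_derivative_integral_powr(1)[OF p]) auto
  have uw: "(\<lambda>x. u x + t * w x) \<in> X" for t
    using zero_sobolev_lincomb[OF u w, of 1 t] p by simp
  have Jeq: "J Z (\<lambda>x. u x + t * w x) = 1/2 * (\<integral>z. 1 * \<bar>gap u z + t * gap w z\<bar> powr p \<partial>kernel_measure s p)
     + (\<integral>x. Z x * \<bar>u x + t * w x\<bar> powr p \<partial>lebesgue)" for t
  proof -
    have "gap (\<lambda>x. u x + t * w x) z = gap u z + t * gap w z" for z by (simp add: gap_def algebra_simps)
    then show ?thesis by (simp add: total_energy_def energy_eq[OF zero_sobolevD(1)[OF uw]])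
  qed
  have "((\<lambda>t. J Z (\<lambda>x. u x + t * w x)) has_real_derivative
     1/2 * (\<integral>z. 1 * (p * sgn (gap u z) * \<bar>gap u z\<bar> powr (p - 1) * gap w z) \<partial>kernel_measure s p)
     + (\<integral>x. Z x * (p * sgn (u x) * \<bar>u x\<bar> powr (p - 1) * w x) \<partial>lebesgue)) (at 0)"
    unfolding Jeq by (intro DERIV_add DERIV_cmult 1 2)
  from DERIV_local_min[OF this zero_less_one] J uw J0 show ?thesis by simp
qed

text \<open>
  The distance to the complement of \<open>\<Omega>\<close>: a Lipschitz function that is positive exactly on
  \<open>\<Omega>\<close>, and the model for all test functions below.
\<close>

definition dom_dist :: "'a \<Rightarrow> real" where "dom_dist x = infdist x (- \<Omega>)"

lemma complement_nonempty: "- \<Omega> \<noteq> {}"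
proof
  assume "- \<Omega> = {}"
  then have "\<Omega> = UNIV" by auto
  then show False using bounded_dom not_bounded_UNIV by simp
qed

lemma dom_dist_pos: "x \<in> \<Omega> \<Longrightarrow> dom_dist x > 0"
  using in_closed_iff_infdist_zero[of "- \<Omega>" x] open_dom complement_nonempty infdist_nonneg[of x "- \<Omega>"]
  by (auto simp: dom_dist_def order_less_le)

lemma dom_dist_zero: "x \<notin> \<Omega> \<Longrightarrow> dom_dist x = 0"
  by (simp add: dom_dist_def)

lemma dom_dist_nonneg: "dom_dist x \<ge> 0"
  by (simp add: dom_dist_def infdist_nonneg)

lemma test_function:
  assumes c: "c \<ge> 0"
  shows "(\<lambda>x. max 0 (dom_dist x - c * infdist x K)) \<in> X"
proof -
  obtain y where y: "y \<notin> \<Omega>" using complement_nonempty by auto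
  obtain R where R: "\<And>x. x \<in> \<Omega> \<Longrightarrow> norm x \<le> R" using bounded_dom by (auto simp: bounded_iff)
  define S where "S = \<bar>R\<bar> + norm y"
  have dS: "dom_dist x \<le> S" for x
  proof (cases "x \<in> \<Omega>")
    case True
    have "dom_dist x \<le> dist x y" unfolding dom_dist_def using y by (intro infdist_le) auto
    also have "\<dots> \<le> norm x + norm y" by (simp add: dist_norm norm_triangle_ineq4)
    finally show ?thesis using R[OF True] by (simp add: S_def)
  qed (simp add: dom_dist_zero S_def)
  show ?thesis
  proof (rule Lipschitz_zero_sobolev[OF s p dom_lmeasurable, where L="1 + c" and S=S])
    fix x y
    have "\<bar>infdist x K - infdist y K\<bar> \<le> norm (x - y)" "\<bar>dom_dist x - dom_dist y\<bar> \<le> norm (x - y)"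
      using infdist_triangle_abs[of x K y] infdist_triangle_abs[of x "- \<Omega>" y] by (auto simp: dom_dist_def dist_norm)
    moreover have "\<bar>c * infdist x K - c * infdist y K\<bar> \<le> c * norm (x - y)"
      using calculation(1) c by (simp add: right_diff_distrib[symmetric] abs_mult mult_left_mono)
    moreover have "\<bar>max 0 a - max 0 b\<bar> \<le> \<bar>a - b\<bar>" for a b :: real by (simp add: max_def)
    note this[of "dom_dist x - c * infdist x K" "dom_dist y - c * infdist y K"]
    ultimately show "\<bar>max 0 (dom_dist x - c * infdist x K) - max 0 (dom_dist y - c * infdist y K)\<bar> \<le> (1 + c) * norm (x - y)"
      unfolding distrib_right by linarith
  next
    fix x
    have "c * infdist x K \<ge> 0" using c by (simp add: infdist_nonneg)
    then show "\<bar>max 0 (dom_dist x - c * infdist x K)\<bar> \<le> S" "x \<notin> \<Omega> \<Longrightarrow> max 0 (dom_dist x - c * infdist x K) = 0"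
      using dS[of x] dom_dist_nonneg[of x] dom_dist_zero[of x] by (auto simp: max_def)
  qed
qed

lemma dom_dist_X: "dom_dist \<in> X"
  using test_function[of 0 "{}"] dom_dist_nonneg by (simp add: max_absorb2)

lemma X1_nonempty:
  assumes "\<Omega> \<noteq> {}" shows "X1 \<noteq> {}"
proof -
  define c where "c = (\<integral>x. \<bar>dom_dist x\<bar> powr p \<partial>lebesgue)"
  note D = zero_sobolevD[OF dom_dist_X]
  have "c \<noteq> 0"
  proof
    assume "c = 0"
    then have "AE x in lebesgue. dom_dist x = 0"
      using integral_nonneg_eq_0_iff_AE[OF D(3)] by (auto simp: c_def elim: eventually_mono)
    then have "AE x in lebesgue. x \<notin> \<Omega>" by (auto elim!: eventually_mono dest: dom_dist_pos)
    then have "\<Omega> \<in> null_sets lebesgue" by (simp add: AE_iff_null_sets)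
    then show False using open_dom assms open_not_negligible negligible_iff_null_sets by blast
  qed
  then have "c > 0" by (simp add: c_def order_less_le)
  then show ?thesis using normalize_X1[OF dom_dist_X c_def] by blast
qed

text \<open>
  If \<open>f > 0\<close> on a set of positive measure, then also on a closed subset \<open>K\<close> of positive measure.
  The test functions \<open>max 0 (\<phi> - m d\<^sub>K)\<close>, with \<open>\<phi>\<close> and \<open>d\<^sub>K\<close> the distances to the complement
  of \<open>\<Omega>\<close> and to \<open>K\<close>, tend to \<open>\<phi>\<close> on \<open>K\<close> and to \<open>0\<close> elsewhere, so that \<open>\<integral>\<^sub>K f \<phi> = 0\<close>, which is
  impossible.
\<close>

lemma AE_nonpos_of_test_integrals:
  assumes fm[measurable]: "f \<in> borel_measurable lebesgue"
    and f: "\<forall>w\<in>X. integrable lebesgue (\<lambda>x. f x * w x) \<and> (\<integral>x. f x * w x \<partial>lebesgue) = 0"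
  shows "AE x in lebesgue. x \<in> \<Omega> \<longrightarrow> f x \<le> 0"
proof -
  define A where "A = {x \<in> \<Omega>. f x > 0}"
  have A[measurable]: "A \<in> sets lebesgue" unfolding A_def by measurable
  have Al: "A \<in> lmeasurable" by (rule bounded_set_imp_lmeasurable[OF bounded_subset[OF bounded_dom] A]) (auto simp: A_def)
  have "measure lebesgue A = 0"
  proof (rule ccontr)
    assume "measure lebesgue A \<noteq> 0"
    then have mA: "measure lebesgue A > 0" by (simp add: order_less_le)
    obtain K where K: "closed K" "K \<subseteq> A" "A - K \<in> lmeasurable" "emeasure lebesgue (A - K) < ennreal (measure lebesgue A)"
      using sets_lebesgue_inner_closed[OF A mA] by blast
    have Ks[measurable]: "K \<in> sets lebesgue" using K(1) by (simp add: borel_closed)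
    have mAK: "measure lebesgue (A - K) < measure lebesgue A"
      using K(3,4) mA by (simp add: emeasure_eq_measure2 ennreal_less_iff)
    then have K0: "K \<noteq> {}" by auto
    define w where "w m x = max 0 (dom_dist x - real m * infdist x K)" for m :: nat and x
    have wX: "w m \<in> X" for m unfolding w_def by (rule test_function) simp
    have wle: "\<bar>w m x\<bar> \<le> dom_dist x" for m x
      using infdist_nonneg[of x K] dom_dist_nonneg[of x] by (auto simp: w_def)
    have dm: "dom_dist \<in> borel_measurable lebesgue" using zero_sobolevD(1)[OF dom_dist_X] .
    note [measurable] = zero_sobolevD(1)[OF wX] dm
    have lim: "(\<lambda>m. w m x) \<longlonglongrightarrow> dom_dist x * indicator K x" for x
    proof (cases "x \<in> K")
      case True
      then show ?thesis using dom_dist_nonneg[of x] by (simp add: w_def max_absorb2)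
    next
      case False
      then have i: "infdist x K > 0" using in_closed_iff_infdist_zero[OF K(1) K0, of x] infdist_nonneg[of x K] by (simp add: order_less_le)
      obtain N :: nat where N: "dom_dist x / infdist x K \<le> real N" using real_arch_simple by blast
      have "w m x = 0" if "m \<ge> N" for m
      proof -
        have "dom_dist x \<le> real N * infdist x K" using N i by (simp add: field_simps)
        also have "\<dots> \<le> real m * infdist x K" using that i by (intro mult_right_mono) auto
        finally show ?thesis by (simp add: w_def)
      qed
      then have "\<forall>\<^sub>F m in sequentially. w m x = 0" by (auto simp: eventually_sequentially)
      then show ?thesis using False by (simp add: tendsto_eventually)
    qed
    have "(\<lambda>m. \<integral>x. f x * w m x \<partial>lebesgue) \<longlonglongrightarrow> (\<integral>x. f x * (dom_dist x * indicator K x) \<partial>lebesgue)"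
    proof (rule integral_dominated_convergence[where w="\<lambda>x. norm (f x * dom_dist x)"])
      show "integrable lebesgue (\<lambda>x. norm (f x * dom_dist x))" using f dom_dist_X by (intro integrable_norm) auto
      show "AE x in lebesgue. (\<lambda>m. f x * w m x) \<longlonglongrightarrow> f x * (dom_dist x * indicator K x)" by (intro AE_I2 tendsto_mult_left lim)
      show "AE x in lebesgue. norm (f x * w m x) \<le> norm (f x * dom_dist x)" for m
        using wle dom_dist_nonneg by (auto simp: abs_mult intro!: mult_left_mono)
    qed measurable
    moreover have "(\<integral>x. f x * w m x \<partial>lebesgue) = 0" for m using f wX by blast
    ultimately have I0: "(\<integral>x. f x * (dom_dist x * indicator K x) \<partial>lebesgue) = 0" by (simp add: LIMSEQ_const_iff)
    have "integrable lebesgue (\<lambda>x. (f x * dom_dist x) * indicator K x)"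
      using f dom_dist_X by (intro integrable_real_mult_indicator) auto
    then have int: "integrable lebesgue (\<lambda>x. f x * (dom_dist x * indicator K x))" by (simp add: mult.assoc)
    have "0 \<le> f x * (dom_dist x * indicator K x)" for x
    proof (cases "x \<in> K")
      case True
      then have "f x > 0" using K(2) by (auto simp: A_def)
      then show ?thesis using dom_dist_nonneg[of x] by (intro mult_nonneg_nonneg) auto
    qed simp
    then have "AE x in lebesgue. f x * (dom_dist x * indicator K x) = 0"
      using I0 integral_nonneg_eq_0_iff_AE[OF int] by blast
    then have "AE x in lebesgue. x \<notin> K"
    proof eventually_elim
      case (elim x)
      show ?case
      proof
        assume x: "x \<in> K"
        then have "f x > 0" "dom_dist x > 0" using K(2) dom_dist_pos by (auto simp: A_def)
        then show False using elim x by simp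
      qed
    qed
    then have "K \<in> null_sets lebesgue" using AE_iff_null_sets[OF Ks] by blast
    then have "measure lebesgue K = 0" by (rule measure_eq_0_null_sets)
    moreover have "measure lebesgue (A - K) = measure lebesgue A - measure lebesgue K"
      using Al K(2) Ks by (intro measurable_measure_Diff) auto
    ultimately show False using mAK by simp
  qed
  then have "A \<in> null_sets lebesgue" using negligible_iff_measure0[OF Al] negligible_iff_null_sets by blast
  then have "AE x in lebesgue. x \<notin> A" by (rule AE_not_in)
  then show ?thesis by (auto simp: A_def elim!: eventually_mono)
qed

text \<open>
  A strong minimum principle; no connectedness of \<open>\<Omega>\<close> is needed, because the operator is
  nonlocal.
\<close>

lemma minimizer_positive:
  assumes u: "u \<in> X" and u0: "\<And>x. u x \<ge> 0" and nz: "(\<integral>x. \<bar>u x\<bar> powr p \<partial>lebesgue) \<noteq> 0"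
    and Z: "Z \<in> potentials q \<Omega>" and J0: "J Z u = 0" and J: "\<forall>v\<in>X. 0 \<le> J Z v"
  shows "AE x in lebesgue. x \<in> \<Omega> \<longrightarrow> u x > 0"
proof -
  note U = zero_sobolevD[OF u] and \<phi> = zero_sobolevD[OF dom_dist_X]
  note [measurable] = U(1) \<phi>(1) potentialsD(1)[OF Z]
  define w where "w m x = min (real (Suc m) * u x) (dom_dist x)" for m x
  have mu: "(\<lambda>x. real (Suc m) * u x) \<in> X" for m by (rule X_scale[OF u])
  have wX: "w m \<in> X" for m unfolding w_def by (rule zero_sobolev_max_min(2)[OF mu dom_dist_X p])
  have wb: "0 \<le> w m x" "w m x \<le> dom_dist x" for m x
    using u0[of x] dom_dist_nonneg[of x] by (auto simp: w_def)
  \<comment> \<open>all multiples of \<open>u\<close> have \<open>J Z = 0\<close>, the minimal value\<close>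
  have Jw: "J Z (w m) \<le> J Z dom_dist" for m
  proof -
    have "J Z (\<lambda>x. max (real (Suc m) * u x) (dom_dist x)) + J Z (w m) \<le> J Z (\<lambda>x. real (Suc m) * u x) + J Z dom_dist"
      unfolding w_def by (rule J_max_min[OF mu dom_dist_X Z])
    moreover have "J Z (\<lambda>x. real (Suc m) * u x) = 0" using J_scale[OF u] J0 by simp
    moreover have "0 \<le> J Z (\<lambda>x. max (real (Suc m) * u x) (dom_dist x))"
      using J zero_sobolev_max_min(1)[OF mu dom_dist_X p] by blast
    ultimately show ?thesis by linarith
  qed
  define M where "M = 2 * (J Z dom_dist + (\<integral>x. \<bar>Z x\<bar> * \<bar>dom_dist x\<bar> powr p \<partial>lebesgue))"
  have Ew: "\<E> (w m) \<le> M" for m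
  proof -
    have "- (\<integral>x. Z x * \<bar>w m x\<bar> powr p \<partial>lebesgue) \<le> (\<integral>x. \<bar>Z x * \<bar>w m x\<bar> powr p\<bar> \<partial>lebesgue)"
      using integral_abs_bound[of lebesgue "\<lambda>x. Z x * \<bar>w m x\<bar> powr p"] by linarith
    also have "\<dots> \<le> (\<integral>x. \<bar>Z x\<bar> * \<bar>dom_dist x\<bar> powr p \<partial>lebesgue)"
    proof (rule integral_mono)
      show "\<bar>Z x * \<bar>w m x\<bar> powr p\<bar> \<le> \<bar>Z x\<bar> * \<bar>dom_dist x\<bar> powr p" for x
        using wb[of m x] p by (auto simp: abs_mult intro!: mult_left_mono powr_mono2)
    qed (use potential_integrable[OF wX Z] abs_potential_integrable[OF dom_dist_X Z] in auto)
    finally show ?thesis using Jw[of m] by (simp add: total_energy_def M_def)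
  qed
  \<comment> \<open>the restriction of \<^const>\<open>dom_dist\<close> to \<open>{u > 0}\<close>, the limit of \<open>w m\<close>\<close>
  define cut where "cut x = (if u x > 0 then dom_dist x else 0)" for x
  have cutm[measurable]: "cut \<in> borel_measurable lebesgue" unfolding cut_def by measurable
  have lim: "(\<lambda>m. w m x) \<longlonglongrightarrow> cut x" for x
  proof (cases "u x > 0")
    case False
    then have "u x = 0" using u0[of x] by simp
    then show ?thesis using dom_dist_nonneg[of x] by (simp add: w_def cut_def)
  next
    case True
    obtain N :: nat where N: "dom_dist x / u x \<le> real N" using real_arch_simple by blast
    have "w m x = cut x" if "m \<ge> N" for m
    proof -
      have "dom_dist x \<le> real N * u x" using N True by (simp add: field_simps)
      also have "\<dots> \<le> real (Suc m) * u x" using that True by (intro mult_right_mono) auto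
      finally show ?thesis using True by (simp add: w_def cut_def)
    qed
    then have "\<forall>\<^sub>F m in sequentially. w m x = cut x" by (auto simp: eventually_sequentially)
    then show ?thesis by (rule tendsto_eventually)
  qed
  have cutX: "cut \<in> X"
  proof -
    have "gagliardo_integral s p UNIV cut \<le> liminf (\<lambda>m. gagliardo_integral s p UNIV (w m))"
      by (rule gagliardo_lower_semicontinuous[OF _ zero_sobolevD(1)[OF wX] cutm]) (use p lim in auto)
    also have "\<dots> \<le> ennreal M"
      by (rule Liminf_le) (use Ew in \<open>auto simp: gagliardo_eq_energy[OF wX] intro!: always_eventually ennreal_leI\<close>)
    finally have "gagliardo_integral s p UNIV cut < \<infinity>" by (simp add: order_le_less_trans)
    moreover have "integrable lebesgue (\<lambda>x. \<bar>cut x\<bar> powr p)"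
      by (rule Bochner_Integration.integrable_bound[OF \<phi>(3)]) (auto simp: cut_def)
    moreover have "cut x = 0" if "x \<notin> \<Omega>" for x using dom_dist_zero[OF that] by (simp add: cut_def)
    ultimately show ?thesis by (auto simp: zero_sobolev_def)
  qed
  \<comment> \<open>the restriction of \<^const>\<open>dom_dist\<close> to \<open>{u = 0}\<close>\<close>
  define \<psi> where "\<psi> x = dom_dist x - cut x" for x
  have \<psi>X: "\<psi> \<in> X" using zero_sobolev_lincomb[OF dom_dist_X cutX, of 1 "-1"] p by (simp add: \<psi>_def[abs_def])
  note [measurable] = zero_sobolevD(1)[OF \<psi>X]
  have \<psi>0: "\<psi> x \<ge> 0" "u x > 0 \<Longrightarrow> \<psi> x = 0" "\<not> u x > 0 \<Longrightarrow> \<psi> x = dom_dist x" for x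
    using dom_dist_nonneg[of x] by (auto simp: \<psi>_def cut_def)
  \<comment> \<open>the integrand of the first term of the Euler-Lagrange equation for \<open>u\<close> with test function \<open>\<psi>\<close>\<close>
  define g where "g z = p * sgn (gap u z) * \<bar>gap u z\<bar> powr (p - 1) * gap \<psi> z" for z
  have g_int: "integrable (kernel_measure s p) g"
    using has_real_derivative_integral_powr(2)[OF p gap_measurable[OF U(1)] gap_measurable[OF zero_sobolevD(1)[OF \<psi>X]], of "\<lambda>z. 1" s p]
      U(4) zero_sobolevD(4)[OF \<psi>X] by (simp add: g_def[abs_def])
  have pot0: "Z x * (p * sgn (u x) * \<bar>u x\<bar> powr (p - 1) * \<psi> x) = 0" for x
    using u0[of x] \<psi>0(2)[of x] by (cases "u x > 0") auto
  have g0: "(\<integral>z. g z \<partial>kernel_measure s p) = 0"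
    using euler_lagrange[OF u \<psi>X Z J0 J] unfolding pot0 by (simp add: g_def)
  have g_neg: "g z \<le> 0" for z
  proof -
    obtain x y where z: "z = (x, y)" by (cases z)
    have "sgn (u x - u y) * (\<psi> x - \<psi> y) \<le> 0"
      using \<psi>0[of x] \<psi>0[of y] u0[of x] u0[of y] by (cases "u x > 0"; cases "u y > 0") (auto simp: sgn_if)
    moreover have "0 \<le> p * \<bar>u x - u y\<bar> powr (p - 1)" using p by simp
    ultimately have "(p * \<bar>u x - u y\<bar> powr (p - 1)) * (sgn (u x - u y) * (\<psi> x - \<psi> y)) \<le> 0"
      by (rule mult_nonneg_nonpos[rotated])
    also have "(p * \<bar>u x - u y\<bar> powr (p - 1)) * (sgn (u x - u y) * (\<psi> x - \<psi> y)) = g z"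
      by (simp only: g_def gap_def z fst_conv snd_conv ac_simps)
    finally show ?thesis .
  qed
  have "AE z in kernel_measure s p. - g z = 0"
    using g_int g0 g_neg by (subst integral_nonneg_eq_0_iff_AE[symmetric]) auto
  then have "AE z in kernel_measure s p. \<not> (\<psi> (fst z) > 0 \<and> u (snd z) > 0)"
  proof eventually_elim
    case (elim z)
    show ?case
    proof
      assume "\<psi> (fst z) > 0 \<and> u (snd z) > 0"
      moreover then have "u (fst z) = 0" "\<psi> (snd z) = 0"
        using \<psi>0(2)[of "fst z"] \<psi>0(2)[of "snd z"] u0[of "fst z"] by (auto simp: order_less_le)
      ultimately have "g z = - (p * u (snd z) powr (p - 1) * \<psi> (fst z))" "u (snd z) > 0" "\<psi> (fst z) > 0"
        by (simp_all add: g_def gap_def)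
      then show False using elim p by simp
    qed
  qed
  moreover have "(\<lambda>z::'a\<times>'a. ennreal (1 / norm (fst z - snd z) powr (real DIM('a) + s * p))) \<in> borel_measurable (lebesgue \<Otimes>\<^sub>M lebesgue)"
    by measurable
  ultimately have "AE z in lebesgue \<Otimes>\<^sub>M lebesgue. 0 < ennreal (1 / norm (fst z - snd z) powr (real DIM('a) + s * p)) \<longrightarrow> \<not> (\<psi> (fst z) > 0 \<and> u (snd z) > 0)"
    unfolding kernel_measure_def by (subst (asm) AE_density) auto
  then have ae: "AE z in lebesgue \<Otimes>\<^sub>M lebesgue. z \<notin> {x. \<psi> x > 0} \<times> {y. u y > 0}"
  proof eventually_elim
    case (elim z)
    show ?case
    proof
      assume "z \<in> {x. \<psi> x > 0} \<times> {y. u y > 0}"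
      then have z: "\<psi> (fst z) > 0" "u (snd z) > 0" by auto
      then have "fst z \<noteq> snd z" using \<psi>0(2)[of "fst z"] by auto
      then have "0 < ennreal (1 / norm (fst z - snd z) powr (real DIM('a) + s * p))" by simp
      with elim z show False by blast
    qed
  qed
  have "Measurable.pred lebesgue (\<lambda>x. \<psi> x > 0)" "Measurable.pred lebesgue (\<lambda>y. u y > 0)" by measurable
  then have A[measurable]: "{x. \<psi> x > 0} \<in> sets lebesgue" and P[measurable]: "{y. u y > 0} \<in> sets lebesgue"
    by (simp_all add: pred_def)
  have "{x. \<psi> x > 0} \<times> {y. u y > 0} \<in> null_sets (lebesgue \<Otimes>\<^sub>M lebesgue)"
    using ae A P by (subst (asm) AE_iff_null_sets[symmetric]) auto
  then have "emeasure lebesgue {x. \<psi> x > 0} * emeasure lebesgue {y. u y > 0} = 0"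
    using A P by (simp add: null_sets_def lebesgue.emeasure_pair_measure_Times del: emeasure_completion)
  moreover have "emeasure lebesgue {y. u y > 0} \<noteq> 0"
  proof
    assume "emeasure lebesgue {y. u y > 0} = 0"
    then have "{y. u y > 0} \<in> null_sets lebesgue" using P by (simp add: null_sets_def del: emeasure_completion)
    then have "AE y in lebesgue. y \<notin> {y. u y > 0}" by (rule AE_not_in)
    then have "AE y in lebesgue. \<bar>u y\<bar> powr p = 0" using u0 by (auto elim!: eventually_mono simp: order_less_le)
    then have "(\<integral>y. \<bar>u y\<bar> powr p \<partial>lebesgue) = 0" by (rule integral_eq_zero_AE)
    with nz show False ..
  qed
  ultimately have "emeasure lebesgue {x. \<psi> x > 0} = 0" by (simp del: emeasure_completion)
  then have "{x. \<psi> x > 0} \<in> null_sets lebesgue" using A by (simp add: null_sets_def del: emeasure_completion)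
  then have "AE x in lebesgue. x \<notin> {x. \<psi> x > 0}" by (rule AE_not_in)
  then show ?thesis
  proof eventually_elim
    case (elim x)
    show ?case
    proof (intro impI, rule ccontr)
      assume x: "x \<in> \<Omega>" "\<not> u x > 0"
      have "\<psi> x > 0" unfolding \<psi>0(3)[OF x(2)] by (rule dom_dist_pos[OF x(1)])
      with elim show False by simp
    qed
  qed
qed

lemma shifted_potential:
  assumes V: "V \<in> potentials q \<Omega>"
  shows "(\<lambda>x. V x - l * indicator \<Omega> x) \<in> potentials q \<Omega>"
    and "w \<in> X \<Longrightarrow> J (\<lambda>x. V x - l * indicator \<Omega> x) w = J V w - l * (\<integral>x. \<bar>w x\<bar> powr p \<partial>lebesgue)"
proof -
  show "(\<lambda>x. V x - l * indicator \<Omega> x) \<in> potentials q \<Omega>"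
    using potentials_lincomb[OF V indicator_potentials, of 1 "- l"] by simp
  assume w: "w \<in> X"
  have "(\<integral>x. (V x - l * indicator \<Omega> x) * \<bar>w x\<bar> powr p \<partial>lebesgue) = (\<integral>x. V x * \<bar>w x\<bar> powr p - l * \<bar>w x\<bar> powr p \<partial>lebesgue)"
    using zero_sobolevD(2)[OF w] by (intro Bochner_Integration.integral_cong) (auto simp: indicator_def algebra_simps)
  also have "\<dots> = (\<integral>x. V x * \<bar>w x\<bar> powr p \<partial>lebesgue) - l * (\<integral>x. \<bar>w x\<bar> powr p \<partial>lebesgue)"
    using potential_integrable[OF w V] zero_sobolevD(3)[OF w] by simp
  finally show "J (\<lambda>x. V x - l * indicator \<Omega> x) w = J V w - l * (\<integral>x. \<bar>w x\<bar> powr p \<partial>lebesgue)"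
    by (simp add: total_energy_def)
qed

text \<open>
  Passing from \<open>u\<close> to \<open>\<bar>u\<bar>\<close> does not increase \<open>J\<close>, so the common minimiser may be taken
  nonnegative, and then positive.
\<close>

lemma common_minimizer_imp_eq:
  assumes V: "V \<in> potentials q \<Omega>" and W: "W \<in> potentials q \<Omega>" and u: "u \<in> X1"
    and JV: "J V u \<le> l" and JW: "J W u \<le> l"
    and minV: "\<forall>v\<in>X1. l \<le> J V v" and minW: "\<forall>v\<in>X1. l \<le> J W v"
  shows "AE x in lebesgue. x \<in> \<Omega> \<longrightarrow> V x = W x"
proof -
  define v where "v x = \<bar>u x\<bar>" for x
  have uX: "u \<in> X" and u1: "(\<integral>x. \<bar>u x\<bar> powr p \<partial>lebesgue) = 1" using u by auto
  have v: "v \<in> X" "\<E> v \<le> \<E> u" using zero_sobolev_abs[OF uX p] by (auto simp: v_def[abs_def])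
  have v1: "(\<integral>x. \<bar>v x\<bar> powr p \<partial>lebesgue) = 1" using u1 by (simp add: v_def)
  have v0: "v x \<ge> 0" for x by (simp add: v_def)
  have Jv: "J Z v \<le> J Z u" for Z using v(2) by (simp add: total_energy_def v_def)
  define Z1 where "Z1 x = V x - l * indicator \<Omega> x" for x
  define Z2 where "Z2 x = W x - l * indicator \<Omega> x" for x
  have Z: "Z1 \<in> potentials q \<Omega>" "Z2 \<in> potentials q \<Omega>"
    using shifted_potential(1)[OF V] shifted_potential(1)[OF W] by (auto simp: Z1_def[abs_def] Z2_def[abs_def])
  have JZ1: "J Z1 w = J V w - l * (\<integral>x. \<bar>w x\<bar> powr p \<partial>lebesgue)" if "w \<in> X" for w
    using shifted_potential(2)[OF V that, of l] by (simp add: Z1_def[abs_def])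
  have JZ2: "J Z2 w = J W w - l * (\<integral>x. \<bar>w x\<bar> powr p \<partial>lebesgue)" if "w \<in> X" for w
    using shifted_potential(2)[OF W that, of l] by (simp add: Z2_def[abs_def])
  have nonneg: "\<forall>w\<in>X. 0 \<le> J Z1 w" "\<forall>w\<in>X. 0 \<le> J Z2 w"
    using J_ge_of_min[OF minV] J_ge_of_min[OF minW] by (auto simp: JZ1 JZ2)
  have zero: "J Z1 v = 0" "J Z2 v = 0"
    using nonneg v(1) Jv[of V] Jv[of W] JV JW by (auto simp: JZ1 JZ2 v1 intro!: antisym)
  have pos: "AE x in lebesgue. x \<in> \<Omega> \<longrightarrow> v x > 0"
    by (rule minimizer_positive[OF v(1) v0 _ Z(1) zero(1) nonneg(1)]) (simp add: v1)
  note [measurable] = zero_sobolevD(1)[OF v(1)] potentialsD(1)[OF Z(1)] potentialsD(1)[OF Z(2)]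
  define D where "D x = p * sgn (v x) * \<bar>v x\<bar> powr (p - 1)" for x
  define f where "f x = (Z1 x - Z2 x) * D x" for x
  have fm: "f \<in> borel_measurable lebesgue" unfolding f_def D_def by measurable
  have int: "integrable lebesgue (\<lambda>x. Z x * (D x * w x))" if "w \<in> X" "Z \<in> potentials q \<Omega>" for w Z
    unfolding D_def using that potential_integrable[OF v(1)] potential_integrable[OF that(1)]
    by (intro has_real_derivative_integral_powr(2)[OF p]) (auto dest: potentialsD zero_sobolevD)
  have test: "integrable lebesgue (\<lambda>x. f x * w x) \<and> (\<integral>x. f x * w x \<partial>lebesgue) = 0" if w: "w \<in> X" for w
  proof -
    have e: "f x * w x = Z1 x * (D x * w x) - Z2 x * (D x * w x)" for x by (simp add: f_def algebra_simps)
    have "(\<integral>x. Z1 x * (D x * w x) \<partial>lebesgue) = (\<integral>x. Z2 x * (D x * w x) \<partial>lebesgue)"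
      using euler_lagrange[OF v(1) w Z(1) zero(1) nonneg(1)] euler_lagrange[OF v(1) w Z(2) zero(2) nonneg(2)]
      by (simp add: D_def)
    then show ?thesis unfolding e using int[OF w Z(1)] int[OF w Z(2)] by simp
  qed
  have le: "AE x in lebesgue. x \<in> \<Omega> \<longrightarrow> f x \<le> 0"
    by (rule AE_nonpos_of_test_integrals[OF fm]) (use test in blast)
  have ge: "AE x in lebesgue. x \<in> \<Omega> \<longrightarrow> - f x \<le> 0"
    by (rule AE_nonpos_of_test_integrals) (use fm test in auto)
  from le ge pos show ?thesis
  proof eventually_elim
    case (elim x)
    show ?case
    proof
      assume x: "x \<in> \<Omega>"
      then have "f x = 0" "v x > 0" using elim by auto
      moreover then have "D x > 0" using p by (simp add: D_def)
      ultimately show "V x = W x" by (simp add: f_def Z1_def Z2_def)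
    qed
  qed
qed

lemma eigenvalue_max_unique:
  assumes sub: "\<C> \<subseteq> Lp_space q \<Omega>" and cv: "fun_convex \<C>" and V: "V \<in> \<C>" and W: "W \<in> \<C>"
    and maxV: "\<forall>U\<in>\<C>. eigenvalue s p \<Omega> U \<le> eigenvalue s p \<Omega> V"
    and maxW: "\<forall>U\<in>\<C>. eigenvalue s p \<Omega> U \<le> eigenvalue s p \<Omega> W"
  shows "AE x in lebesgue_on \<Omega>. W x = V x"
proof (cases "\<Omega> = {}")
  case True
  then show ?thesis by (auto intro!: AE_I2)
next
  case False
  note X1 = X1_nonempty[OF False]
  have VL: "V \<in> Lp_space q \<Omega>" and WL: "W \<in> Lp_space q \<Omega>" using V W sub by auto
  define U where "U x = (1/2) * V x + (1/2) * W x" for x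
  have UC: "U \<in> \<C>" unfolding U_def[abs_def] using cv V W unfolding fun_convex_def
    by (metis field_sum_of_halves less_eq_real_def half_gt_zero_iff zero_less_one)
  then have UL: "U \<in> Lp_space q \<Omega>" using sub by auto
  obtain u where u: "u \<in> X1" "eigenvalue s p \<Omega> U = ereal (J (zero_ext \<Omega> U) u)" "\<forall>w\<in>X1. J (zero_ext \<Omega> U) u \<le> J (zero_ext \<Omega> U) w"
    by (rule eigenvalue_attained[OF UL X1])
  obtain v where v: "v \<in> X1" "eigenvalue s p \<Omega> V = ereal (J (zero_ext \<Omega> V) v)" "\<forall>w\<in>X1. J (zero_ext \<Omega> V) v \<le> J (zero_ext \<Omega> V) w"
    by (rule eigenvalue_attained[OF VL X1])
  obtain w where w: "w \<in> X1" "eigenvalue s p \<Omega> W = ereal (J (zero_ext \<Omega> W) w)" "\<forall>v\<in>X1. J (zero_ext \<Omega> W) w \<le> J (zero_ext \<Omega> W) v"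
    by (rule eigenvalue_attained[OF WL X1])
  define l where "l = J (zero_ext \<Omega> V) v"
  have eq: "eigenvalue s p \<Omega> V = eigenvalue s p \<Omega> W" using maxV maxW V W by (auto intro: antisym)
  then have lW: "J (zero_ext \<Omega> W) w = l" using v(2) w(2) by (simp add: l_def)
  have minV: "\<forall>v\<in>X1. l \<le> J (zero_ext \<Omega> V) v" using v(3) by (simp add: l_def)
  have minW: "\<forall>v\<in>X1. l \<le> J (zero_ext \<Omega> W) v" using w(3) by (simp add: lW)
  have "J (zero_ext \<Omega> U) u \<le> l" using maxV UC u(2) v(2) by (metis ereal_less_eq(3) l_def)
  moreover have "J (zero_ext \<Omega> U) u = (1/2) * J (zero_ext \<Omega> V) u + (1/2) * J (zero_ext \<Omega> W) u"
    unfolding U_def[abs_def] using u(1) VL WL by (intro J_lincomb) auto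
  moreover have "l \<le> J (zero_ext \<Omega> V) u" "l \<le> J (zero_ext \<Omega> W) u" using minV minW u(1) by auto
  ultimately have "J (zero_ext \<Omega> V) u \<le> l" "J (zero_ext \<Omega> W) u \<le> l" by linarith+
  from common_minimizer_imp_eq[OF zero_ext_potentials[OF VL] zero_ext_potentials[OF WL] u(1) this minV minW]
  have "AE x in lebesgue. x \<in> \<Omega> \<longrightarrow> W x = V x"
    by (auto elim!: eventually_mono simp: zero_ext_def)
  then show ?thesis by (simp add: AE_restrict_space_iff)
qed

end

theorem theorem5p1:
  fixes s p q :: real
    and \<Omega> :: "(real ^ 'n) set"
    and \<C> :: "(real ^ 'n \<Rightarrow> real) set"
  assumes "0 < s" and "s < 1" and "1 < p"
    and "bounded \<Omega>" and "extension_domain s p \<Omega>"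
    and "1 < q" and "real CARD('n) / (s * p) < q"
    and "\<C> \<subseteq> Lp_space q \<Omega>" and "\<C> \<noteq> {}"
    and "Lp_bounded q \<Omega> \<C>" and "Lp_closed q \<Omega> \<C>" and "fun_convex \<C>"
  shows "(\<exists>Vmax\<in>\<C>. (\<forall>V\<in>\<C>. eigenvalue s p \<Omega> V \<le> eigenvalue s p \<Omega> Vmax) \<and>
            (\<forall>W\<in>\<C>. (\<forall>V\<in>\<C>. eigenvalue s p \<Omega> V \<le> eigenvalue s p \<Omega> W) \<longrightarrow>
               (AE x in lebesgue_on \<Omega>. W x = Vmax x))) \<and>
         (\<exists>Vmin\<in>\<C>. \<forall>V\<in>\<C>. eigenvalue s p \<Omega> Vmin \<le> eigenvalue s p \<Omega> V)"
proof -
  interpret fractional_eigenvalue_problem s p q \<Omega>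
    using assms by unfold_locales (auto simp: extension_domain_def)
  note \<C> = assms(8-12)
  obtain V where V: "V \<in> \<C>" "\<forall>W\<in>\<C>. eigenvalue s p \<Omega> W \<le> eigenvalue s p \<Omega> V"
    using eigenvalue_max_exists[OF \<C>] by blast
  have "\<forall>W\<in>\<C>. (\<forall>V\<in>\<C>. eigenvalue s p \<Omega> V \<le> eigenvalue s p \<Omega> W) \<longrightarrow> (AE x in lebesgue_on \<Omega>. W x = V x)"
    using eigenvalue_max_unique[OF \<C>(1,5) V(1) _ V(2)] by blast
  moreover have "\<exists>Vmin\<in>\<C>. \<forall>V\<in>\<C>. eigenvalue s p \<Omega> Vmin \<le> eigenvalue s p \<Omega> V"
  proof (cases "\<Omega> = {}")
    case True
    \<comment> \<open>no function is admissible, and every eigenvalue is an infimum over the empty set\<close>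
    have empty: "X1 = {}"
    proof -
      have "v \<notin> X1" for v
      proof
        assume v: "v \<in> X1"
        then have "v x = 0" for x using zero_sobolevD(2)[of v s p \<Omega> x] True by auto
        with v show False by simp
      qed
      then show ?thesis by blast
    qed
    then have "eigenvalue s p \<Omega> V = \<infinity>" for V unfolding eigenvalue_INF empty by (simp add: top_ereal_def)
    then show ?thesis using \<C>(2) by auto
  next
    case False
    show ?thesis by (rule eigenvalue_min_exists[OF \<C> X1_nonempty[OF False]])
  qed
  ultimately show ?thesis using V by blast
qed

end
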